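(* For every $B\ge1$ there is a constant $C(B)$ such that the following holds. Let $n,k,r$ be integers with \[ n\ge k\ge r\ge 3,\qquad n\le r^{10},\qquad k\ge r\log^2\!\left(\frac{en}{r}\right), \] let $V\subset\mathbb R^n$ be a fixed $r$-dimensional subspace, let $U_V:\mathbb R^r\to\mathbb R^n$ be a linear isometry with range $V$, and let $\xi$ be a centered real random variable with $|\xi|\le1$ almost surely. 1. If $(\log k)/k\le p\le 1$ and the $k\times n$ matrix $\Pi$ follows the i.i.d. sparse-entry model with parameters $p$ and $\xi$, then $\mathbb P\{\|\Pi U_V\|>C(B)\sqrt{kp}\}\le k^{-B}$. 2. If $\lceil\log k\rceil\le d\le k$ and $\Pi$ follows the fixed-column-degree sparse-entry model with parameters $d$ and $\xi$, then $\mathbb P\{\|\Pi U_V\|>C(B)\sqrt{d}\}\le k^{-B}$. 3. If $s\mid k$, $\lceil\log k\rceil\le s\le k$, and $\Pi$ follows the unnormalized SparseStack$^{\mathsf T}$ model with parameters $s$ and $\xi$, then $\mathbb P\{\|\Pi U_V\|>C(B)\sqrt{s}\}\le k^{-B}$.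
   Context: $[m]=\{1,\dots,m\}$; $\|\cdot\|$ is the spectral norm. In all three models $\pi_{ui}=\eta_{ui}\xi_{ui}$ for $u\in[k]$, $i\in[n]$, where the $\xi_{ui}$ are independent copies of $\xi$, independent of the $\{0,1\}$-valued array $\eta=(\eta_{ui})$. I.i.d. sparse-entry model with parameters $p,\xi$: the $\eta_{ui}$ are independent Bernoulli($p$) variables. Fixed-column-degree sparse-entry model with parameters $d,\xi$ ($1\le d\le k$ integer): independently for every column $i\in[n]$ choose a uniformly random set $S_i\subset[k]$ of cardinality $d$, and set $\eta_{ui}=\mathbf 1_{\{u\in S_i\}}$. Unnormalized SparseStack$^{\mathsf T}$ model with parameters $s,\xi$ ($1\le s\le k$ integer dividing $k$): partition $[k]$ into sets $B_1,\dots,B_s$ of cardinality $k/s$; independently for every $\ell\in[s]$, $i\in[n]$ choose $U_{\ell i}$ uniformly from $B_\ell$, and set $\eta_{ui}=\mathbf 1_{\{u=U_{\ell i}\}}$ for $u\in B_\ell$. *)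

theory Defs
  imports "HOL-Probability.Probability" "Jordan_Normal_Form.VS_Connect"
begin

definition euclidean_norm :: "real Matrix.vec \<Rightarrow> real" where
  "euclidean_norm v = sqrt (scalar_prod v v)"

definition spectral_norm :: "real Matrix.mat \<Rightarrow> real" where
  "spectral_norm A =
     (SUP x \<in> {x \<in> carrier_vec (dim_col A). euclidean_norm x \<le> 1}. euclidean_norm (A *\<^sub>v x))"

definition subspace_of_dim :: "nat \<Rightarrow> nat \<Rightarrow> real Matrix.vec set \<Rightarrow> bool" where
  "subspace_of_dim n r V \<longleftrightarrow>
     VectorSpace.subspace class_ring V (module_vec TYPE(real) n) \<and>
     vectorspace.dim class_ring ((module_vec TYPE(real) n)\<lparr>carrier := V\<rparr>) = r"

text \<open>A linear map from \<open>\<real>\<^sup>r\<close> to \<open>\<real>\<^sup>n\<close> is represented by its \<open>n \<times> r\<close> matrix.\<close>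

definition isometry_with_range :: "nat \<Rightarrow> nat \<Rightarrow> real Matrix.vec set \<Rightarrow> real Matrix.mat \<Rightarrow> bool" where
  "isometry_with_range n r V U \<longleftrightarrow>
     U \<in> carrier_mat n r \<and>
     (\<forall>x \<in> carrier_vec r. euclidean_norm (U *\<^sub>v x) = euclidean_norm x) \<and>
     (\<lambda>x. U *\<^sub>v x) ` carrier_vec r = V"

text \<open>
  The law \<open>\<mu>\<close> of a centered real random variable bounded by 1 almost surely.
  Boundedness makes the identity integrable, so the Bochner integral is the actual mean.
\<close>

definition centered_bounded_law :: "real measure \<Rightarrow> bool" where
  "centered_bounded_law \<mu> \<longleftrightarrow>
     prob_space \<mu> \<and> sets \<mu> = sets borel \<and> (AE x in \<mu>. \<bar>x\<bar> \<le> 1) \<and> (\<integral>x. x \<partial>\<mu>) = 0"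

text \<open>
  Everything below is stated for laws. This keeps the constant in the theorem independent of
  the probability space (hence of its type) on which the random matrix is realised.

  Rows are indexed by \<open>{..<k}\<close> and columns by \<open>{..<n}\<close>. Given the law \<open>H\<close> of the random support
  pattern \<open>\<eta>\<close> and the law \<open>\<mu>\<close> of \<open>\<xi>\<close>, the following is the joint law of the entries
  \<open>\<eta> (u, i) * \<xi> (u, i)\<close>. The product measure makes the \<open>\<xi> (u, i)\<close> independent copies of \<open>\<xi>\<close>
  which are independent of \<open>\<eta>\<close>.
\<close>

definition sparse_entry_law ::
  "nat \<Rightarrow> nat \<Rightarrow> (nat \<times> nat \<Rightarrow> bool) pmf \<Rightarrow> real measure \<Rightarrow> (nat \<times> nat \<Rightarrow> real) measure" where
  "sparse_entry_law k n H \<mu> =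
     distr (measure_pmf H \<Otimes>\<^sub>M PiM ({..<k} \<times> {..<n}) (\<lambda>_. \<mu>))
       (PiM ({..<k} \<times> {..<n}) (\<lambda>_. borel))
       (\<lambda>(\<eta>, \<xi>). \<lambda>ui \<in> {..<k} \<times> {..<n}. of_bool (\<eta> ui) * \<xi> ui)"

lemma prob_space_sparse_entry_law:
  assumes "prob_space \<mu>" "sets \<mu> = sets borel"
  shows "prob_space (sparse_entry_law k n H \<mu>)"
proof -
  let ?I = "{..<k} \<times> {..<n}"
  interpret P: prob_space "PiM ?I (\<lambda>_. \<mu>)"
    using assms(1) by (intro prob_space_PiM) auto
  interpret Q: pair_prob_space "measure_pmf H" "PiM ?I (\<lambda>_. \<mu>)" ..
  have *: "(\<lambda>\<omega>. snd \<omega> ui) \<in> borel_measurable (measure_pmf H \<Otimes>\<^sub>M PiM ?I (\<lambda>_. \<mu>))" 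
    if "ui \<in> ?I" for ui
    using measurable_compose[OF measurable_snd measurable_component_singleton[OF that]]
      measurable_cong_sets[OF refl assms(2)] by blast
  have "(\<lambda>(\<eta>, \<xi>). \<lambda>ui \<in> ?I. (of_bool (\<eta> ui) :: real) * \<xi> ui)
          \<in> measurable (measure_pmf H \<Otimes>\<^sub>M PiM ?I (\<lambda>_. \<mu>)) (PiM ?I (\<lambda>_. borel))"
    unfolding case_prod_beta
    by (intro measurable_restrict borel_measurable_times *
        measurable_compose[OF measurable_fst]) auto
  then show ?thesis
    unfolding sparse_entry_law_def by (rule Q.prob_space_distr)
qed

definition iid_pattern :: "nat \<Rightarrow> nat \<Rightarrow> real \<Rightarrow> (nat \<times> nat \<Rightarrow> bool) pmf" where
  "iid_pattern k n p = Pi_pmf ({..<k} \<times> {..<n}) False (\<lambda>_. bernoulli_pmf p)"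

definition fixed_degree_pattern :: "nat \<Rightarrow> nat \<Rightarrow> nat \<Rightarrow> (nat \<times> nat \<Rightarrow> bool) pmf" where
  "fixed_degree_pattern k n d =
     map_pmf (\<lambda>S (u, i). u \<in> S i)
       (Pi_pmf {..<n} {} (\<lambda>_. pmf_of_set {T. T \<subseteq> {..<k} \<and> card T = d}))"

definition equal_blocks :: "nat \<Rightarrow> nat \<Rightarrow> (nat \<Rightarrow> nat set) \<Rightarrow> bool" where
  "equal_blocks k s blk \<longleftrightarrow>
     disjoint_family_on blk {..<s} \<and> (\<Union>l<s. blk l) = {..<k} \<and> (\<forall>l<s. card (blk l) = k div s)"

definition sparse_stack_pattern ::
  "nat \<Rightarrow> nat \<Rightarrow> nat \<Rightarrow> (nat \<Rightarrow> nat set) \<Rightarrow> (nat \<times> nat \<Rightarrow> bool) pmf" where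
  "sparse_stack_pattern k n s blk =
     map_pmf (\<lambda>pos (u, i). \<exists>l<s. u \<in> blk l \<and> u = pos (l, i))
       (Pi_pmf ({..<s} \<times> {..<n}) 0 (\<lambda>(l, i). pmf_of_set (blk l)))"

end

theory Submission
  imports Defs
begin

text \<open>
  Write \<open>q\<close> for \<open>p\<close>, \<open>d/k\<close> or \<open>s/k\<close> and \<open>D = k q\<close>. In all three models
  \<open>E \<Prod>(1 + \<eta> f) \<le> exp (q \<Sum>f)\<close> for \<open>f \<ge> 0\<close>, so linear forms in the entries have Bernstein tails,
  as if the entries were independent.

  To bound \<open>\<Sum>z\<^sub>u \<pi>\<^sub>u\<^sub>i \<langle>U\<^sub>i, v\<rangle>\<close> uniformly in the unit vectors \<open>z\<close> and \<open>v\<close>, round \<open>z\<close> to powers of 2 and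
  approximate \<open>v\<close> greedily by multiples of the normalised rows \<open>U\<^sub>i / \<bar>U\<^sub>i\<bar>\<close> with halving step sizes.
  Each greedy step lowers the squared norm of the residual, so the approximation at step size \<open>t\<close> costs
  only \<open>1/t\<^sup>2\<close> atoms, and the residual \<open>w\<close> satisfies \<open>\<bar>\<langle>U\<^sub>i, w\<rangle>\<bar> \<le> t \<bar>U\<^sub>i\<bar>\<close> in every coordinate. At scale
  \<open>2\<^sup>-\<^sup>l\<close> the coefficients are truncated at order \<open>sqrt D * 4\<^sup>-\<^sup>l\<close>. The truncated part is controlled by
  Bernstein's inequality and a union bound in which the entropy of the finer scales is matched by their
  smaller truncation level; what is cut off is bounded deterministically by the column degrees
  \<open>\<Sum>\<^sub>u \<eta>\<^sub>u\<^sub>i\<close> and the row weights \<open>\<Sum>\<^sub>i \<eta>\<^sub>u\<^sub>i \<bar>U\<^sub>i\<bar>\<^sup>2\<close>.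
\<close>

section \<open>Matching pursuit and dyadic rounding\<close>

text \<open>A net at a single scale has entropy of order \<open>k\<close>, so Bernstein's inequality
  at deviation \<open>sqrt D\<close> tolerates only coefficients of order \<open>sqrt D / k\<close>.
  A product \<open>z u * y i\<close> can be far larger, and column degrees pay for it only if
  \<open>y i\<close> exceeds \<open>z u\<close> by a factor of about \<open>sqrt D\<close>. Hence a
  cutoff of order \<open>sqrt D\<close> times the square of \<open>z u\<close>, and hence many
  scales: at most \<open>5 * 4 ^ b\<close> coordinates have size \<open>(1/2) ^ b\<close>, and so
  few are cheap enough to describe for the larger cutoff to be affordable. The second obstacle is
  that \<open>v\<close> meets \<open>n\<close> columns, possibly many more than \<open>k\<close>,
  and naming one atom costs about \<open>ln (n/k)\<close>. With steps
  \<open>(1/2) ^ l / sqrt \<rho>\<close>, where \<open>\<rho>\<close> bounds the squared row norms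
  in a block of columns, at most \<open>5 * \<rho> * 4 ^ l\<close> atoms are used at scale
  \<open>l\<close>. In the block of small rows \<open>\<rho> = r/k\<close>, and the lower bound on
  \<open>k\<close> keeps \<open>\<rho> * ln (n/k)\<close> at most 1; the block of large rows has at
  most \<open>k\<close> members, so there the logarithm disappears.\<close>

definition ip :: "nat \<Rightarrow> (nat \<Rightarrow> real) \<Rightarrow> (nat \<Rightarrow> real) \<Rightarrow> real" where
  "ip r x y = (\<Sum>j<r. x j * y j)"

lemma ip_self_nonneg [simp]: "0 \<le> ip r x x"
  by (simp add: ip_def sum_nonneg)

lemma ip_diff_right: "ip r x (\<lambda>j. y j - z j) = ip r x y - ip r x z"
  by (simp add: ip_def algebra_simps sum_subtractf)

lemma ip_diff_self_le:
  "ip r (\<lambda>j. x j - y j) (\<lambda>j. x j - y j) \<le> 2 * ip r x x + 2 * ip r y y"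
proof -
  have "(x j - y j) * (x j - y j) \<le> 2 * (x j * x j) + 2 * (y j * y j)" for j
    using zero_le_square[of "x j + y j"] by (simp add: algebra_simps)
  then show ?thesis
    unfolding ip_def sum_distrib_left sum.distrib[symmetric] by (intro sum_mono)
qed

lemma ip_shift_self:
  "ip r (\<lambda>j. x j - c * y j) (\<lambda>j. x j - c * y j) = ip r x x - 2 * c * ip r y x + c\<^sup>2 * ip r y y"
proof -
  have "(x j - c * y j) * (x j - c * y j) = x j * x j - 2 * c * (y j * x j) + c\<^sup>2 * (y j * y j)" for j
    by (simp add: power2_eq_square algebra_simps)
  then show ?thesis
    by (simp add: ip_def sum.distrib sum_subtractf sum_distrib_left)
qed

text \<open>Matching pursuit with a fixed step: as long as some correlation exceeds \<open>t\<close>, subtracting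
  \<open>\<plusminus>t\<close> times that atom lowers the squared norm by at least \<open>t\<^sup>2\<close>.\<close>

lemma matching_pursuit:
  fixes e :: "'i \<Rightarrow> nat \<Rightarrow> real"
  assumes J: "finite J" and e: "\<And>i. i \<in> J \<Longrightarrow> ip r (e i) (e i) \<le> 1" and t: "t > 0"
  shows "\<exists>N :: 'i \<Rightarrow> int.
    (\<forall>i\<in>J. \<bar>ip r (e i) (\<lambda>j. x j - t * (\<Sum>i\<in>J. of_int (N i) * e i j))\<bar> \<le> t) \<and>
    ip r (\<lambda>j. x j - t * (\<Sum>i\<in>J. of_int (N i) * e i j)) (\<lambda>j. x j - t * (\<Sum>i\<in>J. of_int (N i) * e i j))
      + t\<^sup>2 * (\<Sum>i\<in>J. \<bar>of_int (N i)\<bar>) \<le> ip r x x"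
\<comment> \<open>The squared norm in units of \<open>t\<^sup>2\<close> loses at least 1 per step,
  so its floor bounds the length of the pursuit.\<close>
proof (induction "nat \<lfloor>ip r x x / t\<^sup>2\<rfloor>" arbitrary: x rule: less_induct)
  case less
  show ?case
  proof (cases "\<forall>i\<in>J. \<bar>ip r (e i) x\<bar> \<le> t")
    case True
    then show ?thesis by (intro exI[of _ "\<lambda>_. 0"]) simp
  next
    case False
    then obtain i0 where i0: "i0 \<in> J" "t < \<bar>ip r (e i0) x\<bar>" by force
    define s :: int where "s = (if ip r (e i0) x > 0 then 1 else - 1)"
    define x' where "x' = (\<lambda>j. x j - (t * of_int s) * e i0 j)"
    have "ip r x' x' = ip r x x - 2 * t * \<bar>ip r (e i0) x\<bar> + t\<^sup>2 * ip r (e i0) (e i0)"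
      unfolding x'_def ip_shift_self by (auto simp: s_def abs_if)
    also have "\<dots> \<le> ip r x x - 2 * t * t + t\<^sup>2 * 1"
      using i0 e[of i0] t by (intro add_mono diff_mono mult_left_mono) auto
    finally have dec: "ip r x' x' \<le> ip r x x - t\<^sup>2" by (simp add: power2_eq_square)
    have "ip r x' x' / t\<^sup>2 \<le> ip r x x / t\<^sup>2 - 1"
      using divide_right_mono[OF dec, of "t\<^sup>2"] t by (simp add: diff_divide_distrib)
    moreover have "0 \<le> ip r x' x' / t\<^sup>2" by simp
    ultimately have "nat \<lfloor>ip r x' x' / t\<^sup>2\<rfloor> < nat \<lfloor>ip r x x / t\<^sup>2\<rfloor>" by linarith
    from less[OF this] obtain N where
      N: "\<forall>i\<in>J. \<bar>ip r (e i) (\<lambda>j. x' j - t * (\<Sum>i\<in>J. of_int (N i) * e i j))\<bar> \<le> t"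
      "ip r (\<lambda>j. x' j - t * (\<Sum>i\<in>J. of_int (N i) * e i j))
        (\<lambda>j. x' j - t * (\<Sum>i\<in>J. of_int (N i) * e i j)) + t\<^sup>2 * (\<Sum>i\<in>J. \<bar>of_int (N i)\<bar>) \<le> ip r x' x'"
      by blast
    define N' where "N' = N(i0 := N i0 + s)"
    have split: "(\<Sum>i\<in>J. g i) = g i0 + (\<Sum>i\<in>J - {i0}. g i)" for g :: "'i \<Rightarrow> real"
      using J i0 by (simp add: sum.remove)
    have "(\<Sum>i\<in>J. of_int (N' i) * e i j) = (\<Sum>i\<in>J. of_int (N i) * e i j) + of_int s * e i0 j" for j
      unfolding split by (auto simp: N'_def algebra_simps intro!: sum.cong)
    then have eq: "x j - t * (\<Sum>i\<in>J. of_int (N' i) * e i j) = x' j - t * (\<Sum>i\<in>J. of_int (N i) * e i j)" for j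
      by (simp add: x'_def algebra_simps)
    have "(\<Sum>i\<in>J. \<bar>of_int (N' i)\<bar>) \<le> (\<Sum>i\<in>J. \<bar>of_int (N i)\<bar>) + (1::real)"
    proof -
      have "(\<Sum>i\<in>J - {i0}. \<bar>of_int (N' i)\<bar>) = (\<Sum>i\<in>J - {i0}. \<bar>of_int (N i) :: real\<bar>)"
        by (intro sum.cong) (auto simp: N'_def)
      moreover have "\<bar>of_int (N' i0)\<bar> \<le> \<bar>of_int (N i0) :: real\<bar> + 1"
        by (auto simp: N'_def s_def)
      ultimately show ?thesis unfolding split by linarith
    qed
    then have "t\<^sup>2 * (\<Sum>i\<in>J. \<bar>of_int (N' i)\<bar>) \<le> t\<^sup>2 * ((\<Sum>i\<in>J. \<bar>of_int (N i)\<bar>) + 1)"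
      by (intro mult_left_mono) auto
    then have "ip r (\<lambda>j. x' j - t * (\<Sum>i\<in>J. of_int (N i) * e i j))
        (\<lambda>j. x' j - t * (\<Sum>i\<in>J. of_int (N i) * e i j)) + t\<^sup>2 * (\<Sum>i\<in>J. \<bar>of_int (N' i)\<bar>) \<le> ip r x x"
      using N(2) dec unfolding distrib_left by linarith
    with N(1) show ?thesis
      by (intro exI[of _ N'], unfold eq) (rule conjI)
  qed
qed

text \<open>Each level restarts the pursuit from the residual of the previous one. The norm losses
  telescope, so one budget \<open>ip r x x\<close> pays for the atoms of all levels
  together.\<close>

lemma matching_pursuit_levels:
  fixes e :: "'i \<Rightarrow> nat \<Rightarrow> real" and t :: "nat \<Rightarrow> real"
  assumes J: "finite J" and e: "\<And>i. i \<in> J \<Longrightarrow> ip r (e i) (e i) \<le> 1" and t: "\<And>l. t l > 0"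
  obtains N :: "nat \<Rightarrow> 'i \<Rightarrow> int" and w :: "nat \<Rightarrow> nat \<Rightarrow> real" where
    "w 0 = x"
    "\<And>l j. w (Suc l) j = w l j - t l * (\<Sum>i\<in>J. of_int (N l i) * e i j)"
    "\<And>l i. i \<in> J \<Longrightarrow> \<bar>ip r (e i) (w (Suc l))\<bar> \<le> t l"
    "\<And>l. ip r (w l) (w l) + (\<Sum>l'<l. (t l')\<^sup>2 * (\<Sum>i\<in>J. \<bar>of_int (N l' i)\<bar>)) \<le> ip r x x"
proof -
  define Q where "Q l x N \<longleftrightarrow>
    (\<forall>i\<in>J. \<bar>ip r (e i) (\<lambda>j. x j - t l * (\<Sum>i\<in>J. of_int (N i) * e i j))\<bar> \<le> t l) \<and>
    ip r (\<lambda>j. x j - t l * (\<Sum>i\<in>J. of_int (N i) * e i j)) (\<lambda>j. x j - t l * (\<Sum>i\<in>J. of_int (N i) * e i j))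
      + (t l)\<^sup>2 * (\<Sum>i\<in>J. \<bar>of_int (N i)\<bar>) \<le> ip r x x" for l x and N :: "'i \<Rightarrow> int"
  define P where "P l x = (SOME N. Q l x N)" for l x
  have "\<exists>N. Q l x N" for l x
    unfolding Q_def by (intro matching_pursuit J t e)
  then have P: "Q l x (P l x)" for l x
    unfolding P_def by (rule someI_ex)
  define w where "w = rec_nat x (\<lambda>l v j. v j - t l * (\<Sum>i\<in>J. of_int (P l v i) * e i j))"
  have w0: "w 0 = x" and wS: "\<And>l. w (Suc l) = (\<lambda>j. w l j - t l * (\<Sum>i\<in>J. of_int (P l (w l) i) * e i j))"
    by (simp_all add: w_def)
  have "ip r (w l) (w l) + (\<Sum>l'<l. (t l')\<^sup>2 * (\<Sum>i\<in>J. \<bar>of_int (P l' (w l') i)\<bar>)) \<le> ip r x x" for l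
  proof (induction l)
    case (Suc l)
    have "ip r (w (Suc l)) (w (Suc l)) + (t l)\<^sup>2 * (\<Sum>i\<in>J. \<bar>of_int (P l (w l) i)\<bar>) \<le> ip r (w l) (w l)"
      using P[of l "w l"] unfolding Q_def wS by simp
    with Suc show ?case by simp
  qed (simp add: w0)
  moreover have "i \<in> J \<Longrightarrow> \<bar>ip r (e i) (w (Suc l))\<bar> \<le> t l" for l i
    using P[of l "w l"] unfolding Q_def wS by simp
  ultimately show ?thesis
    using w0 wS by (intro that[of w "\<lambda>l. P l (w l)"]) simp_all
qed

lemma dyadic_above:
  assumes "\<bar>z\<bar> \<le> (1::real)"
  shows "\<exists>a\<le>K. \<bar>z\<bar> \<le> (1/2) ^ a \<and> (1/4) ^ a \<le> 4 * z\<^sup>2 + (1/4) ^ K"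
proof -
  have "\<exists>a\<le>K. \<bar>z\<bar> \<le> (1/2) ^ a \<and> (a = K \<or> (1/4) ^ a \<le> 4 * z\<^sup>2)"
  proof (induction K)
    case 0
    then show ?case using assms by auto
  next
    case (Suc K)
    show ?case
    proof (cases "\<bar>z\<bar> \<le> (1/2) ^ Suc K")
      case True
      then show ?thesis by blast
    next
      case False
      then have "((1/2) ^ Suc K)\<^sup>2 \<le> \<bar>z\<bar>\<^sup>2" by (intro power_mono) auto
      then have "(1/4) ^ K \<le> 4 * z\<^sup>2"
        by (simp add: power_mult_distrib power2_eq_square power_divide flip: power_mult_distrib)
      moreover obtain a where "a \<le> K" "\<bar>z\<bar> \<le> (1/2) ^ a" "a = K \<or> (1/4) ^ a \<le> 4 * z\<^sup>2"
        using Suc by blast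
      ultimately show ?thesis by (intro exI[of _ a]) auto
    qed
  qed
  then obtain a where "a \<le> K" "\<bar>z\<bar> \<le> (1/2) ^ a" "a = K \<or> (1/4) ^ a \<le> 4 * z\<^sup>2" by blast
  moreover have "0 \<le> 4 * z\<^sup>2" "0 \<le> (1/4 :: real) ^ K" by simp_all
  ultimately have "(1/4) ^ a \<le> 4 * z\<^sup>2 + (1/4) ^ K" by (elim disjE) (simp, linarith)
  with \<open>a \<le> K\<close> \<open>\<bar>z\<bar> \<le> (1/2) ^ a\<close> show ?thesis by blast
qed

text \<open>Rounding \<open>|z u|\<close> up to a power of 2 at most quadruples its square, and the
  coordinates stopped at the exponent \<open>K\<close> add at most \<open>m * (1/4) ^ K\<close>,
  hence the total 4 + 1. Rounding upwards is what later allows vectors to be replaced by dyadic ones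
  without an error term.\<close>

lemma dyadic_rounding:
  fixes z :: "nat \<Rightarrow> real"
  assumes "m \<le> 4 ^ K" "(\<Sum>u<m. (z u)\<^sup>2) \<le> 1"
  obtains a :: "nat \<Rightarrow> nat" where "\<And>u. u < m \<Longrightarrow> a u \<le> K" "\<And>u. u < m \<Longrightarrow> \<bar>z u\<bar> \<le> (1/2) ^ a u"
    "(\<Sum>u<m. (1/4 :: real) ^ a u) \<le> 5"
proof -
  have "\<bar>z u\<bar> \<le> 1" if "u < m" for u
  proof -
    have "(z u)\<^sup>2 \<le> (\<Sum>u<m. (z u)\<^sup>2)" using that by (intro member_le_sum) auto
    with assms(2) have "\<bar>z u\<bar>\<^sup>2 \<le> 1\<^sup>2" by simp
    then show ?thesis by (rule power2_le_imp_le) simp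
  qed
  then have "\<forall>u. \<exists>a. u < m \<longrightarrow> a \<le> K \<and> \<bar>z u\<bar> \<le> (1/2) ^ a \<and> (1/4) ^ a \<le> 4 * (z u)\<^sup>2 + (1/4) ^ K"
    using dyadic_above by blast
  then obtain a where a: "\<And>u. u < m \<Longrightarrow> a u \<le> K \<and> \<bar>z u\<bar> \<le> (1/2) ^ a u \<and> (1/4) ^ a u \<le> 4 * (z u)\<^sup>2 + (1/4) ^ K"
    by metis
  have "(\<Sum>u<m. (1/4 :: real) ^ a u) \<le> (\<Sum>u<m. 4 * (z u)\<^sup>2 + (1/4) ^ K)"
    using a by (intro sum_mono) auto
  also have "\<dots> = 4 * (\<Sum>u<m. (z u)\<^sup>2) + real m * (1/4) ^ K"
    by (simp add: sum.distrib sum_distrib_left)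
  also have "real m * (1/4) ^ K \<le> real (4 ^ K) * (1/4) ^ K"
    using assms(1) by (intro mult_right_mono) (simp_all only: of_nat_le_iff, auto)
  also have "\<dots> = 1" by (simp add: power_divide)
  finally show ?thesis using a assms(2) by (intro that[of a]) auto
qed

text \<open>A term survives only if \<open>(1/2) ^ l < c / m\<close>. The first surviving term is
  thus at most \<open>c * c / m\<close>, and the later ones form a geometric tail.\<close>

lemma geometric_truncated_sum:
  assumes "c \<ge> 0" "m > 0"
  shows "(\<Sum>l<L. if m * (1/4) ^ l < c * (1/2) ^ l then c * (1/2) ^ l else 0) \<le> 2 * c\<^sup>2 / (m :: real)"
proof -
  let ?S = "{l. l < L \<and> m * (1/4) ^ l < c * (1/2) ^ l}"
  have iff: "m * (1/4) ^ l < c * (1/2) ^ l \<longleftrightarrow> m * (1/2) ^ l < c" for l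
  proof -
    have "(1/4 :: real) ^ l = (1/2) ^ l * (1/2) ^ l" by (simp flip: power_mult_distrib)
    then show ?thesis by (simp add: mult.assoc[symmetric])
  qed
  have eq: "(\<Sum>l<L. if m * (1/4) ^ l < c * (1/2) ^ l then c * (1/2) ^ l else 0) = (\<Sum>l\<in>?S. c * (1/2) ^ l)"
    by (rule sum.mono_neutral_cong_right) auto
  show ?thesis
  proof (cases "?S = {}")
    case True
    show ?thesis unfolding eq True using assms by simp
  next
    case False
    define l0 where "l0 = Min ?S"
    have l0: "l0 \<in> ?S" unfolding l0_def using False by (intro Min_in) auto
    have "?S \<subseteq> {l0..<L}" unfolding l0_def by auto
    then have "(\<Sum>l\<in>?S. c * (1/2) ^ l) \<le> (\<Sum>l\<in>{l0..<L}. c * (1/2) ^ l)"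
      using assms by (intro sum_mono2) auto
    also have "\<dots> = c * (\<Sum>l\<in>{l0..<L}. (1/2) ^ l)" by (simp add: sum_distrib_left)
    also have "(\<Sum>l\<in>{l0..<L}. (1/2 :: real) ^ l) \<le> 2 * (1/2) ^ l0"
    proof -
      have "(\<Sum>l\<in>{l0..<l0 + m}. (1/2 :: real) ^ l) = 2 * (1/2) ^ l0 - 2 * (1/2) ^ (l0 + m)" for m
        by (induction m) (simp_all add: algebra_simps)
      from this[of "L - l0"] l0 show ?thesis by simp
    qed
    also have "c * (2 * (1/2) ^ l0) \<le> c * (2 * (c / m))"
      using l0 assms iff[of l0] by (intro mult_left_mono) (auto simp: field_simps)
    also have "\<dots> = 2 * c\<^sup>2 / m" by (simp add: power2_eq_square)
    finally show ?thesis unfolding eq using assms by (simp add: mult_left_mono)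
  qed
qed

text \<open>The factor 4 per level outweighs the denominators, which shrink by at most a factor 2
  per level: the coarsest level \<open>b\<close> dominates.\<close>

lemma weighted_level_sum:
  assumes "b \<le> K"
  shows "(\<Sum>l=b..K. (1/4 :: real) ^ l / (1 + real (K - l))) \<le> 2 * (1/4) ^ b / (1 + real (K - b))"
  using assms
proof (induction b rule: inc_induct)
  case base
  then show ?case by simp
next
  case (step b)
  have "(\<Sum>l=b..K. (1/4 :: real) ^ l / (1 + real (K - l)))
      = (1/4) ^ b / (1 + real (K - b)) + (\<Sum>l=Suc b..K. (1/4 :: real) ^ l / (1 + real (K - l)))"
    using step by (subst sum.atLeast_Suc_atMost) auto
  also have "\<dots> \<le> (1/4) ^ b / (1 + real (K - b)) + 2 * (1/4) ^ Suc b / (1 + real (K - Suc b))"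
    using step by simp
  also have "\<dots> \<le> 2 * (1/4) ^ b / (1 + real (K - b))"
  proof -
    obtain d where d: "K - b = Suc d" using step by (metis Suc_diff_Suc)
    then have d': "K - Suc b = d" by simp
    have "1 / (2 * (1 + real d)) \<le> 1 / (2 + real d)" by (intro divide_left_mono) auto
    then have "(1/4) ^ b * (1 / (2 * (1 + real d))) \<le> (1/4 :: real) ^ b * (1 / (2 + real d))"
      by (intro mult_left_mono) auto
    then show ?thesis unfolding d d' by (simp add: field_simps)
  qed
  finally show ?case .
qed

lemma sum_power_reversed_le:
  assumes "0 < (x::real)" "x < 1"
  shows "(\<Sum>l\<le>K. x ^ (K - l)) \<le> 1 / (1 - x)"
proof (induction K)
  case 0
  then show ?case using assms by simp
next
  case (Suc K)
  have "(\<Sum>l\<le>Suc K. x ^ (Suc K - l)) = x * (\<Sum>l\<le>K. x ^ (K - l)) + 1"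
    by (simp add: sum_distrib_left Suc_diff_le)
  also have "\<dots> \<le> x * (1 / (1 - x)) + 1"
    using Suc assms by (intro add_right_mono mult_left_mono) auto
  also have "\<dots> = 1 / (1 - x)" using assms by (simp add: field_simps)
  finally show ?case .
qed

section \<open>Exponential moments and union bounds\<close>

text \<open>All that is kept of a model: joint exponential moments of the entries \<open>X\<close>
  and of the support indicators \<open>H\<close>, with the bounds that independent entries of
  density \<open>q\<close> satisfy. The Bennett-type exponent \<open>exp x - 1 - x\<close> reflects
  the centering. Nonnegative integrals avoid integrability conditions.\<close>

locale sparse_entries = prob_space M for M :: "'a measure" +
  fixes k n :: nat and q :: real and X H :: "'a \<Rightarrow> nat \<times> nat \<Rightarrow> real"
  assumes q_nonneg: "0 \<le> q"
    and X_measurable: "\<And>e. e \<in> {..<k} \<times> {..<n} \<Longrightarrow> (\<lambda>\<omega>. X \<omega> e) \<in> borel_measurable M"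
    and H_measurable: "\<And>e. e \<in> {..<k} \<times> {..<n} \<Longrightarrow> (\<lambda>\<omega>. H \<omega> e) \<in> borel_measurable M"
    and H_nonneg: "\<And>\<omega> e. 0 \<le> H \<omega> e"
    and mgf_X: "\<And>a. (\<integral>\<^sup>+\<omega>. ennreal (exp (\<Sum>e\<in>{..<k} \<times> {..<n}. a e * X \<omega> e)) \<partial>M)
          \<le> ennreal (exp (q * (\<Sum>e\<in>{..<k} \<times> {..<n}. exp \<bar>a e\<bar> - 1 - \<bar>a e\<bar>)))"
    and mgf_H: "\<And>a. (\<And>e. 0 \<le> a e) \<Longrightarrow>
          (\<integral>\<^sup>+\<omega>. ennreal (exp (\<Sum>e\<in>{..<k} \<times> {..<n}. a e * H \<omega> e)) \<partial>M)
          \<le> ennreal (exp (q * (\<Sum>e\<in>{..<k} \<times> {..<n}. exp (a e) - 1)))"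
begin

lemma chernoff:
  assumes f: "f \<in> borel_measurable M" and le: "(\<integral>\<^sup>+\<omega>. ennreal (exp (f \<omega>)) \<partial>M) \<le> ennreal (exp c)"
  shows "prob {\<omega> \<in> space M. t < f \<omega>} \<le> exp (c - t)"
proof -
  note [measurable] = f
  have "emeasure M {\<omega> \<in> space M. t < f \<omega>}
      \<le> emeasure M {\<omega> \<in> space M. 1 \<le> ennreal (exp (- t)) * ennreal (exp (f \<omega>))}"
    by (intro emeasure_mono)
      (auto simp: ennreal_mult[symmetric] exp_add[symmetric] simp flip: ennreal_1)
  also have "\<dots> \<le> ennreal (exp (- t)) * (\<integral>\<^sup>+\<omega>. ennreal (exp (f \<omega>)) * indicator (space M) \<omega> \<partial>M)"
    by (intro nn_integral_Markov_inequality) auto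
  also have "(\<integral>\<^sup>+\<omega>. ennreal (exp (f \<omega>)) * indicator (space M) \<omega> \<partial>M) = (\<integral>\<^sup>+\<omega>. ennreal (exp (f \<omega>)) \<partial>M)"
    by (intro nn_integral_cong) auto
  also have "ennreal (exp (- t)) * \<dots> \<le> ennreal (exp (- t)) * ennreal (exp c)"
    by (intro mult_left_mono le) auto
  also have "\<dots> = ennreal (exp (c - t))"
    by (simp add: ennreal_mult[symmetric] exp_add[symmetric])
  finally show ?thesis
    by (simp add: emeasure_eq_measure)
qed

end

lemma exp_second_order_bound:
  assumes "0 \<le> x" "x \<le> m"
  shows "exp x - 1 - x \<le> x\<^sup>2 * exp (m :: real)"
proof -
  have "exp x - 1 - x \<le> x\<^sup>2 * exp x"
  proof (cases "x \<le> 1")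
    case True
    then have "exp x \<le> 1 + x + x\<^sup>2" using exp_bound[of x] assms by simp
    moreover have "x\<^sup>2 * 1 \<le> x\<^sup>2 * exp x" using assms by (intro mult_left_mono) auto
    ultimately show ?thesis by simp
  next
    case False
    then have "1 \<le> x\<^sup>2" by (simp add: one_le_power)
    then have "1 * exp x \<le> x\<^sup>2 * exp x" by (intro mult_right_mono) auto
    then show ?thesis using assms by linarith
  qed
  also have "\<dots> \<le> x\<^sup>2 * exp m" using assms by (intro mult_left_mono) auto
  finally show ?thesis .
qed

context sparse_entries begin

text \<open>A weighted union bound: \<open>f\<close> is granted its own deviation
  \<open>cost f\<close>, so the failure probability depends on the Kraft sum and not on the size of
  \<open>F\<close>. The parameter \<open>\<theta>\<close> is shared by the family and stays free,
  because a good choice depends on the truncation level \<open>m\<close>.\<close>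

lemma bernstein_union:
  fixes F :: "'f set" and A :: "'f \<Rightarrow> nat \<times> nat \<Rightarrow> real"
  assumes F: "finite F" and \<theta>: "0 < \<theta>" and m: "0 \<le> m"
    and A_bdd: "\<And>f e. f \<in> F \<Longrightarrow> e \<in> {..<k} \<times> {..<n} \<Longrightarrow> \<bar>A f e\<bar> \<le> m"
    and A_sq: "\<And>f. f \<in> F \<Longrightarrow> (\<Sum>e\<in>{..<k} \<times> {..<n}. (A f e)\<^sup>2) \<le> C0"
    and kraft: "(\<Sum>f\<in>F. exp (- cost f)) \<le> exp F0"
  obtains Bad where "Bad \<in> sets M" "prob Bad \<le> exp (- s)"
    "\<And>\<omega> f. \<omega> \<in> space M - Bad \<Longrightarrow> f \<in> F \<Longrightarrow>
       (\<Sum>e\<in>{..<k} \<times> {..<n}. A f e * X \<omega> e) \<le> (cost f + F0 + s) / \<theta> + q * \<theta> * C0 * exp (\<theta> * m)"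
proof -
  let ?I = "{..<k} \<times> {..<n}"
  define B where "B f = {\<omega> \<in> space M. cost f + F0 + s + q * \<theta>\<^sup>2 * C0 * exp (\<theta> * m)
      < (\<Sum>e\<in>?I. (\<theta> * A f e) * X \<omega> e)}" for f
  have meas: "(\<lambda>\<omega>. \<Sum>e\<in>?I. a e * X \<omega> e) \<in> borel_measurable M" for a
    by (intro borel_measurable_sum borel_measurable_times X_measurable) auto
  have B_sets: "B f \<in> sets M" for f
    unfolding B_def using meas[of "\<lambda>e. \<theta> * A f e"] by measurable
  have prob_B: "prob (B f) \<le> exp (- cost f) * exp (- F0 - s)" if f: "f \<in> F" for f
  proof -
    have "q * (\<Sum>e\<in>?I. exp \<bar>\<theta> * A f e\<bar> - 1 - \<bar>\<theta> * A f e\<bar>)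
        \<le> q * (\<Sum>e\<in>?I. (\<theta> * A f e)\<^sup>2 * exp (\<theta> * m))"
    proof (intro mult_left_mono sum_mono q_nonneg)
      fix e assume e: "e \<in> ?I"
      have "\<bar>\<theta> * A f e\<bar> \<le> \<theta> * m"
        using A_bdd[OF f e] \<theta> by (simp add: abs_mult)
      from exp_second_order_bound[OF _ this]
      show "exp \<bar>\<theta> * A f e\<bar> - 1 - \<bar>\<theta> * A f e\<bar> \<le> (\<theta> * A f e)\<^sup>2 * exp (\<theta> * m)" by simp
    qed
    also have "\<dots> = q * \<theta>\<^sup>2 * (\<Sum>e\<in>?I. (A f e)\<^sup>2) * exp (\<theta> * m)"
      by (simp add: sum_distrib_left sum_distrib_right power_mult_distrib mult_ac)
    also have "\<dots> \<le> q * \<theta>\<^sup>2 * C0 * exp (\<theta> * m)"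
      using A_sq[OF f] q_nonneg by (intro mult_right_mono mult_left_mono) auto
    finally have "(\<integral>\<^sup>+\<omega>. ennreal (exp (\<Sum>e\<in>?I. (\<theta> * A f e) * X \<omega> e)) \<partial>M)
        \<le> ennreal (exp (q * \<theta>\<^sup>2 * C0 * exp (\<theta> * m)))"
      by (intro order_trans[OF mgf_X[of "\<lambda>e. \<theta> * A f e"]] ennreal_leI) simp
    from chernoff[OF meas[of "\<lambda>e. \<theta> * A f e"] this, of "cost f + F0 + s + q * \<theta>\<^sup>2 * C0 * exp (\<theta> * m)"]
    have "prob (B f) \<le> exp (- cost f + (- F0 - s))" unfolding B_def by (simp add: algebra_simps)
    then show ?thesis by (simp only: exp_add)
  qed
  show ?thesis
  proof (rule that[of "\<Union>f\<in>F. B f"])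
    show "(\<Union>f\<in>F. B f) \<in> sets M" using F B_sets by auto
    have "prob (\<Union>f\<in>F. B f) \<le> (\<Sum>f\<in>F. prob (B f))"
      using F B_sets by (intro finite_measure_subadditive_finite) auto
    also have "\<dots> \<le> (\<Sum>f\<in>F. exp (- cost f) * exp (- F0 - s))"
      using prob_B by (rule sum_mono)
    also have "\<dots> = (\<Sum>f\<in>F. exp (- cost f)) * exp (- F0 - s)" by (simp add: sum_distrib_right)
    also have "\<dots> \<le> exp F0 * exp (- F0 - s)" by (intro mult_right_mono kraft) auto
    also have "\<dots> = exp (- s)" by (simp flip: exp_add)
    finally show "prob (\<Union>f\<in>F. B f) \<le> exp (- s)" .
  next
    fix \<omega> f assume "\<omega> \<in> space M - (\<Union>f\<in>F. B f)" "f \<in> F"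
    then have "(\<Sum>e\<in>?I. (\<theta> * A f e) * X \<omega> e) \<le> cost f + F0 + s + q * \<theta>\<^sup>2 * C0 * exp (\<theta> * m)"
      by (auto simp: B_def not_less)
    then have "\<theta> * (\<Sum>e\<in>?I. A f e * X \<omega> e) \<le> cost f + F0 + s + q * \<theta>\<^sup>2 * C0 * exp (\<theta> * m)"
      by (simp add: sum_distrib_left mult_ac)
    then have "(\<Sum>e\<in>?I. A f e * X \<omega> e) \<le> (cost f + F0 + s + q * \<theta>\<^sup>2 * C0 * exp (\<theta> * m)) / \<theta>"
      using \<theta> by (simp add: pos_le_divide_eq mult.commute)
    also have "\<dots> = (cost f + F0 + s) / \<theta> + q * \<theta> * C0 * exp (\<theta> * m)"
      using \<theta> by (simp add: add_divide_distrib power2_eq_square)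
    finally show "(\<Sum>e\<in>?I. A f e * X \<omega> e) \<le> (cost f + F0 + s) / \<theta> + q * \<theta> * C0 * exp (\<theta> * m)" .
  qed
qed

text \<open>Chernoff at parameter 1. For weights in [0, 1], \<open>exp x - 1 \<le> 2 * x\<close>,
  which turns the mean bound \<open>D\<close> into the exponent \<open>2 * D\<close>. Column degrees
  and weighted row sums are both of this kind.\<close>

lemma degree_union:
  fixes F :: "'f set" and A :: "'f \<Rightarrow> nat \<times> nat \<Rightarrow> real"
  assumes F: "finite F"
    and A_nonneg: "\<And>f e. f \<in> F \<Longrightarrow> 0 \<le> A f e" and A_le: "\<And>f e. f \<in> F \<Longrightarrow> A f e \<le> 1"
    and A_sum: "\<And>f. f \<in> F \<Longrightarrow> q * (\<Sum>e\<in>{..<k} \<times> {..<n}. A f e) \<le> D"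
  obtains Bad where "Bad \<in> sets M" "prob Bad \<le> real (card F) * exp (2 * D - t)"
    "\<And>\<omega> f. \<omega> \<in> space M - Bad \<Longrightarrow> f \<in> F \<Longrightarrow> (\<Sum>e\<in>{..<k} \<times> {..<n}. A f e * H \<omega> e) \<le> t"
proof -
  let ?I = "{..<k} \<times> {..<n}"
  define B where "B f = {\<omega> \<in> space M. t < (\<Sum>e\<in>?I. A f e * H \<omega> e)}" for f
  have meas: "(\<lambda>\<omega>. \<Sum>e\<in>?I. a e * H \<omega> e) \<in> borel_measurable M" for a
    by (intro borel_measurable_sum borel_measurable_times H_measurable) auto
  have B_sets: "B f \<in> sets M" for f
    unfolding B_def using meas[of "A f"] by measurable
  have prob_B: "prob (B f) \<le> exp (2 * D - t)" if f: "f \<in> F" for f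
  proof -
    have "q * (\<Sum>e\<in>?I. exp (A f e) - 1) \<le> q * (\<Sum>e\<in>?I. 2 * A f e)"
    proof (intro mult_left_mono sum_mono q_nonneg)
      fix e
      have "(A f e)\<^sup>2 \<le> A f e"
        using A_nonneg[OF f, of e] A_le[OF f, of e] by (simp add: power2_eq_square mult_left_le)
      then show "exp (A f e) - 1 \<le> 2 * A f e"
        using exp_bound[of "A f e"] A_nonneg[OF f, of e] A_le[OF f, of e] by simp
    qed
    also have "\<dots> \<le> 2 * D" using A_sum[OF f] by (simp add: sum_distrib_left[symmetric])
    finally have "(\<integral>\<^sup>+\<omega>. ennreal (exp (\<Sum>e\<in>?I. A f e * H \<omega> e)) \<partial>M) \<le> ennreal (exp (2 * D))"
      by (intro order_trans[OF mgf_H[of "A f"]] ennreal_leI A_nonneg f) simp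
    from chernoff[OF meas this] show ?thesis unfolding B_def .
  qed
  show ?thesis
  proof (rule that[of "\<Union>f\<in>F. B f"])
    show "(\<Union>f\<in>F. B f) \<in> sets M" using F B_sets by auto
    have "prob (\<Union>f\<in>F. B f) \<le> (\<Sum>f\<in>F. prob (B f))"
      using F B_sets by (intro finite_measure_subadditive_finite) auto
    also have "\<dots> \<le> real (card F) * exp (2 * D - t)"
      using sum_bounded_above[of F "\<lambda>f. prob (B f)"] prob_B by simp
    finally show "prob (\<Union>f\<in>F. B f) \<le> real (card F) * exp (2 * D - t)" .
  next
    fix \<omega> f assume "\<omega> \<in> space M - (\<Union>f\<in>F. B f)" "f \<in> F"
    then show "(\<Sum>e\<in>?I. A f e * H \<omega> e) \<le> t" by (auto simp: B_def not_less)
  qed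
qed

end

section \<open>Kraft sums and the multiscale union bound\<close>

definition dyadic :: "(nat \<times> bool) option \<Rightarrow> real" where
  "dyadic c = (case c of None \<Rightarrow> 0 | Some (b, s) \<Rightarrow> (if s then 1 else - 1) * (1/2) ^ b)"

definition codes :: "nat \<Rightarrow> (nat \<times> bool) option set" where
  "codes l = insert None (Some ` ({..l} \<times> UNIV))"

text \<open>\<open>None\<close> stands for a coordinate that is not yet revealed. The costs are chosen so that the weights
  \<open>exp (- cost)\<close> are \<open>1/16\<close> to the power \<open>K - b\<close>; multiplied by the \<open>4 ^ (K - b)\<close> coordinates that can
  have size \<open>(1/2) ^ b\<close> they are still summable.\<close>

definition code_cost :: "nat \<Rightarrow> (nat \<times> bool) option \<Rightarrow> real" where
  "code_cost K c = (case c of None \<Rightarrow> 0 | Some (b, s) \<Rightarrow> ln 16 * real (K - b))"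

lemma finite_codes [simp]: "finite (codes l)"
  by (simp add: codes_def)

lemma exp_minus_ln_mult: "exp (- (ln 16 * real d)) = (1/16) ^ d"
proof -
  have "exp (- (ln 16 * real d)) = exp (- ln 16) ^ d"
    by (simp add: exp_of_nat_mult[symmetric] mult.commute)
  then show ?thesis by (simp add: exp_minus inverse_eq_divide)
qed

lemma sum_sixteenth_le:
  assumes "l \<le> K"
  shows "(\<Sum>b\<le>l. (1/16 :: real) ^ (K - b)) \<le> 16/15 * (1/16) ^ (K - l)"
proof -
  have "(\<Sum>b\<le>l. (1/16 :: real) ^ (K - b)) = (\<Sum>b\<le>l. (1/16) ^ (l - b) * (1/16) ^ (K - l))"
    using assms by (intro sum.cong) (simp_all flip: power_add)
  also have "\<dots> = (\<Sum>b\<le>l. (1/16) ^ (l - b)) * (1/16) ^ (K - l)" by (simp add: sum_distrib_right)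
  also have "\<dots> \<le> 16/15 * (1/16) ^ (K - l)"
    using sum_power_reversed_le[of "1/16" l] by (intro mult_right_mono) auto
  finally show ?thesis .
qed

text \<open>The code \<open>None\<close> contributes 1, and the two signs contribute
  \<open>2 * 16/15 \<le> 3\<close> times the last power. The bound is kept as an exponential so that
  it multiplies over coordinates.\<close>

lemma kraft_codes:
  assumes "l \<le> K"
  shows "(\<Sum>c\<in>codes l. exp (- code_cost K c)) \<le> exp (3 * (1/16) ^ (K - l))"
proof -
  have "(\<Sum>c\<in>codes l. exp (- code_cost K c))
      = 1 + (\<Sum>p\<in>{..l} \<times> UNIV. exp (- code_cost K (Some p)))"
    unfolding codes_def
    by (subst sum.insert) (auto simp: code_cost_def sum.reindex)
  also have "(\<Sum>p\<in>{..l} \<times> UNIV. exp (- code_cost K (Some p)))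
      = (\<Sum>b\<le>l. \<Sum>s\<in>(UNIV :: bool set). (1/16) ^ (K - b))"
    unfolding sum.cartesian_product
    by (intro sum.cong) (auto simp: code_cost_def exp_minus_ln_mult)
  also have "\<dots> = 2 * (\<Sum>b\<le>l. (1/16) ^ (K - b))"
    by (simp add: UNIV_bool sum_distrib_left)
  also have "1 + \<dots> \<le> 1 + 3 * (1/16) ^ (K - l)"
  proof -
    have "0 \<le> (1/16 :: real) ^ (K - l)" by simp
    with sum_sixteenth_le[OF assms] show ?thesis by linarith
  qed
  also have "\<dots> \<le> exp (3 * (1/16) ^ (K - l))" by (rule exp_ge_add_one_self)
  finally show ?thesis .
qed

lemma kraft_code_vectors:
  assumes "l \<le> K"
  shows "(\<Sum>c\<in>PiE {..<m} (\<lambda>_. codes l). exp (- (\<Sum>u<m. code_cost K (c u))))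
      \<le> exp (real m * (3 * (1/16) ^ (K - l)))"
proof -
  have "(\<Sum>c\<in>PiE {..<m} (\<lambda>_. codes l). exp (- (\<Sum>u<m. code_cost K (c u))))
      = (\<Sum>c\<in>PiE {..<m} (\<lambda>_. codes l). \<Prod>u<m. exp (- code_cost K (c u)))"
    by (simp add: sum_negf[symmetric] exp_sum)
  also have "\<dots> = (\<Prod>u<m. \<Sum>c\<in>codes l. exp (- code_cost K c))"
    by (intro prod_sum_PiE[symmetric]) auto
  also have "\<dots> \<le> (\<Prod>u<m. exp (3 * (1/16) ^ (K - l)))"
    using kraft_codes[OF assms] by (intro prod_mono) (auto intro: sum_nonneg)
  also have "\<dots> = exp (real m * (3 * (1/16) ^ (K - l)))"
    by (simp add: exp_of_nat_mult)
  finally show ?thesis .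
qed

text \<open>A cost proportional to \<open>|x|\<close> treats an integer coefficient as a
  multiplicity: every use of an atom is paid for separately, and the Kraft sum is a two-sided
  geometric series.\<close>

lemma kraft_integers:
  assumes "exp (- \<kappa>) \<le> (1/2 :: real)"
  shows "(\<Sum>x\<in>{- int m..int m}. exp (- (\<kappa> * \<bar>of_int x\<bar>))) \<le> exp (4 * exp (- \<kappa>))"
proof -
  have "(\<Sum>x\<in>{- int m..int m}. exp (- (\<kappa> * \<bar>of_int x\<bar>))) \<le> 1 + 2 * (\<Sum>j<m. exp (- \<kappa>) ^ Suc j)"
  proof (induction m)
    case (Suc m)
    have "{- int (Suc m)..int (Suc m)} = insert (- int (Suc m)) (insert (int (Suc m)) {- int m..int m})"
      by auto
    moreover have "exp (- (\<kappa> * real (Suc m))) = exp (- \<kappa>) ^ Suc m"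
      by (simp only: exp_of_nat_mult[symmetric]) (simp add: algebra_simps)
    ultimately have "(\<Sum>x\<in>{- int (Suc m)..int (Suc m)}. exp (- (\<kappa> * \<bar>of_int x\<bar>)))
        = 2 * exp (- \<kappa>) ^ Suc m + (\<Sum>x\<in>{- int m..int m}. exp (- (\<kappa> * \<bar>of_int x\<bar>)))"
      by (simp add: add.commute)
    then show ?case using Suc by simp
  qed simp
  also have "(\<Sum>j<m. exp (- \<kappa>) ^ Suc j) \<le> 2 * exp (- \<kappa>)"
  proof -
    have "(\<Sum>j<m. exp (- \<kappa>) ^ j) \<le> 2"
    proof -
      have "(\<Sum>j<m. exp (- \<kappa>) ^ j) \<le> (\<Sum>j<m. (1/2) ^ j)"
        using assms by (intro sum_mono power_mono) auto
      also have "\<dots> \<le> 2" by (simp add: sum_gp_strict)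
      finally show ?thesis .
    qed
    then have "exp (- \<kappa>) * (\<Sum>j<m. exp (- \<kappa>) ^ j) \<le> exp (- \<kappa>) * 2" by (intro mult_left_mono) auto
    then show ?thesis by (simp add: sum_distrib_left mult.commute)
  qed
  also have "1 + 2 * (2 * exp (- \<kappa>)) \<le> exp (4 * exp (- \<kappa>))"
    using exp_ge_add_one_self[of "4 * exp (- \<kappa>)"] by simp
  finally show ?thesis by simp
qed

text \<open>In use, \<open>e i\<close> is the normalised row \<open>i\<close> of the isometry,
  \<open>\<tau> i\<close> its squared norm, and \<open>J\<close> a block of columns of the random
  matrix with at most \<open>nn\<close> members. The exponent \<open>K\<close> is the finest scale:
  as \<open>k \<le> 4 ^ K\<close>, coordinates below \<open>(1/2) ^ K\<close> have total square at
  most 1.\<close>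

locale sparse_frame = sparse_entries M k n q X H
  for M :: "'a measure" and k n :: nat and q :: real and X H :: "'a \<Rightarrow> nat \<times> nat \<Rightarrow> real" +
  fixes r K :: nat and J :: "nat set" and \<rho> nn :: real
    and e :: "nat \<Rightarrow> nat \<Rightarrow> real" and \<tau> :: "nat \<Rightarrow> real"
  assumes k_ge: "3 \<le> k" and r_le: "r \<le> k" and K_lower: "k \<le> 4 ^ K" and K_upper: "4 ^ K < 4 * k"
    and J_subset: "J \<subseteq> {..<n}" and card_J: "real (card J) \<le> nn" and nn_ge: "real k \<le> nn"
    and \<rho>_pos: "0 < \<rho>" and \<rho>_le: "\<rho> \<le> 1" and \<rho>_ln: "\<rho> * ln (nn / real k) \<le> 1"
    and e_norm: "\<And>i. i \<in> J \<Longrightarrow> ip r (e i) (e i) \<le> 1"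
    and \<tau>_nonneg: "\<And>i. 0 \<le> \<tau> i" and \<tau>_le: "\<And>i. i \<in> J \<Longrightarrow> \<tau> i \<le> \<rho>"
    and \<tau>_sum: "(\<Sum>i\<in>J. \<tau> i) \<le> real k * \<rho>"
    and bessel: "\<And>v. (\<Sum>i\<in>J. \<tau> i * (ip r (e i) v)\<^sup>2) \<le> ip r v v"
    and D_ge: "ln (real k) \<le> real k * q"
begin

section \<open>Scales, nets and cutoffs for one block of columns\<close>

definition D :: real where "D = real k * q"

definition Y :: "nat \<Rightarrow> (nat \<Rightarrow> real) \<Rightarrow> real" where "Y i v = sqrt (\<tau> i) * ip r (e i) v"

text \<open>Since \<open>\<tau> i \<le> \<rho>\<close> on \<open>J\<close>, a residual with
  correlations at most \<open>step l\<close> is at most \<open>(1/2) ^ l\<close> in every coordinate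
  \<open>Y i\<close>.\<close>

definition step :: "nat \<Rightarrow> real" where "step l = (1/2) ^ l / sqrt \<rho>"

definition layer :: "nat \<Rightarrow> (nat \<times> nat \<Rightarrow> int) \<Rightarrow> nat \<Rightarrow> real" where
  "layer l N j = step l * (\<Sum>i\<in>J. of_int (N (l, i)) * e i j)"

definition partial :: "nat \<Rightarrow> (nat \<times> nat \<Rightarrow> int) \<Rightarrow> nat \<Rightarrow> real" where
  "partial l N j = (\<Sum>l'\<le>l. layer l' N j)"

text \<open>With at most \<open>nn\<close> atoms per level, the weights
  \<open>exp (- atom_cost l)\<close> of one level sum to at most
  \<open>k/2 * (1/16) ^ (K - l)\<close>: the entropy stays proportional to \<open>k\<close>, not to
  the number of columns.\<close>

definition atom_cost :: "nat \<Rightarrow> real" where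
  "atom_cost l = ln (2 * nn / real k) + ln 16 * real (K - l)"

definition net_cost :: "nat \<Rightarrow> (nat \<times> nat \<Rightarrow> int) \<Rightarrow> real" where
  "net_cost l N = (\<Sum>p\<in>{..l} \<times> J. atom_cost (fst p) * \<bar>of_int (N p)\<bar>)"

text \<open>\<open>5 * 4 ^ K\<close> bounds the number of atoms that a pursuit from a vector of squared norm at most 5 can use.\<close>

definition nets :: "nat \<Rightarrow> (nat \<times> nat \<Rightarrow> int) set" where
  "nets l = PiE ({..l} \<times> J) (\<lambda>_. {- int (5 * 4 ^ K)..int (5 * 4 ^ K)})"

text \<open>For a coordinate of size \<open>(1/2) ^ l\<close> this keeps \<open>Y i\<close> up to
  \<open>2 * sqrt D * (1/2) ^ l\<close>; the factor 2 leaves room for the error of the approximation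
  of \<open>v\<close> at that level.\<close>

definition cutoff :: "nat \<Rightarrow> real" where "cutoff l = 2 * sqrt D * (1/4) ^ l"

definition trunc :: "real \<Rightarrow> real \<Rightarrow> real" where "trunc m x = (if \<bar>x\<bar> \<le> m then x else 0)"

text \<open>Telescoping over pairs (coordinates of \<open>z\<close> up to level \<open>l\<close>, approximation of \<open>v\<close> up to level \<open>l\<close>):
  a coordinate that appears at level \<open>l\<close> meets the whole approximation, an older one only the new layer.\<close>

definition coef :: "nat \<Rightarrow> (nat \<Rightarrow> (nat \<times> bool) option) \<Rightarrow> (nat \<times> nat \<Rightarrow> int) \<Rightarrow> nat \<times> nat \<Rightarrow> real" where
  "coef l c N = (\<lambda>(u, i). if i \<in> J then
     (case c u of None \<Rightarrow> 0
      | Some (b, s) \<Rightarrow> dyadic (c u) * Y i (if b = l then partial l N else layer l N)) else 0)"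

definition remainder_coef ::
  "(nat \<Rightarrow> (nat \<times> bool) option) \<Rightarrow> (nat \<Rightarrow> real) \<Rightarrow> nat \<times> nat \<Rightarrow> real" where
  "remainder_coef c w = (\<lambda>(u, i). if i \<in> J then dyadic (c u) * Y i w else 0)"

lemma finite_J: "finite J"
  using J_subset finite_subset by blast

lemma D_ge_1: "1 \<le> D"
proof -
  have "exp 1 \<le> (3 :: real)" by (rule exp_le)
  also have "\<dots> \<le> real k" using k_ge by simp
  finally have "1 \<le> ln (real k)" using k_ge by (subst ln_ge_iff) auto
  with D_ge show ?thesis by (simp add: D_def)
qed

lemma cutoff_pos: "0 < cutoff l"
  using D_ge_1 by (simp add: cutoff_def)

lemma q_le: "q \<le> 4 * D / 4 ^ K"
proof -
  have "real (4 ^ K) \<le> real (4 * k)"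
    using K_upper by (intro of_nat_mono) simp
  then have "q * 4 ^ K \<le> q * real (4 * k)"
    using q_nonneg by (intro mult_left_mono) auto
  then show ?thesis by (simp add: D_def field_simps)
qed

lemma sum_Y_le: "(\<Sum>i\<in>J. (Y i v)\<^sup>2) \<le> ip r v v"
  using bessel[of v] \<tau>_nonneg by (simp add: Y_def power_mult_distrib)

lemma sum_entries_J:
  assumes "\<And>u i. i \<notin> J \<Longrightarrow> g (u, i) = 0"
  shows "(\<Sum>e\<in>{..<k} \<times> {..<n}. g e) = (\<Sum>u<k. \<Sum>i\<in>J. (g (u, i) :: real))"
proof -
  have "(\<Sum>e\<in>{..<k} \<times> {..<n}. g e) = (\<Sum>u<k. \<Sum>i<n. g (u, i))"
    by (simp add: sum.cartesian_product)
  also have "\<dots> = (\<Sum>u<k. \<Sum>i\<in>J. g (u, i))"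
    using J_subset assms by (intro sum.cong refl sum.mono_neutral_right) auto
  finally show ?thesis .
qed

lemma exp_atom_cost: "exp (- atom_cost l) = real k / (2 * nn) * (1/16) ^ (K - l)"
proof -
  have pos: "0 < real k" "0 < nn" using k_ge nn_ge by linarith+
  have "exp (- atom_cost l) = exp (- ln (2 * nn / real k)) * exp (- (ln 16 * real (K - l)))"
    unfolding atom_cost_def by (simp flip: exp_add)
  also have "exp (- ln (2 * nn / real k)) = real k / (2 * nn)"
    using pos by (simp add: exp_minus inverse_eq_divide)
  finally show ?thesis unfolding exp_minus_ln_mult .
qed

text \<open>The sum factors over the atoms. Level \<open>l'\<close> contributes
  \<open>4 * card J * exp (- atom_cost l')\<close> to the logarithm, at most
  \<open>2 * k * (1/16) ^ (K - l')\<close>, and summing the levels up to \<open>l\<close> costs a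
  factor \<open>16/15\<close>. The result has the same form as the bound for coordinate
  codes.\<close>

lemma kraft_nets:
  assumes "l \<le> K"
  shows "(\<Sum>N\<in>nets l. exp (- net_cost l N)) \<le> exp (real k * (3 * (1/16) ^ (K - l)))"
proof -
  have pos: "0 < real k" "0 < nn" using k_ge nn_ge by linarith+
  have half: "exp (- atom_cost l') \<le> 1/2" for l'
  proof -
    have "real k / (2 * nn) \<le> 1/2" using pos nn_ge by (simp add: field_simps)
    then have "real k / (2 * nn) * (1/16) ^ (K - l') \<le> 1/2 * 1"
      using pos by (intro mult_mono power_le_one) auto
    then show ?thesis unfolding exp_atom_cost by simp
  qed
  have "(\<Sum>N\<in>nets l. exp (- net_cost l N))
      = (\<Sum>N\<in>nets l. \<Prod>p\<in>{..l} \<times> J. exp (- (atom_cost (fst p) * \<bar>of_int (N p)\<bar>)))"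
    using finite_J by (simp add: net_cost_def sum_negf[symmetric] exp_sum)
  also have "\<dots> = (\<Prod>p\<in>{..l} \<times> J. \<Sum>x\<in>{- int (5 * 4 ^ K)..int (5 * 4 ^ K)}. exp (- (atom_cost (fst p) * \<bar>of_int x\<bar>)))"
    unfolding nets_def using finite_J by (intro prod_sum_PiE[symmetric]) auto
  also have "\<dots> \<le> (\<Prod>p\<in>{..l} \<times> J. exp (4 * exp (- atom_cost (fst p))))"
    by (intro prod_mono conjI sum_nonneg kraft_integers half) auto
  also have "\<dots> = exp (\<Sum>p\<in>{..l} \<times> J. 4 * exp (- atom_cost (fst p)))"
    using finite_J by (simp add: exp_sum)
  finally have le: "(\<Sum>N\<in>nets l. exp (- net_cost l N))
      \<le> exp (\<Sum>p\<in>{..l} \<times> J. 4 * exp (- atom_cost (fst p)))" .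
  have "(\<Sum>p\<in>{..l} \<times> J. 4 * exp (- atom_cost (fst p)))
      = real (card J) * (2 * real k / nn) * (\<Sum>l'\<le>l. (1/16) ^ (K - l'))"
  proof -
    have "(\<Sum>p\<in>{..l} \<times> J. 4 * exp (- atom_cost (fst p))) = (\<Sum>l'\<le>l. \<Sum>i\<in>J. 4 * exp (- atom_cost l'))"
      unfolding sum.cartesian_product by (simp add: split_beta)
    then show ?thesis by (simp add: exp_atom_cost sum_distrib_left mult_ac)
  qed
  also have "\<dots> \<le> (2 * real k) * (16/15 * (1/16) ^ (K - l))"
  proof (rule mult_mono[OF _ sum_sixteenth_le[OF assms]])
    have "real (card J) * (2 * real k / nn) \<le> nn * (2 * real k / nn)"
      using card_J pos by (intro mult_right_mono) auto
    then show "real (card J) * (2 * real k / nn) \<le> 2 * real k" using pos by simp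
  qed (use pos in \<open>auto intro: sum_nonneg\<close>)
  also have "\<dots> \<le> real k * (3 * (1/16) ^ (K - l))"
    by (simp add: mult_right_mono)
  finally have "exp (\<Sum>p\<in>{..l} \<times> J. 4 * exp (- atom_cost (fst p))) \<le> exp (real k * (3 * (1/16) ^ (K - l)))"
    by simp
  with le show ?thesis by (rule order_trans)
qed

lemma finite_nets [simp]: "finite (nets l)"
  unfolding nets_def using finite_J by (intro finite_PiE) auto

text \<open>Only one vector \<open>v\<close> occurs in each row of coefficients, so the Bessel bound
  leaves 20 times the squared dyadic coordinate. Summed over the rows this is
  \<open>20 * 5\<close>.\<close>

lemma coef_square_sum:
  assumes "(\<Sum>u<k. (dyadic (c u))\<^sup>2) \<le> 5" "ip r (partial l N) (partial l N) \<le> 20" "ip r (layer l N) (layer l N) \<le> 20"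
  shows "(\<Sum>p\<in>{..<k} \<times> {..<n}. (trunc (cutoff l) (coef l c N p))\<^sup>2) \<le> 100"
proof -
  have "(\<Sum>p\<in>{..<k} \<times> {..<n}. (trunc (cutoff l) (coef l c N p))\<^sup>2)
      \<le> (\<Sum>p\<in>{..<k} \<times> {..<n}. (coef l c N p)\<^sup>2)"
    by (intro sum_mono) (auto simp: trunc_def)
  also have "\<dots> = (\<Sum>u<k. \<Sum>i\<in>J. (coef l c N (u, i))\<^sup>2)"
    by (intro sum_entries_J) (auto simp: coef_def)
  also have "\<dots> \<le> (\<Sum>u<k. (dyadic (c u))\<^sup>2 * 20)"
  proof (intro sum_mono)
    fix u
    define v where "v = (case c u of None \<Rightarrow> partial l N | Some (b, s) \<Rightarrow> if b = l then partial l N else layer l N)"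
    have "(\<Sum>i\<in>J. (coef l c N (u, i))\<^sup>2) = (\<Sum>i\<in>J. (dyadic (c u))\<^sup>2 * (Y i v)\<^sup>2)"
      by (intro sum.cong)
        (auto simp: coef_def v_def dyadic_def power_mult_distrib split: option.splits)
    also have "\<dots> \<le> (dyadic (c u))\<^sup>2 * ip r v v"
      unfolding sum_distrib_left[symmetric] by (intro mult_left_mono sum_Y_le) auto
    also have "\<dots> \<le> (dyadic (c u))\<^sup>2 * 20"
      using assms(2,3) by (intro mult_left_mono) (auto simp: v_def split: option.splits)
    finally show "(\<Sum>i\<in>J. (coef l c N (u, i))\<^sup>2) \<le> (dyadic (c u))\<^sup>2 * 20" .
  qed
  also have "\<dots> = (\<Sum>u<k. (dyadic (c u))\<^sup>2) * 20" by (simp add: sum_distrib_right)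
  finally show ?thesis using assms(1) by linarith
qed

lemma remainder_square_sum:
  assumes "(\<Sum>u<k. (dyadic (c u))\<^sup>2) \<le> 5" "ip r w w \<le> 20"
  shows "(\<Sum>p\<in>{..<k} \<times> {..<n}. (trunc m (remainder_coef c w p))\<^sup>2) \<le> 100"
proof -
  have "(\<Sum>p\<in>{..<k} \<times> {..<n}. (trunc m (remainder_coef c w p))\<^sup>2)
      \<le> (\<Sum>p\<in>{..<k} \<times> {..<n}. (remainder_coef c w p)\<^sup>2)"
    by (intro sum_mono) (auto simp: trunc_def)
  also have "\<dots> = (\<Sum>u<k. \<Sum>i\<in>J. (remainder_coef c w (u, i))\<^sup>2)"
    by (intro sum_entries_J) (auto simp: remainder_coef_def)
  also have "\<dots> = (\<Sum>u<k. (dyadic (c u))\<^sup>2) * (\<Sum>i\<in>J. (Y i w)\<^sup>2)"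
    by (simp add: remainder_coef_def power_mult_distrib sum_product)
  also have "\<dots> \<le> 5 * 20"
    using assms sum_Y_le[of w] by (intro mult_mono) (auto intro: sum_nonneg)
  finally show ?thesis by simp
qed

lemma sum_product_subset_le:
  assumes "F \<subseteq> A \<times> B" "finite A" "finite B" "(\<Sum>a\<in>A. exp (- f a)) \<le> exp x" "(\<Sum>b\<in>B. exp (- g b)) \<le> exp y"
  shows "(\<Sum>p\<in>F. exp (- (f (fst p) + g (snd p)))) \<le> exp (x + y :: real)"
proof -
  have "(\<Sum>p\<in>F. exp (- (f (fst p) + g (snd p)))) \<le> (\<Sum>p\<in>A \<times> B. exp (- (f (fst p) + g (snd p))))"
    using assms by (intro sum_mono2) auto
  also have "\<dots> = (\<Sum>a\<in>A. exp (- f a)) * (\<Sum>b\<in>B. exp (- g b))"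
    by (simp add: sum_product sum.cartesian_product split_beta exp_add[symmetric])
  also have "\<dots> \<le> exp x * exp y" using assms by (intro mult_mono sum_nonneg) auto
  finally show ?thesis by (simp add: exp_add)
qed

lemma level_event:
  assumes "l \<le> K"
  obtains Bad where "Bad \<in> sets M" "prob Bad \<le> exp (- S)"
    "\<And>\<omega> c N. \<omega> \<in> space M - Bad \<Longrightarrow> c \<in> PiE {..<k} (\<lambda>_. codes l) \<Longrightarrow> N \<in> nets l \<Longrightarrow>
       (\<Sum>u<k. (dyadic (c u))\<^sup>2) \<le> 5 \<Longrightarrow> ip r (partial l N) (partial l N) \<le> 20 \<Longrightarrow>
       ip r (layer l N) (layer l N) \<le> 20 \<Longrightarrow>
       (\<Sum>p\<in>{..<k} \<times> {..<n}. trunc (cutoff l) (coef l c N p) * X \<omega> p)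
       \<le> ((\<Sum>u<k. code_cost K (c u)) + net_cost l N + real k * (6 * (1/16) ^ (K - l)) + S)
            * (4 * sqrt D * (1/4) ^ l / (1 + real (K - l)))
          + 100 * sqrt D * ((1 + real (K - l)) * exp ((1 + real (K - l)) / 2) * (1/4) ^ (K - l))"
proof -
  \<comment> \<open>The natural scale is \<open>1 / cutoff l\<close>. The extra factor
    \<open>1 + (K - l)\<close> divides the costs, which grow like \<open>K - l\<close>; its price is
    the factor \<open>exp ((1 + (K - l)) / 2)\<close> in the variance term, which the factor
    \<open>(1/4) ^ (K - l)\<close> in \<open>q * \<theta>\<close> outweighs.\<close>
  define \<theta> where "\<theta> = (1 + real (K - l)) / (2 * cutoff l)"
  define F where "F = {p. fst p \<in> PiE {..<k} (\<lambda>_. codes l) \<and> snd p \<in> nets l \<and>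
    (\<Sum>u<k. (dyadic (fst p u))\<^sup>2) \<le> 5 \<and> ip r (partial l (snd p)) (partial l (snd p)) \<le> 20 \<and>
    ip r (layer l (snd p)) (layer l (snd p)) \<le> 20}"
  have F_sub: "F \<subseteq> PiE {..<k} (\<lambda>_. codes l) \<times> nets l" by (simp add: F_def subset_iff mem_Times_iff)
  have fin: "finite (PiE {..<k} (\<lambda>_. codes l))" by (intro finite_PiE) auto
  have finF: "finite F" by (rule finite_subset[OF F_sub]) (use fin in auto)
  have \<theta>: "0 < \<theta>" using cutoff_pos[of l] by (simp add: \<theta>_def)
  have \<theta>m: "\<theta> * cutoff l = (1 + real (K - l)) / 2" using cutoff_pos[of l] by (simp add: \<theta>_def)
  have q\<theta>: "q * \<theta> \<le> sqrt D * ((1 + real (K - l)) * (1/4) ^ (K - l))"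
  proof -
    have "(1/4 :: real) ^ K = (1/4) ^ (K - l) * (1/4) ^ l" using assms by (simp flip: power_add)
    then have inv: "(1/4 :: real) ^ K * inverse ((1/4) ^ l) = (1/4) ^ (K - l)" by simp
    have "q * \<theta> \<le> (4 * D * (1/4) ^ K) * \<theta>"
      using q_le \<theta> by (intro mult_right_mono) (auto simp: power_divide)
    also have "\<dots> = (D / sqrt D) * (1 + real (K - l)) * ((1/4) ^ K * inverse ((1/4) ^ l))"
    proof -
      have "(4 * D * P) * (L / (2 * (2 * s * a))) = (D / s) * L * (P * inverse a)" for P L s a :: real
        by (cases "s = 0 \<or> a = 0") (auto simp: field_simps)
      then show ?thesis unfolding \<theta>_def cutoff_def .
    qed
    also have "\<dots> = sqrt D * ((1 + real (K - l)) * (1/4) ^ (K - l))"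
      unfolding inv using D_ge_1 by (simp add: real_div_sqrt)
    finally show ?thesis .
  qed
  have kraft: "(\<Sum>p\<in>F. exp (- ((\<Sum>u<k. code_cost K (fst p u)) + net_cost l (snd p))))
      \<le> exp (real k * (3 * (1/16) ^ (K - l)) + real k * (3 * (1/16) ^ (K - l)))"
    by (rule sum_product_subset_le[OF F_sub fin finite_nets kraft_code_vectors[OF assms] kraft_nets[OF assms]])
  show ?thesis
  proof (rule bernstein_union[OF finF \<theta>, of "cutoff l" "\<lambda>p. (\<lambda>e. trunc (cutoff l) (coef l (fst p) (snd p) e))" 100
        "\<lambda>p. (\<Sum>u<k. code_cost K (fst p u)) + net_cost l (snd p)" "real k * (6 * (1/16) ^ (K - l))" S])
    fix Bad
    assume Bad: "Bad \<in> sets M" "prob Bad \<le> exp (- S)"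
      and le: "\<And>\<omega> f. \<omega> \<in> space M - Bad \<Longrightarrow> f \<in> F \<Longrightarrow>
        (\<Sum>e\<in>{..<k} \<times> {..<n}. trunc (cutoff l) (coef l (fst f) (snd f) e) * X \<omega> e) \<le>
        ((\<Sum>u<k. code_cost K (fst f u)) + net_cost l (snd f) + real k * (6 * (1/16) ^ (K - l)) + S) / \<theta>
          + q * \<theta> * 100 * exp (\<theta> * cutoff l)"
    show thesis
    proof (rule that[OF Bad])
      fix \<omega> c N
      assume *: "\<omega> \<in> space M - Bad" "c \<in> PiE {..<k} (\<lambda>_. codes l)" "N \<in> nets l"
       "(\<Sum>u<k. (dyadic (c u))\<^sup>2) \<le> 5" "ip r (partial l N) (partial l N) \<le> 20" "ip r (layer l N) (layer l N) \<le> 20"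
      have "x / \<theta> = x * (4 * sqrt D * (1/4) ^ l / (1 + real (K - l)))" for x
        by (simp add: \<theta>_def cutoff_def)
      moreover have "q * \<theta> * 100 * exp (\<theta> * cutoff l)
         \<le> (sqrt D * ((1 + real (K - l)) * (1/4) ^ (K - l))) * 100 * exp ((1 + real (K - l)) / 2)"
        unfolding \<theta>m using q\<theta> by (intro mult_right_mono) auto
      ultimately show "(\<Sum>p\<in>{..<k} \<times> {..<n}. trunc (cutoff l) (coef l c N p) * X \<omega> p)
       \<le> ((\<Sum>u<k. code_cost K (c u)) + net_cost l N + real k * (6 * (1/16) ^ (K - l)) + S)
            * (4 * sqrt D * (1/4) ^ l / (1 + real (K - l)))
          + 100 * sqrt D * ((1 + real (K - l)) * exp ((1 + real (K - l)) / 2) * (1/4) ^ (K - l))"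
        using le[of \<omega> "(c, N)"] * by (simp add: F_def mult_ac)
    qed
  next
    show "(\<Sum>f\<in>F. exp (- ((\<Sum>u<k. code_cost K (fst f u)) + net_cost l (snd f))))
        \<le> exp (real k * (6 * (1/16) ^ (K - l)))"
    proof -
      have "a * (3 * b) + a * (3 * b) = a * (6 * b)" for a b :: real by simp
      from kraft[unfolded this] show ?thesis .
    qed
  next
    fix f assume "f \<in> F"
    then show "(\<Sum>e\<in>{..<k} \<times> {..<n}. (trunc (cutoff l) (coef l (fst f) (snd f) e))\<^sup>2) \<le> 100"
      by (intro coef_square_sum) (simp_all add: F_def)
  next
    show "\<bar>trunc (cutoff l) x\<bar> \<le> cutoff l" for x
      using cutoff_pos[of l] by (simp add: trunc_def)
  qed (use cutoff_pos[of l] in simp)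
qed

text \<open>After level \<open>K\<close> a residual remains that belongs to no net. It is named by
  coding the dyadic vector \<open>x\<close> as well and subtracting the approximation, which costs
  \<open>r \<le> k\<close> further coordinates, hence \<open>9 * real k\<close>. At
  \<open>cutoff K\<close>, of order \<open>sqrt D / k\<close>, an entropy of order \<open>k\<close>
  is affordable.\<close>

lemma remainder_event:
  obtains Bad where "Bad \<in> sets M" "prob Bad \<le> exp (- S)"
    "\<And>\<omega> c N x. \<omega> \<in> space M - Bad \<Longrightarrow> c \<in> PiE {..<k} (\<lambda>_. codes K) \<Longrightarrow> N \<in> nets K \<Longrightarrow>
       x \<in> PiE {..<r} (\<lambda>_. codes K) \<Longrightarrow> (\<Sum>u<k. (dyadic (c u))\<^sup>2) \<le> 5 \<Longrightarrow>
       ip r (\<lambda>j. dyadic (x j) - partial K N j) (\<lambda>j. dyadic (x j) - partial K N j) \<le> 20 \<Longrightarrow>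
       (\<Sum>p\<in>{..<k} \<times> {..<n}. trunc (cutoff K) (remainder_coef c (\<lambda>j. dyadic (x j) - partial K N j) p) * X \<omega> p)
       \<le> ((\<Sum>u<k. code_cost K (c u)) + net_cost K N + (\<Sum>j<r. code_cost K (x j)) + 9 * real k + S)
            * cutoff K + 600 * sqrt D"
proof -
  define \<theta> where "\<theta> = 1 / cutoff K"
  let ?w = "\<lambda>x N j. dyadic (x j) - partial K N j"
  let ?A = "PiE {..<k} (\<lambda>_. codes K)"
  let ?B = "PiE {..<r} (\<lambda>_. codes K)"
  define F where "F = {p. fst p \<in> ?A \<and> fst (snd p) \<in> nets K \<and> snd (snd p) \<in> ?B \<and>
    (\<Sum>u<k. (dyadic (fst p u))\<^sup>2) \<le> 5 \<and> ip r (?w (snd (snd p)) (fst (snd p))) (?w (snd (snd p)) (fst (snd p))) \<le> 20}"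
  have F_sub: "F \<subseteq> ?A \<times> (nets K \<times> ?B)" by (simp add: F_def subset_iff mem_Times_iff)
  have fin: "finite ?A" "finite ?B" by (intro finite_PiE; simp)+
  have finF: "finite F" by (rule finite_subset[OF F_sub]) (use fin in auto)
  have \<theta>: "0 < \<theta>" using cutoff_pos[of K] by (simp add: \<theta>_def)
  have q\<theta>: "q * \<theta> \<le> 2 * sqrt D"
  proof -
    have "q * \<theta> \<le> (4 * D / 4 ^ K) * \<theta>" using q_le \<theta> by (intro mult_right_mono) auto
    also have "\<dots> = 2 * (D / sqrt D)" by (simp add: \<theta>_def cutoff_def field_simps power_divide)
    also have "\<dots> = 2 * sqrt D" using D_ge_1 by (simp add: real_div_sqrt)
    finally show ?thesis .
  qed
  have kraft2: "(\<Sum>p\<in>nets K \<times> ?B. exp (- (net_cost K (fst p) + (\<Sum>j<r. code_cost K (snd p j)))))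
     \<le> exp (real k * (3 * (1/16) ^ (K - K)) + real r * (3 * (1/16) ^ (K - K)))"
    by (rule sum_product_subset_le[OF subset_refl finite_nets fin(2) kraft_nets[OF order_refl] kraft_code_vectors[OF order_refl]])
  have kraft: "(\<Sum>p\<in>F. exp (- ((\<Sum>u<k. code_cost K (fst p u)) + (net_cost K (fst (snd p)) + (\<Sum>j<r. code_cost K (snd (snd p) j))))))
      \<le> exp (real k * (3 * (1/16) ^ (K - K)) + (real k * (3 * (1/16) ^ (K - K)) + real r * (3 * (1/16) ^ (K - K))))"
    by (rule sum_product_subset_le[OF F_sub fin(1) _ kraft_code_vectors[OF order_refl] kraft2]) (use fin in auto)
  show ?thesis
  proof (rule bernstein_union[OF finF \<theta>, of "cutoff K"
        "\<lambda>p e. trunc (cutoff K) (remainder_coef (fst p) (?w (snd (snd p)) (fst (snd p))) e)" 100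
        "\<lambda>p. (\<Sum>u<k. code_cost K (fst p u)) + (net_cost K (fst (snd p)) + (\<Sum>j<r. code_cost K (snd (snd p) j)))" "9 * real k" S])
    fix Bad
    assume Bad: "Bad \<in> sets M" "prob Bad \<le> exp (- S)"
      and le: "\<And>\<omega> f. \<omega> \<in> space M - Bad \<Longrightarrow> f \<in> F \<Longrightarrow>
        (\<Sum>e\<in>{..<k} \<times> {..<n}. trunc (cutoff K) (remainder_coef (fst f) (?w (snd (snd f)) (fst (snd f))) e) * X \<omega> e) \<le>
        ((\<Sum>u<k. code_cost K (fst f u)) + (net_cost K (fst (snd f)) + (\<Sum>j<r. code_cost K (snd (snd f) j))) + 9 * real k + S) / \<theta>
          + q * \<theta> * 100 * exp (\<theta> * cutoff K)"
    show thesis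
    proof (rule that[OF Bad])
      fix \<omega> c N x
      assume *: "\<omega> \<in> space M - Bad" "c \<in> ?A" "N \<in> nets K" "x \<in> ?B"
       "(\<Sum>u<k. (dyadic (c u))\<^sup>2) \<le> 5" "ip r (?w x N) (?w x N) \<le> 20"
      have "y / \<theta> = y * cutoff K" for y by (simp add: \<theta>_def)
      moreover have "q * \<theta> * 100 * exp (\<theta> * cutoff K) \<le> (2 * sqrt D) * 100 * 3"
      proof -
        have "\<theta> * cutoff K = 1" using cutoff_pos[of K] by (simp add: \<theta>_def)
        moreover have "q * \<theta> * (100 * exp 1) \<le> (2 * sqrt D) * (100 * 3)"
          by (rule mult_mono[OF q\<theta>]) (use exp_le D_ge_1 in auto)
        ultimately show ?thesis by (simp add: mult.assoc)
      qed
      ultimately show "(\<Sum>p\<in>{..<k} \<times> {..<n}. trunc (cutoff K) (remainder_coef c (?w x N) p) * X \<omega> p)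
       \<le> ((\<Sum>u<k. code_cost K (c u)) + net_cost K N + (\<Sum>j<r. code_cost K (x j)) + 9 * real k + S)
            * cutoff K + 600 * sqrt D"
        using le[of \<omega> "(c, N, x)"] * by (simp add: F_def algebra_simps)
    qed
  next
    have "exp (real k * (3 * (1/16) ^ (K - K)) + (real k * (3 * (1/16) ^ (K - K)) + real r * (3 * (1/16) ^ (K - K))))
        \<le> exp (9 * real k)"
      using r_le by simp
    with kraft show "(\<Sum>p\<in>F. exp (- ((\<Sum>u<k. code_cost K (fst p u)) + (net_cost K (fst (snd p)) + (\<Sum>j<r. code_cost K (snd (snd p) j))))))
      \<le> exp (9 * real k)" by linarith
  next
    fix f assume "f \<in> F"
    then show "(\<Sum>e\<in>{..<k} \<times> {..<n}. (trunc (cutoff K) (remainder_coef (fst f) (?w (snd (snd f)) (fst (snd f))) e))\<^sup>2) \<le> 100"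
      by (intro remainder_square_sum) (simp_all add: F_def)
  next
    show "\<bar>trunc (cutoff K) x\<bar> \<le> cutoff K" for x
      using cutoff_pos[of K] by (simp add: trunc_def)
  qed (use cutoff_pos[of K] in simp)
qed

end

section \<open>Truncated entries and the total cost\<close>

lemma ln_16_le: "ln (16 :: real) \<le> 4"
proof -
  have "ln (16 :: real) = ln (2 ^ 4)" by simp
  also have "\<dots> = 4 * ln 2" by (subst ln_realpow) auto
  finally show ?thesis using ln_le_minus_one[of "2 :: real"] by simp
qed

context sparse_frame begin

lemma Y_diff: "Y i (\<lambda>j. x j - y j) = Y i x - Y i y"
  by (simp add: Y_def ip_diff_right algebra_simps)

lemma step_pos: "0 < step l"
  using \<rho>_pos by (simp add: step_def)

lemma step_square: "(step l)\<^sup>2 = (1/4) ^ l / \<rho>"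
proof -
  have "((1/2 :: real) ^ l)\<^sup>2 = (1/4) ^ l" by (simp add: power2_eq_square flip: power_mult_distrib)
  then show ?thesis using \<rho>_pos unfolding step_def power_divide by simp
qed

lemma pursuit_decomposition:
  assumes v: "ip r v v \<le> 5"
  obtains N w where
    "w 0 = v" "\<And>l. layer l N = (\<lambda>j. w l j - w (Suc l) j)" "\<And>l. partial l N = (\<lambda>j. v j - w (Suc l) j)"
    "\<And>i l. i \<in> J \<Longrightarrow> \<bar>Y i (w (Suc l))\<bar> \<le> sqrt (\<tau> i) * step l"
    "\<And>l. ip r (w l) (w l) \<le> 5"
    "(\<Sum>l\<le>K. (step l)\<^sup>2 * (\<Sum>i\<in>J. \<bar>of_int (N (l, i))\<bar>)) \<le> 5"
    "\<And>l. l \<le> K \<Longrightarrow> restrict N ({..l} \<times> J) \<in> nets l"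
proof -
  obtain N0 w where w: "w 0 = v"
    "\<And>l j. w (Suc l) j = w l j - step l * (\<Sum>i\<in>J. of_int (N0 l i) * e i j)"
    "\<And>l i. i \<in> J \<Longrightarrow> \<bar>ip r (e i) (w (Suc l))\<bar> \<le> step l"
    "\<And>l. ip r (w l) (w l) + (\<Sum>l'<l. (step l')\<^sup>2 * (\<Sum>i\<in>J. \<bar>of_int (N0 l' i)\<bar>)) \<le> ip r v v"
    by (rule matching_pursuit_levels[of J r e step v, OF finite_J]) (erule e_norm, rule step_pos, rule that)
  define N where "N = (\<lambda>(l, i). N0 l i)"
  have layer: "layer l N = (\<lambda>j. w l j - w (Suc l) j)" for l
    by (simp add: fun_eq_iff layer_def N_def w(2))
  have partial: "partial l N = (\<lambda>j. v j - w (Suc l) j)" for l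
  proof
    fix j
    have "partial l N j = (\<Sum>l'<Suc l. w l' j - w (Suc l') j)"
      by (simp add: partial_def layer lessThan_Suc_atMost)
    also have "\<dots> = w 0 j - w (Suc l) j"
      by (rule sum_lessThan_telescope')
    finally show "partial l N j = v j - w (Suc l) j" by (simp add: w(1))
  qed
  have nonneg: "0 \<le> (\<Sum>l'<l. (step l')\<^sup>2 * (\<Sum>i\<in>J. \<bar>of_int (N0 l' i) :: real\<bar>))" for l
    by (intro sum_nonneg mult_nonneg_nonneg) auto
  have wle: "ip r (w l) (w l) \<le> 5" for l
    using w(4)[of l] nonneg[of l] v by linarith
  have Nle: "(\<Sum>l\<le>K. (step l)\<^sup>2 * (\<Sum>i\<in>J. \<bar>of_int (N (l, i))\<bar>)) \<le> 5"
    using w(4)[of "Suc K"] ip_self_nonneg[of r "w (Suc K)"] v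
    unfolding N_def prod.case lessThan_Suc_atMost by linarith
  show ?thesis
  proof (rule that[OF w(1) layer partial _ wle Nle])
    fix i l assume "i \<in> J"
    then show "\<bar>Y i (w (Suc l))\<bar> \<le> sqrt (\<tau> i) * step l"
      using w(3)[of i l] \<tau>_nonneg[of i] by (simp add: Y_def abs_mult mult_left_mono)
  next
    fix l assume l: "l \<le> K"
    have "- int (5 * 4 ^ K) \<le> N (l', i) \<and> N (l', i) \<le> int (5 * 4 ^ K)" if "l' \<le> l" "i \<in> J" for l' i
    proof -
      \<comment> \<open>Every use of an atom spends at least \<open>(1/4) ^ K\<close> of the budget
        5, so the multiplicities fit into the alphabet of \<open>nets\<close>.\<close>
      have "(1/4) ^ K \<le> (1/4 :: real) ^ l'" using that l by (intro power_decreasing) auto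
      also have "\<dots> \<le> (1/4) ^ l' / \<rho>" using \<rho>_pos \<rho>_le by (simp add: field_simps)
      finally have step: "(1/4) ^ K \<le> (step l')\<^sup>2" unfolding step_square .
      have "(1/4) ^ K * \<bar>of_int (N (l', i))\<bar> \<le> (step l')\<^sup>2 * (\<Sum>i\<in>J. \<bar>of_int (N (l', i)) :: real\<bar>)"
        using that finite_J by (intro mult_mono[OF step] member_le_sum) auto
      also have "\<dots> \<le> (\<Sum>l\<le>K. (step l)\<^sup>2 * (\<Sum>i\<in>J. \<bar>of_int (N (l, i))\<bar>))"
        using that l by (intro member_le_sum) (auto intro: sum_nonneg)
      also note Nle
      finally have "\<bar>of_int (N (l', i))\<bar> \<le> (5 * 4 ^ K :: real)"
        by (simp add: field_simps power_divide)
      then have "\<bar>of_int (N (l', i))\<bar> \<le> (of_int (5 * 4 ^ K) :: real)" by simp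
      then have "\<bar>N (l', i)\<bar> \<le> 5 * 4 ^ K" by (simp only: of_int_abs[symmetric] of_int_le_iff)
      then show ?thesis by (simp add: abs_le_iff)
    qed
    then show "restrict N ({..l} \<times> J) \<in> nets l" by (auto simp: nets_def)
  qed
qed

definition excess :: "real \<Rightarrow> real \<Rightarrow> real" where "excess m x = (if \<bar>x\<bar> \<le> m then 0 else \<bar>x\<bar>)"

lemma abs_le_trunc_excess: "x * y \<le> trunc m x * y + excess m x * \<bar>y\<bar>"
proof -
  have "x * y \<le> \<bar>x\<bar> * \<bar>y\<bar>" by (metis abs_ge_self abs_mult)
  then show ?thesis by (simp add: trunc_def excess_def)
qed

text \<open>Here \<open>y = Y i v\<close> and \<open>y'\<close> is its level \<open>b\<close> approximation: a truncated entry forces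
  \<open>\<bar>y\<bar> \<ge> a * sqrt D\<close>, so the column degrees pay for it.\<close>

lemma excess_own_level:
  assumes a: "a = (1/2) ^ b" and le: "\<bar>y'\<bar> \<le> \<bar>y\<bar> + a" and z: "\<bar>z\<bar> = a"
  shows "excess (cutoff b) (z * y') \<le> 2 * y\<^sup>2 / sqrt D"
proof (cases "\<bar>z * y'\<bar> \<le> cutoff b")
  case True
  then show ?thesis using D_ge_1 by (simp add: excess_def)
next
  case False
  have apos: "0 < a" by (simp add: a)
  have s: "1 \<le> sqrt D" using D_ge_1 by simp
  have "(1/4 :: real) ^ b = a * a" by (simp add: a flip: power_mult_distrib)
  with False z have "2 * sqrt D * a * a < a * \<bar>y'\<bar>" by (simp add: cutoff_def abs_mult)
  then have big: "2 * sqrt D * a < \<bar>y'\<bar>" using apos by simp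
  have "1 * a \<le> sqrt D * a" using s apos by (intro mult_right_mono) auto
  with big le have y2: "\<bar>y'\<bar> \<le> 2 * \<bar>y\<bar>" by linarith
  with big have "sqrt D * a \<le> \<bar>y\<bar>" by linarith
  then have ay: "a \<le> \<bar>y\<bar> / sqrt D" using s by (simp add: field_simps)
  have "\<bar>z * y'\<bar> \<le> a * (2 * \<bar>y\<bar>)" using y2 apos z by (simp add: abs_mult)
  also have "\<dots> \<le> (\<bar>y\<bar> / sqrt D) * (2 * \<bar>y\<bar>)" using ay by (intro mult_right_mono) auto
  also have "\<dots> = 2 * y\<^sup>2 / sqrt D" by (simp add: power2_eq_square abs_mult_self_eq)
  finally show ?thesis using False by (simp add: excess_def)
qed

lemma excess_le_square:
  assumes "\<bar>x\<bar> \<le> y"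
  shows "excess (cutoff l) x \<le> y\<^sup>2 / cutoff l"
proof (cases "\<bar>x\<bar> \<le> cutoff l")
  case True
  then show ?thesis using cutoff_pos[of l] by (simp add: excess_def)
next
  case False
  have "\<bar>x\<bar> * cutoff l \<le> y * y"
    using False assms cutoff_pos[of l] by (intro mult_mono) auto
  then show ?thesis
    using False cutoff_pos[of l] by (simp add: excess_def pos_le_divide_eq power2_eq_square)
qed

text \<open>An entry has three regimes: nothing before its level \<open>b\<close>; at level
  \<open>b\<close> a payment in \<open>(Y i v)\<^sup>2\<close>, later charged to columns; afterwards
  a payment in \<open>\<tau> i\<close>, later charged to rows, 9 units for the layers and 1 for the
  final residual.\<close>

lemma entry_excess:
  assumes i: "i \<in> J" and b: "b \<le> K" and z: "\<bar>z\<bar> = (1/2) ^ b"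
    and layer: "\<And>l. layer l N = (\<lambda>j. w l j - w (Suc l) j)"
    and partial: "partial b N = (\<lambda>j. v j - w (Suc b) j)"
    and w: "\<And>l. \<bar>Y i (w (Suc l))\<bar> \<le> sqrt (\<tau> i) * step l"
  shows "(\<Sum>l\<le>K. excess (cutoff l) (if l < b then 0 else z * Y i (if b = l then partial l N else layer l N)))
      + excess (cutoff K) (z * Y i (w (Suc K)))
     \<le> 2 * (Y i v)\<^sup>2 / sqrt D + 10 * ((1/4) ^ b * \<tau> i) / (\<rho> * sqrt D)"
proof -
  \<comment> \<open>The 3 is 2 + 1: a layer is the difference of consecutive residuals, controlled
    by \<open>step (l - 1) = 2 * step l\<close> and by \<open>step l\<close>.\<close>
  define c where "c = 3 * (1/2) ^ b * sqrt (\<tau> i / \<rho>)"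
  have s: "1 \<le> sqrt D" using D_ge_1 by simp
  have ti: "0 \<le> \<tau> i / \<rho>" using \<tau>_nonneg[of i] \<rho>_pos by simp
  have c0: "0 \<le> c" using ti by (simp add: c_def)
  have b4: "((1/2 :: real) ^ b)\<^sup>2 = (1/4) ^ b" for b :: nat
    by (simp add: power2_eq_square flip: power_mult_distrib)
  have c2: "c\<^sup>2 = 9 * ((1/4) ^ b * \<tau> i) / \<rho>"
    using ti by (simp add: c_def power_mult_distrib b4)
  have sq: "sqrt (\<tau> i) * step l = sqrt (\<tau> i / \<rho>) * (1/2) ^ l" for l
    by (simp add: step_def real_sqrt_divide)
  have own: "excess (cutoff b) (z * Y i (partial b N)) \<le> 2 * (Y i v)\<^sup>2 / sqrt D"
  proof (rule excess_own_level[OF refl _ z])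
    have "sqrt (\<tau> i / \<rho>) \<le> 1" using \<tau>_le[OF i] \<rho>_pos by simp
    then have "sqrt (\<tau> i) * step b \<le> 1 * (1/2) ^ b" unfolding sq by (intro mult_right_mono) auto
    then show "\<bar>Y i (partial b N)\<bar> \<le> \<bar>Y i v\<bar> + (1/2) ^ b"
      using w[of b] unfolding partial Y_diff by linarith
  qed
  have fine: "excess (cutoff l) (z * Y i (layer l N))
      \<le> (if 2 * sqrt D * (1/4) ^ l < c * (1/2) ^ l then c * (1/2) ^ l else 0)" if "b < l" for l
  proof -
    obtain l' where l': "l = Suc l'" using \<open>b < l\<close> by (cases l) auto
    have "\<bar>Y i (layer l N)\<bar> \<le> sqrt (\<tau> i) * step l' + sqrt (\<tau> i) * step l"
      using w[of l'] w[of l] unfolding layer Y_diff l' by linarith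
    also have "\<dots> = 3 * sqrt (\<tau> i / \<rho>) * (1/2) ^ l" unfolding sq l' by simp
    finally have "\<bar>z * Y i (layer l N)\<bar> \<le> (1/2) ^ b * (3 * sqrt (\<tau> i / \<rho>) * (1/2) ^ l)"
      unfolding abs_mult z by (intro mult_left_mono) auto
    also have "\<dots> = c * (1/2) ^ l" by (simp add: c_def)
    finally show ?thesis by (auto simp: excess_def cutoff_def)
  qed
  have "(\<Sum>l\<le>K. excess (cutoff l) (if l < b then 0 else z * Y i (if b = l then partial l N else layer l N)))
     \<le> (\<Sum>l\<le>K. (if l = b then 2 * (Y i v)\<^sup>2 / sqrt D else 0)
          + (if 2 * sqrt D * (1/4) ^ l < c * (1/2) ^ l then c * (1/2) ^ l else 0))"
  proof (rule sum_mono)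
    fix l
    consider "l < b" | "l = b" | "b < l" by linarith
    then show "excess (cutoff l) (if l < b then 0 else z * Y i (if b = l then partial l N else layer l N))
      \<le> (if l = b then 2 * (Y i v)\<^sup>2 / sqrt D else 0)
          + (if 2 * sqrt D * (1/4) ^ l < c * (1/2) ^ l then c * (1/2) ^ l else 0)"
    proof cases
      case 1
      then show ?thesis using c0 cutoff_pos[of l] by (simp add: excess_def)
    next
      case 2
      have "0 \<le> (if 2 * sqrt D * (1/4) ^ l < c * (1/2) ^ l then c * (1/2) ^ l else 0)"
        using c0 by simp
      with own show ?thesis unfolding 2 by (simp del: if_split)
    next
      case 3
      then show ?thesis using fine[OF 3] by simp
    qed
  qed
  also have "\<dots> = 2 * (Y i v)\<^sup>2 / sqrt D
      + (\<Sum>l<Suc K. if 2 * sqrt D * (1/4) ^ l < c * (1/2) ^ l then c * (1/2) ^ l else 0)"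
    using b by (simp add: sum.distrib lessThan_Suc_atMost)
  also have "\<dots> \<le> 2 * (Y i v)\<^sup>2 / sqrt D + 2 * c\<^sup>2 / (2 * sqrt D)"
    using geometric_truncated_sum[OF c0, of "2 * sqrt D" "Suc K"] s by simp
  also have "2 * c\<^sup>2 / (2 * sqrt D) = 9 * ((1/4) ^ b * \<tau> i) / (\<rho> * sqrt D)" by (simp add: c2)
  finally have 1: "(\<Sum>l\<le>K. excess (cutoff l) (if l < b then 0 else z * Y i (if b = l then partial l N else layer l N)))
     \<le> 2 * (Y i v)\<^sup>2 / sqrt D + 9 * ((1/4) ^ b * \<tau> i) / (\<rho> * sqrt D)" .
  have "\<bar>z * Y i (w (Suc K))\<bar> \<le> (1/2) ^ b * (sqrt (\<tau> i / \<rho>) * (1/2) ^ K)"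
    unfolding abs_mult z using w[of K] unfolding sq by (intro mult_left_mono) auto
  from excess_le_square[OF this, of K]
  have "excess (cutoff K) (z * Y i (w (Suc K))) \<le> ((1/2) ^ b * (sqrt (\<tau> i / \<rho>) * (1/2) ^ K))\<^sup>2 / cutoff K" .
  also have "\<dots> = ((1/4) ^ b * \<tau> i) / (\<rho> * sqrt D) / 2"
    using ti by (simp add: power_mult_distrib b4 cutoff_def)
  also have "\<dots> \<le> ((1/4) ^ b * \<tau> i) / (\<rho> * sqrt D)"
  proof -
    have "0 \<le> ((1/4) ^ b * \<tau> i) / (\<rho> * sqrt D)" using \<tau>_nonneg[of i] \<rho>_pos s by simp
    moreover have "x / 2 \<le> x" if "0 \<le> x" for x :: real using that by simp
    ultimately show ?thesis by blast
  qed
  finally have 2: "excess (cutoff K) (z * Y i (w (Suc K))) \<le> ((1/4) ^ b * \<tau> i) / (\<rho> * sqrt D)" .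
  have "9 * ((1/4) ^ b * \<tau> i) / (\<rho> * sqrt D) + ((1/4) ^ b * \<tau> i) / (\<rho> * sqrt D)
      = 10 * ((1/4) ^ b * \<tau> i) / (\<rho> * sqrt D)" by (simp add: add_divide_distrib[symmetric])
  with 1 2 show ?thesis by linarith
qed

text \<open>The part with \<open>Y i v\<close> is summed over \<open>u\<close> first and uses column
  degrees, the part with \<open>\<tau> i\<close> over \<open>i\<close> first and uses row weights.
  Each time \<open>D / sqrt D = sqrt D\<close> remains, with constants \<open>2 * 5\<close> and
  \<open>10 * 5\<close>.\<close>

lemma excess_total:
  assumes XH: "\<And>p. p \<in> {..<k} \<times> {..<n} \<Longrightarrow> \<bar>X \<omega> p\<bar> \<le> H \<omega> p"
    and col: "\<And>i. i \<in> J \<Longrightarrow> (\<Sum>u<k. H \<omega> (u, i)) \<le> C1 * D"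
    and row: "\<And>u. u < k \<Longrightarrow> (\<Sum>i\<in>J. H \<omega> (u, i) * \<tau> i) \<le> C1 * D * \<rho>"
    and C1: "0 \<le> C1" and b: "(\<Sum>u<k. (1/4 :: real) ^ b u) \<le> 5" and v: "ip r v v \<le> 5"
  shows "(\<Sum>u<k. \<Sum>i\<in>J. (2 * (Y i v)\<^sup>2 / sqrt D + 10 * ((1/4) ^ b u * \<tau> i) / (\<rho> * sqrt D)) * \<bar>X \<omega> (u, i)\<bar>)
     \<le> 60 * C1 * sqrt D"
proof -
  have s: "0 < sqrt D" using D_ge_1 by simp
  have "(\<Sum>u<k. \<Sum>i\<in>J. (2 * (Y i v)\<^sup>2 / sqrt D + 10 * ((1/4) ^ b u * \<tau> i) / (\<rho> * sqrt D)) * \<bar>X \<omega> (u, i)\<bar>)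
      \<le> (\<Sum>u<k. \<Sum>i\<in>J. (2 * (Y i v)\<^sup>2 / sqrt D + 10 * ((1/4) ^ b u * \<tau> i) / (\<rho> * sqrt D)) * H \<omega> (u, i))"
    using s \<rho>_pos \<tau>_nonneg J_subset
    by (intro sum_mono mult_left_mono XH add_nonneg_nonneg) auto
  also have "\<dots> = (\<Sum>u<k. \<Sum>i\<in>J. (2 / sqrt D * (Y i v)\<^sup>2) * H \<omega> (u, i))
      + (\<Sum>u<k. \<Sum>i\<in>J. (10 / (\<rho> * sqrt D) * (1/4) ^ b u) * (H \<omega> (u, i) * \<tau> i))"
    unfolding sum.distrib[symmetric] by (intro sum.cong) (simp_all add: algebra_simps)
  also have "(\<Sum>u<k. \<Sum>i\<in>J. (2 / sqrt D * (Y i v)\<^sup>2) * H \<omega> (u, i))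
      = (\<Sum>i\<in>J. (2 / sqrt D * (Y i v)\<^sup>2) * (\<Sum>u<k. H \<omega> (u, i)))"
    by (subst sum.swap) (simp add: sum_distrib_left)
  also have "\<dots> \<le> (\<Sum>i\<in>J. (2 / sqrt D * (Y i v)\<^sup>2) * (C1 * D))"
    using s col by (intro sum_mono mult_left_mono) auto
  also have "\<dots> = (2 / sqrt D * (C1 * D)) * (\<Sum>i\<in>J. (Y i v)\<^sup>2)"
    unfolding sum_distrib_left by (intro sum.cong) auto
  also have "\<dots> \<le> (2 / sqrt D * (C1 * D)) * 5"
    using sum_Y_le[of v] v s C1 D_ge_1 by (intro mult_left_mono) auto
  also have "\<dots> = 10 * C1 * sqrt D"
    using D_ge_1 by (simp add: real_div_sqrt field_simps)
  also have "(\<Sum>u<k. \<Sum>i\<in>J. (10 / (\<rho> * sqrt D) * (1/4) ^ b u) * (H \<omega> (u, i) * \<tau> i))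
      = (\<Sum>u<k. (10 / (\<rho> * sqrt D) * (1/4) ^ b u) * (\<Sum>i\<in>J. H \<omega> (u, i) * \<tau> i))"
    by (simp add: sum_distrib_left)
  also have "\<dots> \<le> (\<Sum>u<k. (10 / (\<rho> * sqrt D) * (1/4) ^ b u) * (C1 * D * \<rho>))"
    using s \<rho>_pos row by (intro sum_mono mult_left_mono) auto
  also have "\<dots> = (10 / (\<rho> * sqrt D) * (C1 * D * \<rho>)) * (\<Sum>u<k. (1/4) ^ b u)"
    unfolding sum_distrib_left by (intro sum.cong) auto
  also have "\<dots> \<le> (10 / (\<rho> * sqrt D) * (C1 * D * \<rho>)) * 5"
    using b s \<rho>_pos C1 D_ge_1 by (intro mult_left_mono) auto
  also have "\<dots> = 50 * C1 * sqrt D"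
    using D_ge_1 \<rho>_pos by (simp add: real_div_sqrt field_simps)
  finally show ?thesis by simp
qed


section \<open>Summing the union-bound costs over all scales\<close>

definition weight :: "nat \<Rightarrow> real" where "weight l = (1/4) ^ l / (1 + real (K - l))"

text \<open>A coordinate or atom first named at level \<open>b a\<close> is named again in the union
  bound of every finer level. By \<open>weighted_level_sum\<close> all these payments are at most
  twice the first. Up to the factor \<open>4 * sqrt D\<close>, \<open>weight\<close> is the
  reciprocal of the Bernstein parameter.\<close>

lemma nested_cost_sum:
  assumes "finite A" "\<And>a. a \<in> A \<Longrightarrow> b a \<le> K" "\<And>a. a \<in> A \<Longrightarrow> 0 \<le> f a"
  shows "(\<Sum>l\<le>K. (\<Sum>a\<in>A. if b a \<le> l then f a else 0) * weight l)
      \<le> (\<Sum>a\<in>A. f a * (2 * weight (b a)))"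
proof -
  have "(\<Sum>l\<le>K. (\<Sum>a\<in>A. if b a \<le> l then f a else 0) * weight l)
      = (\<Sum>a\<in>A. \<Sum>l\<le>K. if b a \<le> l then f a * weight l else 0)"
    unfolding sum_distrib_right by (subst sum.swap) (intro sum.cong; simp)
  also have "\<dots> \<le> (\<Sum>a\<in>A. f a * (2 * weight (b a)))"
  proof (rule sum_mono)
    fix a assume a: "a \<in> A"
    have "(\<Sum>l\<le>K. if b a \<le> l then f a * weight l else 0) = (\<Sum>l=b a..K. f a * weight l)"
      by (rule sum.mono_neutral_cong_right) auto
    also have "\<dots> = f a * (\<Sum>l=b a..K. weight l)" by (simp add: sum_distrib_left)
    also have "\<dots> \<le> f a * (2 * weight (b a))"
      using weighted_level_sum[OF assms(2)[OF a]] assms(3)[OF a]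
      by (intro mult_left_mono) (simp_all add: weight_def)
    finally show "(\<Sum>l\<le>K. if b a \<le> l then f a * weight l else 0) \<le> f a * (2 * weight (b a))" .
  qed
  finally show ?thesis .
qed

lemma power_four_split: "l \<le> K \<Longrightarrow> (1/4 :: real) ^ l = (1/4) ^ K * 4 ^ (K - l)"
proof -
  assume "l \<le> K"
  then have "(1/4 :: real) ^ K = (1/4) ^ l * (1/4) ^ (K - l)" by (simp flip: power_add)
  then show ?thesis by (simp add: power_divide)
qed

lemma k_quarter_le: "real k * (1/4) ^ K \<le> 1"
proof -
  have "real k \<le> real (4 ^ K)" using K_lower by (rule of_nat_mono)
  then show ?thesis by (simp add: power_divide)
qed

lemma atom_cost_nonneg: "0 \<le> atom_cost l"
proof -
  have "0 < real k" using k_ge by simp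
  then have "1 \<le> 2 * nn / real k" using nn_ge by (simp add: field_simps)
  then show ?thesis by (simp add: atom_cost_def)
qed

text \<open>Here \<open>\<rho>_ln\<close> enters: the number of atoms allowed is proportional to
  \<open>\<rho>\<close>, so naming one may cost as much as \<open>1 / \<rho>\<close>. The 6 collects
  \<open>ln 2 \<le> 1\<close>, the 1 of \<open>\<rho>_ln\<close> and
  \<open>ln 16 \<le> 4\<close>.\<close>

lemma atom_cost_le: "\<rho> * atom_cost l \<le> 6 * (1 + real (K - l))"
proof -
  have pos: "0 < real k" "0 < nn" using k_ge nn_ge by linarith+
  have "ln (2 * nn / real k) = ln 2 + ln (nn / real k)"
    using pos by (simp add: ln_mult ln_div)
  then have "\<rho> * atom_cost l = \<rho> * ln 2 + \<rho> * ln (nn / real k) + \<rho> * (ln 16 * real (K - l))"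
    by (simp add: atom_cost_def algebra_simps)
  also have "\<dots> \<le> 1 * 1 + 1 + 1 * (4 * real (K - l))"
    using \<rho>_pos \<rho>_le \<rho>_ln ln_16_le ln_le_minus_one[of "2 :: real"]
    by (intro add_mono mult_mono mult_nonneg_nonneg) auto
  finally show ?thesis by simp
qed

lemma ln_k_le: "ln (real k) \<le> 2 * real K"
proof -
  have "ln (real k) \<le> ln (real (4 ^ K))"
    using of_nat_mono[OF K_lower, where ?'a = real] k_ge by (intro ln_mono) auto
  also have "\<dots> = real K * ln (2 ^ 2)" by (simp add: ln_realpow)
  also have "\<dots> = real K * (2 * ln 2)" by (subst ln_realpow) auto
  also have "\<dots> \<le> real K * 2" using ln_le_minus_one[of "2 :: real"] by (intro mult_left_mono) auto
  finally show ?thesis by simp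
qed

lemma le_four_power: "real d \<le> 4 ^ d"
proof -
  have "Suc d \<le> 4 ^ d" by (induction d) auto
  then have "real d \<le> real (4 ^ d)" by (intro of_nat_mono) simp
  then show ?thesis by simp
qed

text \<open>Up to the factor \<open>4 * sqrt D\<close>, the coordinates cost 40, the atoms 60, the
  Kraft constants 8 and the confidence \<open>4 * \<beta>\<close>. For the first two, the
  denominator of \<open>weight\<close> cancels the growth of the price in \<open>K - l\<close>, and
  the budgets 5 conclude.\<close>

lemma total_cost:
  assumes b: "\<And>u. u < k \<Longrightarrow> b u \<le> K" "(\<Sum>u<k. (1/4 :: real) ^ b u) \<le> 5"
    and m: "\<And>l. 0 \<le> m l" "(\<Sum>l\<le>K. (step l)\<^sup>2 * m l) \<le> 5" and \<beta>: "0 \<le> \<beta>"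
  shows "(\<Sum>l\<le>K. ((\<Sum>u<k. if b u \<le> l then ln 16 * real (K - b u) else 0)
        + (\<Sum>l'\<le>l. atom_cost l' * m l') + real k * (6 * (1/16) ^ (K - l)) + \<beta> * ln (real k))
      * (4 * sqrt D * (1/4) ^ l / (1 + real (K - l)))) \<le> sqrt D * (432 + 16 * \<beta>)"
proof -
  let ?z = "\<lambda>l. \<Sum>u<k. if b u \<le> l then ln 16 * real (K - b u) else 0"
  let ?a = "\<lambda>l. \<Sum>l'\<le>l. atom_cost l' * m l'"
  have z: "(\<Sum>l\<le>K. ?z l * weight l) \<le> 40"
  proof -
    have "(\<Sum>l\<le>K. ?z l * weight l) \<le> (\<Sum>u<k. (ln 16 * real (K - b u)) * (2 * weight (b u)))"
      by (rule nested_cost_sum) (use b in auto)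
    also have "\<dots> \<le> (\<Sum>u<k. 8 * (1/4) ^ b u)"
    proof (rule sum_mono)
      fix u
      have "(ln 16 * real (K - b u)) * (2 * weight (b u))
          = ln 16 * 2 * (1/4) ^ b u * (real (K - b u) / (1 + real (K - b u)))"
        by (simp add: weight_def)
      also have "\<dots> \<le> 4 * 2 * (1/4) ^ b u * 1"
        using ln_16_le by (intro mult_mono) (auto simp: divide_le_eq)
      finally show "(ln 16 * real (K - b u)) * (2 * weight (b u)) \<le> 8 * (1/4) ^ b u" by simp
    qed
    also have "\<dots> = 8 * (\<Sum>u<k. (1/4) ^ b u)" by (simp add: sum_distrib_left)
    finally show ?thesis using b(2) by linarith
  qed
  have a: "(\<Sum>l\<le>K. ?a l * weight l) \<le> 60"
  proof -
    have eq: "?a l = (\<Sum>l'\<le>K. if l' \<le> l then atom_cost l' * m l' else 0)" if "l \<le> K" for l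
      using that by (intro sum.mono_neutral_cong_left) auto
    have "(\<Sum>l\<le>K. ?a l * weight l) = (\<Sum>l\<le>K. (\<Sum>l'\<le>K. if l' \<le> l then atom_cost l' * m l' else 0) * weight l)"
      by (rule sum.cong[OF refl]) (simp only: atMost_iff eq)
    also have "\<dots> \<le> (\<Sum>l'\<le>K. (atom_cost l' * m l') * (2 * weight l'))"
      by (rule nested_cost_sum) (use m(1) atom_cost_nonneg in auto)
    also have "\<dots> \<le> (\<Sum>l\<le>K. 12 * ((step l)\<^sup>2 * m l))"
    proof (rule sum_mono)
      fix l
      have "(atom_cost l * m l) * (2 * weight l) = 2 * ((step l)\<^sup>2 * m l) * (\<rho> * atom_cost l / (1 + real (K - l)))"
        using \<rho>_pos by (simp add: weight_def step_square)
      also have "\<dots> \<le> 2 * ((step l)\<^sup>2 * m l) * 6"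
        using atom_cost_le[of l] m(1)[of l] by (intro mult_left_mono) (auto simp: divide_le_eq)
      finally show "(atom_cost l * m l) * (2 * weight l) \<le> 12 * ((step l)\<^sup>2 * m l)" by simp
    qed
    also have "\<dots> = 12 * (\<Sum>l\<le>K. (step l)\<^sup>2 * m l)" by (simp add: sum_distrib_left)
    finally show ?thesis using m(2) by linarith
  qed
  \<comment> \<open>This is the reason for 16 in the costs: multiplied by \<open>(1/4) ^ l\<close>,
    the term \<open>k * (1/16) ^ (K - l)\<close> becomes \<open>(1/4) ^ (K - l)\<close> times
    \<open>k * (1/4) ^ K \<le> 1\<close>. With 4 in place of 16 no geometric decay would
    remain.\<close>
  have f: "(\<Sum>l\<le>K. real k * (6 * (1/16) ^ (K - l)) * weight l) \<le> 8"
  proof -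
    have "(\<Sum>l\<le>K. real k * (6 * (1/16) ^ (K - l)) * weight l) \<le> (\<Sum>l\<le>K. 6 * (1/4) ^ (K - l))"
    proof (rule sum_mono)
      fix l assume "l \<in> {..K}"
      then have l: "(1/4 :: real) ^ l = (1/4) ^ K * 4 ^ (K - l)" by (intro power_four_split) simp
      have w: "weight l \<le> (1/4) ^ l" by (simp add: weight_def divide_le_eq mult_ge1_I)
      have "(1/16 :: real) ^ (K - l) * 4 ^ (K - l) = (1/4) ^ (K - l)" by (simp flip: power_mult_distrib)
      then have eq: "real k * (6 * (1/16) ^ (K - l)) * (1/4) ^ l = 6 * (1/4) ^ (K - l) * (real k * (1/4) ^ K)"
        unfolding l by (simp add: mult_ac)
      have "real k * (6 * (1/16) ^ (K - l)) * weight l \<le> real k * (6 * (1/16) ^ (K - l)) * (1/4) ^ l"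
        using w by (intro mult_left_mono) auto
      also have "\<dots> \<le> 6 * (1/4) ^ (K - l) * 1"
        unfolding eq using k_quarter_le by (intro mult_left_mono) auto
      finally show "real k * (6 * (1/16) ^ (K - l)) * weight l \<le> 6 * (1/4) ^ (K - l)" by simp
    qed
    also have "\<dots> = 6 * (\<Sum>l\<le>K. (1/4) ^ (K - l))" by (simp add: sum_distrib_left)
    also have "\<dots> \<le> 6 * (1 / (1 - 1/4))"
      by (intro mult_left_mono sum_power_reversed_le) auto
    finally show ?thesis by simp
  qed
  \<comment> \<open>The same failure probability \<open>k powr (- \<beta>)\<close> is demanded at
    every level. The weights sum to at most \<open>2 / (1 + K)\<close>, which absorbs
    \<open>ln k \<le> 2 * K\<close>.\<close>
  have s: "(\<Sum>l\<le>K. \<beta> * ln (real k) * weight l) \<le> 4 * \<beta>"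
  proof -
    have "(\<Sum>l\<le>K. weight l) \<le> 2 / (1 + real K)"
      using weighted_level_sum[of 0 K] by (simp add: weight_def atLeast0AtMost)
    moreover have "0 \<le> \<beta> * ln (real k)" using \<beta> k_ge by simp
    ultimately have "\<beta> * ln (real k) * (\<Sum>l\<le>K. weight l) \<le> \<beta> * ln (real k) * (2 / (1 + real K))"
      by (intro mult_left_mono) auto
    also have "\<dots> \<le> \<beta> * (2 * real K) * (2 / (1 + real K))"
      using ln_k_le \<beta> by (intro mult_right_mono mult_left_mono) auto
    also have "\<dots> = 4 * \<beta> * (real K / (1 + real K))" by simp
    also have "\<dots> \<le> 4 * \<beta> * 1" using \<beta> by (intro mult_left_mono) (auto simp: divide_le_eq)
    finally show ?thesis by (simp add: sum_distrib_left)
  qed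
  have "(\<Sum>l\<le>K. (?z l + ?a l + real k * (6 * (1/16) ^ (K - l)) + \<beta> * ln (real k))
      * (4 * sqrt D * (1/4) ^ l / (1 + real (K - l))))
     = 4 * sqrt D * ((\<Sum>l\<le>K. ?z l * weight l) + (\<Sum>l\<le>K. ?a l * weight l)
        + (\<Sum>l\<le>K. real k * (6 * (1/16) ^ (K - l)) * weight l) + (\<Sum>l\<le>K. \<beta> * ln (real k) * weight l))"
    unfolding sum.distrib[symmetric] sum_distrib_left[of "4 * sqrt D"]
  proof (rule sum.cong[OF refl])
    fix l
    have "(a + b + c + d) * (4 * s * p / L) = 4 * s * (a * (p / L) + b * (p / L) + c * (p / L) + d * (p / L))"
      for a b c d s p L :: real by (simp add: add_divide_distrib algebra_simps)
    then show "(?z l + ?a l + real k * (6 * (1/16) ^ (K - l)) + \<beta> * ln (real k))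
      * (4 * sqrt D * (1/4) ^ l / (1 + real (K - l)))
      = 4 * sqrt D * (?z l * weight l + ?a l * weight l
        + real k * (6 * (1/16) ^ (K - l)) * weight l + \<beta> * ln (real k) * weight l)"
      unfolding weight_def .
  qed
  also have "\<dots> \<le> 4 * sqrt D * (40 + 60 + 8 + 4 * \<beta>)"
    using z a f s D_ge_1 by (intro mult_left_mono add_mono) auto
  also have "\<dots> = sqrt D * (432 + 16 * \<beta>)" by (simp add: algebra_simps)
  finally show ?thesis .
qed

text \<open>With \<open>d = K - l\<close>, the estimates \<open>1 + d \<le> 2 ^ d\<close> and
  \<open>exp (1/2) \<le> 7/4\<close> leave the ratio \<open>2 * (7/4) / 4 = 7/8\<close>; the total
  is \<open>100 * (7/4) * 8\<close>.\<close>

lemma total_variance: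
  "(\<Sum>l\<le>K. 100 * sqrt D * ((1 + real (K - l)) * exp ((1 + real (K - l)) / 2) * (1/4) ^ (K - l)))
    \<le> 1400 * sqrt D"
proof -
  have e: "exp (1/2) \<le> (7/4 :: real)"
  proof (rule power2_le_imp_le)
    have "(exp (1/2 :: real))\<^sup>2 = exp 1" by (simp add: power2_eq_square flip: exp_add)
    also have "\<dots> \<le> 3" by (rule exp_le)
    also have "\<dots> \<le> (7/4 :: real)\<^sup>2" by (simp add: power2_eq_square)
    finally show "(exp (1/2 :: real))\<^sup>2 \<le> (7/4)\<^sup>2" .
  qed simp
  have trm: "(1 + real d) * exp ((1 + real d) / 2) * (1/4) ^ d \<le> 7/4 * (7/8) ^ d" for d
  proof -
    have "Suc d \<le> 2 ^ d" using less_exp[of d] by linarith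
    then have "real (Suc d) \<le> real (2 ^ d)" by (rule of_nat_mono)
    then have 1: "1 + real d \<le> 2 ^ d" by simp
    have "exp ((1 + real d) / 2) = exp (1/2) ^ Suc d"
      by (simp only: exp_of_nat_mult[symmetric]) (simp add: add_divide_distrib)
    also have "\<dots> \<le> (7/4) ^ Suc d" using e by (intro power_mono) auto
    finally have "(1 + real d) * exp ((1 + real d) / 2) * (1/4) ^ d \<le> 2 ^ d * (7/4) ^ Suc d * (1/4) ^ d"
      using 1 by (intro mult_mono) auto
    also have "\<dots> = 7/4 * ((2 * (7/4) * (1/4)) ^ d)" by (simp only: power_mult_distrib power_Suc mult_ac)
    also have "\<dots> = 7/4 * (7/8) ^ d" by simp
    finally show ?thesis .
  qed
  have "(\<Sum>l\<le>K. 100 * sqrt D * ((1 + real (K - l)) * exp ((1 + real (K - l)) / 2) * (1/4) ^ (K - l)))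
      \<le> (\<Sum>l\<le>K. 100 * sqrt D * (7/4 * (7/8) ^ (K - l)))"
    using D_ge_1 by (intro sum_mono mult_left_mono trm) auto
  also have "\<dots> = 175 * sqrt D * (\<Sum>l\<le>K. (7/8) ^ (K - l))"
    by (simp add: sum_distrib_left mult.assoc)
  also have "\<dots> \<le> 175 * sqrt D * (1 / (1 - 7/8))"
    using D_ge_1 by (intro mult_left_mono sum_power_reversed_le) auto
  finally show ?thesis by simp
qed

text \<open>At \<open>cutoff K\<close> the crude \<open>K - b \<le> 4 ^ (K - b)\<close> suffices:
  multiplied by \<open>(1/4) ^ K\<close>, a price of order \<open>K - b\<close> becomes one of order
  \<open>(1/4) ^ b\<close>, which the budgets 5 cover.\<close>

lemma final_cost:
  assumes b: "\<And>u. u < k \<Longrightarrow> b u \<le> K" "(\<Sum>u<k. (1/4 :: real) ^ b u) \<le> 5"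
    and b': "\<And>j. j < r \<Longrightarrow> b' j \<le> K" "(\<Sum>j<r. (1/4 :: real) ^ b' j) \<le> 5"
    and m: "\<And>l. 0 \<le> m l" "(\<Sum>l\<le>K. (step l)\<^sup>2 * m l) \<le> 5" and \<beta>: "0 \<le> \<beta>"
  shows "((\<Sum>u<k. ln 16 * real (K - b u)) + (\<Sum>l\<le>K. atom_cost l * m l)
        + (\<Sum>j<r. ln 16 * real (K - b' j)) + 9 * real k + \<beta> * ln (real k)) * cutoff K
      \<le> sqrt D * (158 + 2 * \<beta>)"
proof -
  have vec: "(1/4) ^ K * (\<Sum>u<p. ln 16 * real (K - c u)) \<le> 20"
    if c: "\<And>u. u < p \<Longrightarrow> c u \<le> K" "(\<Sum>u<p. (1/4 :: real) ^ c u) \<le> 5" for p :: nat and c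
  proof -
    have "(1/4) ^ K * (\<Sum>u<p. ln 16 * real (K - c u)) \<le> (\<Sum>u<p. 4 * (1/4) ^ c u)"
      unfolding sum_distrib_left
    proof (rule sum_mono)
      fix u assume "u \<in> {..<p}"
      then have cu: "(1/4 :: real) ^ c u = (1/4) ^ K * 4 ^ (K - c u)"
        using c by (intro power_four_split) auto
      have "(1/4) ^ K * (ln 16 * real (K - c u)) \<le> (1/4) ^ K * (4 * 4 ^ (K - c u))"
        using ln_16_le le_four_power by (intro mult_left_mono mult_mono) auto
      then show "(1/4) ^ K * (ln 16 * real (K - c u)) \<le> 4 * (1/4) ^ c u" unfolding cu by simp
    qed
    also have "\<dots> = 4 * (\<Sum>u<p. (1/4) ^ c u)" by (simp add: sum_distrib_left)
    finally show ?thesis using c(2) by linarith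
  qed
  have a: "(1/4) ^ K * (\<Sum>l\<le>K. atom_cost l * m l) \<le> 30"
  proof -
    have "(1/4) ^ K * (\<Sum>l\<le>K. atom_cost l * m l) \<le> (\<Sum>l\<le>K. 6 * ((step l)\<^sup>2 * m l))"
      unfolding sum_distrib_left
    proof (rule sum_mono)
      fix l assume "l \<in> {..K}"
      then have l: "(1/4 :: real) ^ l = (1/4) ^ K * 4 ^ (K - l)" by (intro power_four_split) simp
      have "Suc d \<le> 4 ^ d" for d :: nat
        by (induction d) auto
      then have "real (Suc (K - l)) \<le> real (4 ^ (K - l))" by (rule of_nat_mono)
      then have "\<rho> * atom_cost l \<le> 6 * 4 ^ (K - l)" using atom_cost_le[of l] by simp
      then have "((1/4) ^ K / \<rho> * m l) * (\<rho> * atom_cost l) \<le> ((1/4) ^ K / \<rho> * m l) * (6 * 4 ^ (K - l))"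
        using m(1)[of l] \<rho>_pos by (intro mult_left_mono) auto
      then show "(1/4) ^ K * (atom_cost l * m l) \<le> 6 * ((step l)\<^sup>2 * m l)"
        unfolding step_square l using \<rho>_pos by (simp add: mult_ac)
    qed
    also have "\<dots> = 6 * (\<Sum>l\<le>K. (step l)\<^sup>2 * m l)" by (simp add: sum_distrib_left)
    finally show ?thesis using m(2) by linarith
  qed
  have s: "(1/4) ^ K * (\<beta> * ln (real k)) \<le> \<beta>"
  proof -
    have "ln (real k) \<le> real k" using ln_le_minus_one[of "real k"] k_ge by simp
    then have "\<beta> * ((1/4) ^ K * ln (real k)) \<le> \<beta> * (real k * (1/4) ^ K)"
      using \<beta> by (intro mult_left_mono) auto
    also have "\<dots> \<le> \<beta> * 1" using \<beta> k_quarter_le by (intro mult_left_mono)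
    finally show ?thesis by (simp add: mult_ac)
  qed
  have eq: "(A + B + C + E + F) * cutoff K
      = 2 * sqrt D * ((1/4) ^ K * A + (1/4) ^ K * B + (1/4) ^ K * C + (1/4) ^ K * E + (1/4) ^ K * F)"
    for A B C E F by (simp add: cutoff_def algebra_simps)
  have "(1/4) ^ K * (9 * real k) \<le> 9" using k_quarter_le by (simp add: mult.commute)
  then have "((\<Sum>u<k. ln 16 * real (K - b u)) + (\<Sum>l\<le>K. atom_cost l * m l)
        + (\<Sum>j<r. ln 16 * real (K - b' j)) + 9 * real k + \<beta> * ln (real k)) * cutoff K
      \<le> 2 * sqrt D * (20 + 30 + 20 + 9 + \<beta>)"
    unfolding eq using vec[OF b] vec[OF b'] a s D_ge_1 by (intro mult_left_mono add_mono) auto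
  also have "\<dots> = sqrt D * (158 + 2 * \<beta>)" by (simp add: algebra_simps)
  finally show ?thesis .
qed

end

section \<open>The bilinear form\<close>

context sparse_frame begin

text \<open>Here \<open>y\<close> stands for \<open>Y i v\<close> and \<open>g l\<close> for the
  residual before level \<open>l\<close>. A coordinate enters with all that has been approximated so
  far and later layers refine it, so only the last residual is missing.\<close>

lemma level_telescope:
  "(\<Sum>l\<le>L. if l < b then 0 else z * (if b = l then y - g (Suc l) else g l - g (Suc l)))
    = (if L < b then 0 else z * (y - g (Suc L :: nat)) :: real)"
  by (induction L) (auto simp: algebra_simps)

lemma layer_restrict: "l' \<le> l \<Longrightarrow> layer l' (restrict N ({..l} \<times> J)) = layer l' N"
  by (auto simp: layer_def fun_eq_iff intro!: sum.cong)

lemma partial_restrict: "partial l (restrict N ({..l} \<times> J)) = partial l N"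
  by (auto simp: partial_def fun_eq_iff layer_restrict intro!: sum.cong)

lemma net_cost_restrict:
  "net_cost l (restrict N ({..l} \<times> J)) = (\<Sum>l'\<le>l. atom_cost l' * (\<Sum>i\<in>J. \<bar>of_int (N (l', i))\<bar>))"
proof -
  have "net_cost l (restrict N ({..l} \<times> J)) = (\<Sum>(l', i)\<in>{..l} \<times> J. atom_cost l' * \<bar>of_int (N (l', i))\<bar>)"
    unfolding net_cost_def by (intro sum.cong) auto
  also have "\<dots> = (\<Sum>l'\<le>l. \<Sum>i\<in>J. atom_cost l' * \<bar>of_int (N (l', i))\<bar>)"
    by (simp add: sum.cartesian_product)
  finally show ?thesis by (simp add: sum_distrib_left)
qed

text \<open>The deterministic half: the assumed bounds on sums describe the good event. Each
  coefficient is a sum of level pieces and a final residual, and each piece is cut into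
  \<open>trunc\<close>, covered by the union bounds, and \<open>excess\<close>, covered by the
  degrees.\<close>

lemma coded_bound:
  assumes \<beta>: "0 \<le> \<beta>" and C1: "0 \<le> C1"
    and XH: "\<And>p. p \<in> {..<k} \<times> {..<n} \<Longrightarrow> \<bar>X \<omega> p\<bar> \<le> H \<omega> p"
    and col: "\<And>i. i \<in> J \<Longrightarrow> (\<Sum>u<k. H \<omega> (u, i)) \<le> C1 * D"
    and row: "\<And>u. u < k \<Longrightarrow> (\<Sum>i\<in>J. H \<omega> (u, i) * \<tau> i) \<le> C1 * D * \<rho>"
    and level: "\<And>l c N. l \<le> K \<Longrightarrow> c \<in> PiE {..<k} (\<lambda>_. codes l) \<Longrightarrow> N \<in> nets l \<Longrightarrow>
       (\<Sum>u<k. (dyadic (c u))\<^sup>2) \<le> 5 \<Longrightarrow> ip r (partial l N) (partial l N) \<le> 20 \<Longrightarrow>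
       ip r (layer l N) (layer l N) \<le> 20 \<Longrightarrow>
       (\<Sum>p\<in>{..<k} \<times> {..<n}. trunc (cutoff l) (coef l c N p) * X \<omega> p)
       \<le> ((\<Sum>u<k. code_cost K (c u)) + net_cost l N + real k * (6 * (1/16) ^ (K - l)) + \<beta> * ln (real k))
            * (4 * sqrt D * (1/4) ^ l / (1 + real (K - l)))
          + 100 * sqrt D * ((1 + real (K - l)) * exp ((1 + real (K - l)) / 2) * (1/4) ^ (K - l))"
    and remainder: "\<And>c N x. c \<in> PiE {..<k} (\<lambda>_. codes K) \<Longrightarrow> N \<in> nets K \<Longrightarrow>
       x \<in> PiE {..<r} (\<lambda>_. codes K) \<Longrightarrow> (\<Sum>u<k. (dyadic (c u))\<^sup>2) \<le> 5 \<Longrightarrow>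
       ip r (\<lambda>j. dyadic (x j) - partial K N j) (\<lambda>j. dyadic (x j) - partial K N j) \<le> 20 \<Longrightarrow>
       (\<Sum>p\<in>{..<k} \<times> {..<n}. trunc (cutoff K) (remainder_coef c (\<lambda>j. dyadic (x j) - partial K N j) p) * X \<omega> p)
       \<le> ((\<Sum>u<k. code_cost K (c u)) + net_cost K N + (\<Sum>j<r. code_cost K (x j)) + 9 * real k + \<beta> * ln (real k))
            * cutoff K + 600 * sqrt D"
    and b: "\<And>u. u < k \<Longrightarrow> b u \<le> K" "(\<Sum>u<k. (1/4 :: real) ^ b u) \<le> 5"
    and b': "\<And>j. j < r \<Longrightarrow> b' j \<le> K" "(\<Sum>j<r. (1/4 :: real) ^ b' j) \<le> 5"
    and z: "\<And>u. z u = dyadic (Some (b u, s u))"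
    and v: "\<And>j. j < r \<Longrightarrow> v j = dyadic (Some (b' j, s' j))"
  shows "(\<Sum>u<k. \<Sum>i\<in>J. z u * Y i v * X \<omega> (u, i)) \<le> (2590 + 18 * \<beta> + 60 * C1) * sqrt D"
proof -
  have b4: "((1/2 :: real) ^ b)\<^sup>2 = (1/4) ^ b" for b :: nat
    by (simp add: power2_eq_square flip: power_mult_distrib)
  have dsq: "(dyadic (Some (b, s)))\<^sup>2 = (1/4) ^ b" for b s
    by (simp add: dyadic_def power_mult_distrib b4)
  define xc where "xc = (\<lambda>j\<in>{..<r}. Some (b' j, s' j))"
  define v' where "v' = (\<lambda>j. dyadic (xc j))"
  have v'_eq: "j < r \<Longrightarrow> v' j = v j" for j by (simp add: v'_def xc_def v)
  have Yv: "Y i v = Y i v'" for i by (simp add: Y_def ip_def v'_eq)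
  have xc: "xc \<in> PiE {..<r} (\<lambda>_. codes K)" using b'(1) by (auto simp: xc_def codes_def)
  have "ip r v' v' = (\<Sum>j<r. (1/4) ^ b' j)"
    by (auto simp: ip_def v'_eq v dsq power2_eq_square[symmetric] intro!: sum.cong)
  with b'(2) have vsq: "ip r v' v' \<le> 5" by simp
  obtain w N where pw: "w 0 = v'" "\<And>l. layer l N = (\<lambda>j. w l j - w (Suc l) j)"
      "\<And>l. partial l N = (\<lambda>j. v' j - w (Suc l) j)"
    and pY: "\<And>i l. i \<in> J \<Longrightarrow> \<bar>Y i (w (Suc l))\<bar> \<le> sqrt (\<tau> i) * step l"
    and psq: "\<And>l. ip r (w l) (w l) \<le> 5"
    and pm: "(\<Sum>l\<le>K. (step l)\<^sup>2 * (\<Sum>i\<in>J. \<bar>of_int (N (l, i))\<bar>)) \<le> 5"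
    and pnets: "\<And>l. l \<le> K \<Longrightarrow> restrict N ({..l} \<times> J) \<in> nets l"
    by (rule pursuit_decomposition[OF vsq]) (rule that)
  define m where "m l = (\<Sum>i\<in>J. \<bar>of_int (N (l, i)) :: real\<bar>)" for l
  have m: "0 \<le> m l" "(\<Sum>l\<le>K. (step l)\<^sup>2 * m l) \<le> 5" for l
    using pm by (simp_all add: m_def sum_nonneg)
  \<comment> \<open>Coordinates finer than \<open>l\<close> stay \<open>None\<close> and cost
    nothing at level \<open>l\<close>; otherwise coarse levels, too, would pay an entropy of order
    \<open>k\<close>.\<close>
  define cl where "cl l = (\<lambda>u\<in>{..<k}. if b u \<le> l then Some (b u, s u) else None)" for l
  have cl: "cl l \<in> PiE {..<k} (\<lambda>_. codes l)" for l by (auto simp: cl_def codes_def)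
  have clsq: "(\<Sum>u<k. (dyadic (cl l u))\<^sup>2) \<le> 5" for l
  proof -
    have "(\<Sum>u<k. (dyadic (cl l u))\<^sup>2) \<le> (\<Sum>u<k. (1/4) ^ b u)"
      by (intro sum_mono) (simp add: cl_def dsq, simp add: dyadic_def)
    with b(2) show ?thesis by simp
  qed
  have cost_cl: "(\<Sum>u<k. code_cost K (cl l u)) = (\<Sum>u<k. if b u \<le> l then ln 16 * real (K - b u) else 0)" for l
    by (intro sum.cong) (auto simp: cl_def code_cost_def)
  have cost_K: "(\<Sum>u<k. code_cost K (cl K u)) = (\<Sum>u<k. ln 16 * real (K - b u))"
    unfolding cost_cl using b(1) by (intro sum.cong) auto
  have cost_x: "(\<Sum>j<r. code_cost K (xc j)) = (\<Sum>j<r. ln 16 * real (K - b' j))"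
    by (intro sum.cong) (auto simp: xc_def code_cost_def)
  let ?N = "\<lambda>l. restrict N ({..l} \<times> J)"
  \<comment> \<open>Both are differences of two vectors of squared norm at most 5, and
    \<open>2 * 5 + 2 * 5 = 20\<close>.\<close>
  have sqs: "ip r (partial l N) (partial l N) \<le> 20" "ip r (layer l N) (layer l N) \<le> 20" for l
    using ip_diff_self_le[of r v' "w (Suc l)"] ip_diff_self_le[of r "w l" "w (Suc l)"] psq[of l] psq[of "Suc l"] vsq
    unfolding pw by linarith+
  define f where "f l p = (case p of (u, i) \<Rightarrow> if i \<in> J then
      (if l < b u then 0 else z u * Y i (if b u = l then partial l N else layer l N)) else 0)" for l and p :: "nat \<times> nat"
  define g where "g p = (case p of (u, i) \<Rightarrow> if i \<in> J then z u * Y i (w (Suc K)) else 0)" for p :: "nat \<times> nat"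
  have f_J: "f l (u, i) = (if l < b u then 0 else z u * Y i (if b u = l then partial l N else layer l N))"
    and g_J: "g (u, i) = z u * Y i (w (Suc K))" if "i \<in> J" for l u i
    using that by (simp_all only: f_def g_def prod.case if_True)
  have coef_f: "coef l (cl l) (?N l) p = f l p" if "p \<in> {..<k} \<times> {..<n}" for l p
    using that by (auto simp: coef_def f_def cl_def z partial_restrict layer_restrict split: prod.splits)
  have rem_g: "remainder_coef (cl K) (\<lambda>j. dyadic (xc j) - partial K (?N K) j) p = g p" if pI: "p \<in> {..<k} \<times> {..<n}" for p
  proof -
    have rem: "(\<lambda>j. dyadic (xc j) - partial K (?N K) j) = w (Suc K)"
      unfolding partial_restrict pw(3) by (simp add: v'_def)
    obtain u i where p: "p = (u, i)" "u < k" using pI by (cases p) auto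
    have cu: "dyadic (cl K u) = z u" using p(2) b(1)[OF p(2)] by (simp add: cl_def z)
    have "remainder_coef (cl K) y (u, i) = (if i \<in> J then z u * Y i y else 0)" for y
      by (simp add: remainder_coef_def cu)
    from this[of "w (Suc K)"] show ?thesis unfolding rem p(1) by (simp add: g_def)
  qed
  have fl: "(\<Sum>p\<in>{..<k} \<times> {..<n}. trunc (cutoff l) (f l p) * X \<omega> p)
       \<le> ((\<Sum>u<k. if b u \<le> l then ln 16 * real (K - b u) else 0) + (\<Sum>l'\<le>l. atom_cost l' * m l')
          + real k * (6 * (1/16) ^ (K - l)) + \<beta> * ln (real k))
            * (4 * sqrt D * (1/4) ^ l / (1 + real (K - l)))
          + 100 * sqrt D * ((1 + real (K - l)) * exp ((1 + real (K - l)) / 2) * (1/4) ^ (K - l))" if "l \<le> K" for l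
  proof -
    have "(\<Sum>p\<in>{..<k} \<times> {..<n}. trunc (cutoff l) (f l p) * X \<omega> p)
        = (\<Sum>p\<in>{..<k} \<times> {..<n}. trunc (cutoff l) (coef l (cl l) (?N l) p) * X \<omega> p)"
      by (intro sum.cong refl) (simp add: coef_f)
    also have "\<dots> \<le> ((\<Sum>u<k. code_cost K (cl l u)) + net_cost l (?N l) + real k * (6 * (1/16) ^ (K - l)) + \<beta> * ln (real k))
            * (4 * sqrt D * (1/4) ^ l / (1 + real (K - l)))
          + 100 * sqrt D * ((1 + real (K - l)) * exp ((1 + real (K - l)) / 2) * (1/4) ^ (K - l))"
      by (rule level[OF that cl pnets[OF that] clsq])
        (simp_all only: partial_restrict layer_restrict[OF order_refl] sqs)
    finally show ?thesis unfolding cost_cl net_cost_restrict m_def .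
  qed
  have gl: "(\<Sum>p\<in>{..<k} \<times> {..<n}. trunc (cutoff K) (g p) * X \<omega> p)
      \<le> ((\<Sum>u<k. ln 16 * real (K - b u)) + (\<Sum>l\<le>K. atom_cost l * m l)
        + (\<Sum>j<r. ln 16 * real (K - b' j)) + 9 * real k + \<beta> * ln (real k)) * cutoff K + 600 * sqrt D"
  proof -
    have "(\<Sum>p\<in>{..<k} \<times> {..<n}. trunc (cutoff K) (g p) * X \<omega> p)
        = (\<Sum>p\<in>{..<k} \<times> {..<n}. trunc (cutoff K) (remainder_coef (cl K) (\<lambda>j. dyadic (xc j) - partial K (?N K) j) p) * X \<omega> p)"
      by (intro sum.cong refl) (simp add: rem_g)
    also have "\<dots> \<le> ((\<Sum>u<k. code_cost K (cl K u)) + net_cost K (?N K) + (\<Sum>j<r. code_cost K (xc j)) + 9 * real k + \<beta> * ln (real k))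
            * cutoff K + 600 * sqrt D"
    proof (rule remainder[OF cl pnets[OF order_refl] xc clsq])
      have "(\<lambda>j. dyadic (xc j) - partial K (?N K) j) = w (Suc K)"
        unfolding partial_restrict pw(3) by (simp add: v'_def)
      then show "ip r (\<lambda>j. dyadic (xc j) - partial K (?N K) j) (\<lambda>j. dyadic (xc j) - partial K (?N K) j) \<le> 20"
        using psq[of "Suc K"] by simp
    qed
    finally show ?thesis unfolding cost_K cost_x net_cost_restrict m_def .
  qed
  \<comment> \<open>The constant 2590 is 432 + 1400 from the levels and 158 + 600 from the last
    residual; 18 is 16 + 2.\<close>
  have small: "(\<Sum>l\<le>K. \<Sum>p\<in>{..<k} \<times> {..<n}. trunc (cutoff l) (f l p) * X \<omega> p)
      + (\<Sum>p\<in>{..<k} \<times> {..<n}. trunc (cutoff K) (g p) * X \<omega> p) \<le> (2590 + 18 * \<beta>) * sqrt D"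
  proof -
    have "(\<Sum>l\<le>K. \<Sum>p\<in>{..<k} \<times> {..<n}. trunc (cutoff l) (f l p) * X \<omega> p)
       \<le> (\<Sum>l\<le>K. ((\<Sum>u<k. if b u \<le> l then ln 16 * real (K - b u) else 0) + (\<Sum>l'\<le>l. atom_cost l' * m l')
          + real k * (6 * (1/16) ^ (K - l)) + \<beta> * ln (real k))
            * (4 * sqrt D * (1/4) ^ l / (1 + real (K - l)))
          + 100 * sqrt D * ((1 + real (K - l)) * exp ((1 + real (K - l)) / 2) * (1/4) ^ (K - l)))"
      by (intro sum_mono fl) simp
    also have "\<dots> \<le> sqrt D * (432 + 16 * \<beta>) + 1400 * sqrt D"
      unfolding sum.distrib by (intro add_mono total_cost total_variance b m \<beta>)
    finally have 1: "(\<Sum>l\<le>K. \<Sum>p\<in>{..<k} \<times> {..<n}. trunc (cutoff l) (f l p) * X \<omega> p)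
        \<le> sqrt D * (432 + 16 * \<beta>) + 1400 * sqrt D" .
    have 2: "(\<Sum>p\<in>{..<k} \<times> {..<n}. trunc (cutoff K) (g p) * X \<omega> p) \<le> sqrt D * (158 + 2 * \<beta>) + 600 * sqrt D"
      using gl final_cost[OF b b' m \<beta>] by linarith
    have "sqrt D * (432 + 16 * \<beta>) + 1400 * sqrt D + (sqrt D * (158 + 2 * \<beta>) + 600 * sqrt D) = (2590 + 18 * \<beta>) * sqrt D"
      by (simp add: algebra_simps)
    with 1 2 show ?thesis by linarith
  qed
  have big: "(\<Sum>u<k. \<Sum>i\<in>J. ((\<Sum>l\<le>K. excess (cutoff l) (f l (u, i))) + excess (cutoff K) (g (u, i))) * \<bar>X \<omega> (u, i)\<bar>)
      \<le> 60 * C1 * sqrt D"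
  proof -
    have "(\<Sum>u<k. \<Sum>i\<in>J. ((\<Sum>l\<le>K. excess (cutoff l) (f l (u, i))) + excess (cutoff K) (g (u, i))) * \<bar>X \<omega> (u, i)\<bar>)
      \<le> (\<Sum>u<k. \<Sum>i\<in>J. (2 * (Y i v')\<^sup>2 / sqrt D + 10 * ((1/4) ^ b u * \<tau> i) / (\<rho> * sqrt D)) * \<bar>X \<omega> (u, i)\<bar>)"
    proof (intro sum_mono mult_right_mono)
      fix u i assume u: "u \<in> {..<k}" and i: "i \<in> J"
      have "\<bar>z u\<bar> = (1/2) ^ b u" by (simp add: z dyadic_def abs_mult)
      from entry_excess[OF i b(1) this pw(2) pw(3) pY[OF i]] u
      show "(\<Sum>l\<le>K. excess (cutoff l) (f l (u, i))) + excess (cutoff K) (g (u, i))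
        \<le> 2 * (Y i v')\<^sup>2 / sqrt D + 10 * ((1/4) ^ b u * \<tau> i) / (\<rho> * sqrt D)"
        by (simp only: f_J[OF i] g_J[OF i] lessThan_iff)
    qed simp
    also have "\<dots> \<le> 60 * C1 * sqrt D"
      by (rule excess_total[OF XH col row C1 b(2) vsq])
    finally show ?thesis .
  qed
  have entry: "z u * Y i v * X \<omega> (u, i) \<le> (\<Sum>l\<le>K. trunc (cutoff l) (f l (u, i)) * X \<omega> (u, i))
      + trunc (cutoff K) (g (u, i)) * X \<omega> (u, i)
      + ((\<Sum>l\<le>K. excess (cutoff l) (f l (u, i))) + excess (cutoff K) (g (u, i))) * \<bar>X \<omega> (u, i)\<bar>"
    if u: "u < k" and i: "i \<in> J" for u i
  proof -
    have "(\<Sum>l\<le>K. f l (u, i)) = (\<Sum>l\<le>K. if l < b u then 0 else z u * (if b u = l then Y i v' - Y i (w (Suc l)) else Y i (w l) - Y i (w (Suc l))))"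
      by (intro sum.cong refl) (simp only: f_J[OF i] pw Y_diff split: if_split, simp)
    also have "\<dots> = z u * (Y i v' - Y i (w (Suc K)))"
      using level_telescope[where b = "b u" and z = "z u" and y = "Y i v'" and g = "\<lambda>l. Y i (w l)" and L = K]
        b(1)[OF u] by (simp only: not_less[symmetric] if_False)
    finally have "z u * Y i v = (\<Sum>l\<le>K. f l (u, i)) + g (u, i)"
      by (simp add: g_J[OF i] Yv right_diff_distrib)
    then have "z u * Y i v * X \<omega> (u, i) = (\<Sum>l\<le>K. f l (u, i) * X \<omega> (u, i)) + g (u, i) * X \<omega> (u, i)"
      by (simp add: sum_distrib_right distrib_right)
    also have "\<dots> \<le> (\<Sum>l\<le>K. trunc (cutoff l) (f l (u, i)) * X \<omega> (u, i) + excess (cutoff l) (f l (u, i)) * \<bar>X \<omega> (u, i)\<bar>)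
        + (trunc (cutoff K) (g (u, i)) * X \<omega> (u, i) + excess (cutoff K) (g (u, i)) * \<bar>X \<omega> (u, i)\<bar>)"
      by (intro add_mono sum_mono abs_le_trunc_excess)
    finally show ?thesis by (simp add: sum.distrib sum_distrib_right distrib_right)
  qed
  have "(\<Sum>u<k. \<Sum>i\<in>J. z u * Y i v * X \<omega> (u, i))
      \<le> (\<Sum>u<k. \<Sum>i\<in>J. (\<Sum>l\<le>K. trunc (cutoff l) (f l (u, i)) * X \<omega> (u, i))
      + trunc (cutoff K) (g (u, i)) * X \<omega> (u, i)
      + ((\<Sum>l\<le>K. excess (cutoff l) (f l (u, i))) + excess (cutoff K) (g (u, i))) * \<bar>X \<omega> (u, i)\<bar>)"
    by (intro sum_mono entry) auto
  also have "\<dots> = (\<Sum>u<k. \<Sum>i\<in>J. \<Sum>l\<le>K. trunc (cutoff l) (f l (u, i)) * X \<omega> (u, i))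
      + (\<Sum>u<k. \<Sum>i\<in>J. trunc (cutoff K) (g (u, i)) * X \<omega> (u, i))
      + (\<Sum>u<k. \<Sum>i\<in>J. ((\<Sum>l\<le>K. excess (cutoff l) (f l (u, i))) + excess (cutoff K) (g (u, i))) * \<bar>X \<omega> (u, i)\<bar>)"
    by (simp only: sum.distrib)
  also have "(\<Sum>u<k. \<Sum>i\<in>J. trunc (cutoff K) (g (u, i)) * X \<omega> (u, i))
      = (\<Sum>p\<in>{..<k} \<times> {..<n}. trunc (cutoff K) (g p) * X \<omega> p)"
    by (rule sum_entries_J[symmetric]) (simp add: g_def trunc_def)
  also have "(\<Sum>u<k. \<Sum>i\<in>J. \<Sum>l\<le>K. trunc (cutoff l) (f l (u, i)) * X \<omega> (u, i))
      = (\<Sum>p\<in>{..<k} \<times> {..<n}. \<Sum>l\<le>K. trunc (cutoff l) (f l p) * X \<omega> p)"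
    by (rule sum_entries_J[symmetric]) (simp add: f_def trunc_def)
  also have "\<dots> = (\<Sum>l\<le>K. \<Sum>p\<in>{..<k} \<times> {..<n}. trunc (cutoff l) (f l p) * X \<omega> p)"
    by (rule sum.swap)
  finally have "(\<Sum>u<k. \<Sum>i\<in>J. z u * Y i v * X \<omega> (u, i)) \<le> (2590 + 18 * \<beta>) * sqrt D + 60 * C1 * sqrt D"
    using small big by linarith
  then show ?thesis by (simp add: algebra_simps)
qed


section \<open>Degree events and the passage to arbitrary unit vectors\<close>

lemma K_le: "K \<le> k"
proof (cases K)
  case (Suc K')
  have "Suc K' \<le> 4 ^ K'" by (induction K') auto
  with Suc K_upper show ?thesis by simp
qed simp

text \<open>The threshold \<open>(\<beta> + 2) * D\<close> absorbs the \<open>2 * D\<close> of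
  \<open>degree_union\<close>, and \<open>D \<ge> ln k\<close> turns the remaining
  \<open>exp (- \<beta> * D)\<close> into a power of \<open>k\<close>. The union over the columns
  costs the factor \<open>n\<close>.\<close>

lemma column_event:
  assumes \<beta>: "0 \<le> \<beta>"
  obtains Bad where "Bad \<in> sets M" "prob Bad \<le> real n * exp (- (\<beta> * ln (real k)))"
    "\<And>\<omega> i. \<omega> \<in> space M - Bad \<Longrightarrow> i \<in> J \<Longrightarrow> (\<Sum>u<k. H \<omega> (u, i)) \<le> (\<beta> + 2) * D"
proof -
  define A where "A i = (\<lambda>(u :: nat, i'). if i' = i then 1 else (0::real))" for i :: nat
  have sum_A: "(\<Sum>p\<in>{..<k} \<times> {..<n}. A i p * g p) = (\<Sum>u<k. g (u, i))" if "i \<in> J" for i g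
  proof -
    have "(\<Sum>p\<in>{..<k} \<times> {..<n}. A i p * g p) = (\<Sum>u<k. \<Sum>i'<n. A i (u, i') * g (u, i'))"
      by (simp add: sum.cartesian_product)
    also have "\<dots> = (\<Sum>u<k. \<Sum>i'<n. if i' = i then g (u, i) else 0)"
      by (intro sum.cong) (auto simp: A_def)
    also have "\<dots> = (\<Sum>u<k. g (u, i))" using that J_subset by (intro sum.cong) auto
    finally show ?thesis .
  qed
  show ?thesis
  proof (rule degree_union[of J A D "(\<beta> + 2) * D"])
    fix Bad assume Bad: "Bad \<in> sets M" "prob Bad \<le> real (card J) * exp (2 * D - (\<beta> + 2) * D)"
      and le: "\<And>\<omega> f. \<omega> \<in> space M - Bad \<Longrightarrow> f \<in> J \<Longrightarrow> (\<Sum>e\<in>{..<k} \<times> {..<n}. A f e * H \<omega> e) \<le> (\<beta> + 2) * D"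
    show thesis
    proof (rule that[OF Bad(1)])
      have "card J \<le> n" using card_mono[OF _ J_subset] by simp
      moreover have "\<beta> * ln (real k) \<le> \<beta> * D" using D_ge \<beta> by (intro mult_left_mono) (auto simp: D_def)
      ultimately have "real (card J) * exp (2 * D - (\<beta> + 2) * D) \<le> real n * exp (- (\<beta> * ln (real k)))"
        by (intro mult_mono) (auto simp: algebra_simps)
      with Bad(2) show "prob Bad \<le> real n * exp (- (\<beta> * ln (real k)))" by linarith
    next
      fix \<omega> i assume "\<omega> \<in> space M - Bad" "i \<in> J"
      with le[OF this] sum_A[of i "H \<omega>"] show "(\<Sum>u<k. H \<omega> (u, i)) \<le> (\<beta> + 2) * D" by simp
    qed
  next
    fix i assume "i \<in> J"
    with sum_A[of i "\<lambda>_. 1"] show "q * (\<Sum>e\<in>{..<k} \<times> {..<n}. A i e) \<le> D" by (simp add: D_def)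
  qed (use finite_J in \<open>auto simp: A_def\<close>)
qed

text \<open>Dividing by \<open>\<rho>\<close> makes the weights at most 1, and the mean is still at
  most \<open>D\<close> because \<open>\<tau>_sum\<close> bounds the normalised weights of a row by
  \<open>k\<close> in total.\<close>

lemma row_event:
  assumes \<beta>: "0 \<le> \<beta>"
  obtains Bad where "Bad \<in> sets M" "prob Bad \<le> real k * exp (- (\<beta> * ln (real k)))"
    "\<And>\<omega> u. \<omega> \<in> space M - Bad \<Longrightarrow> u < k \<Longrightarrow> (\<Sum>i\<in>J. H \<omega> (u, i) * \<tau> i) \<le> (\<beta> + 2) * D * \<rho>"
proof -
  define A where "A u = (\<lambda>(u', i). if u' = u \<and> i \<in> J then \<tau> i / \<rho> else 0)" for u :: nat
  have sum_A: "(\<Sum>p\<in>{..<k} \<times> {..<n}. A u p * g p) = (\<Sum>i\<in>J. g (u, i) * \<tau> i) / \<rho>" if "u < k" for u g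
  proof -
    have "(\<Sum>p\<in>{..<k} \<times> {..<n}. A u p * g p) = (\<Sum>u'<k. \<Sum>i\<in>J. A u (u', i) * g (u', i))"
      by (rule sum_entries_J) (simp add: A_def)
    also have "\<dots> = (\<Sum>u'<k. if u' = u then (\<Sum>i\<in>J. \<tau> i / \<rho> * g (u, i)) else 0)"
      by (intro sum.cong) (auto simp: A_def)
    also have "\<dots> = (\<Sum>i\<in>J. \<tau> i / \<rho> * g (u, i))" using that by simp
    also have "\<dots> = (\<Sum>i\<in>J. g (u, i) * \<tau> i) / \<rho>" by (simp add: sum_divide_distrib mult.commute)
    finally show ?thesis .
  qed
  show ?thesis
  proof (rule degree_union[of "{..<k}" A D "(\<beta> + 2) * D"])
    fix Bad assume Bad: "Bad \<in> sets M" "prob Bad \<le> real (card {..<k}) * exp (2 * D - (\<beta> + 2) * D)"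
      and le: "\<And>\<omega> f. \<omega> \<in> space M - Bad \<Longrightarrow> f \<in> {..<k} \<Longrightarrow> (\<Sum>e\<in>{..<k} \<times> {..<n}. A f e * H \<omega> e) \<le> (\<beta> + 2) * D"
    show thesis
    proof (rule that[OF Bad(1)])
      have "\<beta> * ln (real k) \<le> \<beta> * D" using D_ge \<beta> by (intro mult_left_mono) (auto simp: D_def)
      then have "real k * exp (2 * D - (\<beta> + 2) * D) \<le> real k * exp (- (\<beta> * ln (real k)))"
        by (intro mult_left_mono) (auto simp: algebra_simps)
      with Bad(2) show "prob Bad \<le> real k * exp (- (\<beta> * ln (real k)))" by simp
    next
      fix \<omega> u assume "\<omega> \<in> space M - Bad" "u < k"
      with le[of \<omega> u] sum_A[of u "H \<omega>"] \<rho>_pos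
      show "(\<Sum>i\<in>J. H \<omega> (u, i) * \<tau> i) \<le> (\<beta> + 2) * D * \<rho>" by (simp add: pos_divide_le_eq)
    qed
  next
    fix u assume "u \<in> {..<k}"
    then have "(\<Sum>e\<in>{..<k} \<times> {..<n}. A u e) = (\<Sum>i\<in>J. \<tau> i) / \<rho>" using sum_A[of u "\<lambda>_. 1"] by simp
    also have "\<dots> \<le> real k" using \<tau>_sum \<rho>_pos by (simp add: pos_divide_le_eq)
    finally have "q * (\<Sum>e\<in>{..<k} \<times> {..<n}. A u e) \<le> q * real k" by (rule mult_left_mono[OF _ q_nonneg])
    then show "q * (\<Sum>e\<in>{..<k} \<times> {..<n}. A u e) \<le> D" by (simp add: D_def mult.commute)
  qed (use \<tau>_nonneg \<tau>_le \<rho>_pos in \<open>auto simp: A_def\<close>)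
qed

text \<open>In units of \<open>exp (- \<beta> * ln k)\<close>, failure costs \<open>n\<close> for
  the columns, \<open>k\<close> for the rows, 1 for the residual and
  \<open>K + 1 \<le> k + 1\<close> for the levels. The constant is
  \<open>2590 + 18 * \<beta>\<close> plus \<open>60 * (\<beta> + 2)\<close>.\<close>

lemma bilinear_bound:
  assumes \<beta>: "0 \<le> \<beta>"
  obtains Bad where "Bad \<in> sets M" "prob Bad \<le> (real n + 2 * real k + 2) * exp (- (\<beta> * ln (real k)))"
    "\<And>\<omega> z v. \<omega> \<in> space M - Bad \<Longrightarrow> \<forall>p\<in>{..<k} \<times> {..<n}. \<bar>X \<omega> p\<bar> \<le> H \<omega> p \<Longrightarrow>
       (\<Sum>u<k. (z u)\<^sup>2) \<le> (1 :: real) \<Longrightarrow> (\<Sum>j<r. (v j)\<^sup>2) \<le> (1 :: real) \<Longrightarrow>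
       (\<Sum>u<k. \<Sum>i\<in>J. z u * Y i v * X \<omega> (u, i)) \<le> (2710 + 78 * \<beta>) * sqrt D"
proof -
  let ?S = "\<beta> * ln (real k)"
  obtain B1 where B1: "B1 \<in> sets M" "prob B1 \<le> real n * exp (- ?S)"
    and col: "\<And>\<omega> i. \<omega> \<in> space M - B1 \<Longrightarrow> i \<in> J \<Longrightarrow> (\<Sum>u<k. H \<omega> (u, i)) \<le> (\<beta> + 2) * D"
    by (rule column_event[OF \<beta>]) (rule that)
  obtain B2 where B2: "B2 \<in> sets M" "prob B2 \<le> real k * exp (- ?S)"
    and row: "\<And>\<omega> u. \<omega> \<in> space M - B2 \<Longrightarrow> u < k \<Longrightarrow> (\<Sum>i\<in>J. H \<omega> (u, i) * \<tau> i) \<le> (\<beta> + 2) * D * \<rho>"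
    by (rule row_event[OF \<beta>]) (rule that)
  obtain B3 where B3: "B3 \<in> sets M" "prob B3 \<le> exp (- ?S)"
    and rem: "\<And>\<omega> c N x. \<omega> \<in> space M - B3 \<Longrightarrow> c \<in> PiE {..<k} (\<lambda>_. codes K) \<Longrightarrow> N \<in> nets K \<Longrightarrow>
       x \<in> PiE {..<r} (\<lambda>_. codes K) \<Longrightarrow> (\<Sum>u<k. (dyadic (c u))\<^sup>2) \<le> 5 \<Longrightarrow>
       ip r (\<lambda>j. dyadic (x j) - partial K N j) (\<lambda>j. dyadic (x j) - partial K N j) \<le> 20 \<Longrightarrow>
       (\<Sum>p\<in>{..<k} \<times> {..<n}. trunc (cutoff K) (remainder_coef c (\<lambda>j. dyadic (x j) - partial K N j) p) * X \<omega> p)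
       \<le> ((\<Sum>u<k. code_cost K (c u)) + net_cost K N + (\<Sum>j<r. code_cost K (x j)) + 9 * real k + ?S)
            * cutoff K + 600 * sqrt D"
    by (rule remainder_event[of ?S]) (rule that)
  define good where "good l \<omega> \<longleftrightarrow> (\<forall>c N. c \<in> PiE {..<k} (\<lambda>_. codes l) \<longrightarrow> N \<in> nets l \<longrightarrow>
       (\<Sum>u<k. (dyadic (c u))\<^sup>2) \<le> 5 \<longrightarrow> ip r (partial l N) (partial l N) \<le> 20 \<longrightarrow>
       ip r (layer l N) (layer l N) \<le> 20 \<longrightarrow>
       (\<Sum>p\<in>{..<k} \<times> {..<n}. trunc (cutoff l) (coef l c N p) * X \<omega> p)
       \<le> ((\<Sum>u<k. code_cost K (c u)) + net_cost l N + real k * (6 * (1/16) ^ (K - l)) + ?S)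
            * (4 * sqrt D * (1/4) ^ l / (1 + real (K - l)))
          + 100 * sqrt D * ((1 + real (K - l)) * exp ((1 + real (K - l)) / 2) * (1/4) ^ (K - l)))" for l \<omega>
  have "\<exists>B. B \<in> sets M \<and> prob B \<le> exp (- ?S) \<and> (\<forall>\<omega>\<in>space M - B. good l \<omega>)" if "l \<le> K" for l
    by (rule level_event[OF that, of ?S]) (intro exI conjI ballI, assumption+, unfold good_def, blast)
  then obtain B4 where B4: "\<And>l. l \<le> K \<Longrightarrow> B4 l \<in> sets M" "\<And>l. l \<le> K \<Longrightarrow> prob (B4 l) \<le> exp (- ?S)"
    and lev: "\<And>l \<omega>. l \<le> K \<Longrightarrow> \<omega> \<in> space M - B4 l \<Longrightarrow> good l \<omega>"
    by metis
  define Bad where "Bad = B1 \<union> (B2 \<union> (B3 \<union> (\<Union>l\<le>K. B4 l)))"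
  show ?thesis
  proof (rule that[of Bad])
    have U: "(\<Union>l\<le>K. B4 l) \<in> sets M" using B4(1) by auto
    then show "Bad \<in> sets M" using B1(1) B2(1) B3(1) by (auto simp: Bad_def)
    have "prob (\<Union>l\<le>K. B4 l) \<le> (\<Sum>l\<le>K. prob (B4 l))"
      using B4(1) by (intro finite_measure_subadditive_finite) auto
    also have "\<dots> \<le> (\<Sum>l\<le>K. exp (- ?S))" using B4(2) by (intro sum_mono) auto
    also have "\<dots> = (real K + 1) * exp (- ?S)" by simp
    finally have "prob (\<Union>l\<le>K. B4 l) \<le> (real k + 1) * exp (- ?S)"
      using K_le by (auto elim!: order_trans intro!: mult_right_mono)
    moreover have "prob Bad \<le> prob B1 + (prob B2 + (prob B3 + prob (\<Union>l\<le>K. B4 l)))"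
      unfolding Bad_def using B1(1) B2(1) B3(1) U
      by (intro order_trans[OF measure_Un_le] add_left_mono) auto
    ultimately have "prob Bad \<le> real n * exp (- ?S) + (real k * exp (- ?S) + (exp (- ?S) + (real k + 1) * exp (- ?S)))"
      using B1(2) B2(2) B3(2) by linarith
    then show "prob Bad \<le> (real n + 2 * real k + 2) * exp (- ?S)" by (simp add: algebra_simps)
  next
    fix \<omega> and z v :: "nat \<Rightarrow> real"
    assume \<omega>: "\<omega> \<in> space M - Bad" and "\<forall>p\<in>{..<k} \<times> {..<n}. \<bar>X \<omega> p\<bar> \<le> H \<omega> p"
      and z: "(\<Sum>u<k. (z u)\<^sup>2) \<le> 1" and v: "(\<Sum>j<r. (v j)\<^sup>2) \<le> 1"
    then have XH: "\<bar>X \<omega> p\<bar> \<le> H \<omega> p" if "p \<in> {..<k} \<times> {..<n}" for p using that by blast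
    have \<omega>': "\<omega> \<in> space M - B1" "\<omega> \<in> space M - B2" "\<omega> \<in> space M - B3" "\<And>l. l \<le> K \<Longrightarrow> \<omega> \<in> space M - B4 l"
      using \<omega> by (auto simp: Bad_def)
    obtain b where b: "\<And>u. u < k \<Longrightarrow> b u \<le> K" "\<And>u. u < k \<Longrightarrow> \<bar>z u\<bar> \<le> (1/2) ^ b u"
      "(\<Sum>u<k. (1/4 :: real) ^ b u) \<le> 5"
      by (rule dyadic_rounding[OF K_lower z]) (rule that)
    have "r \<le> 4 ^ K" using r_le K_lower by linarith
    then obtain b' where b': "\<And>j. j < r \<Longrightarrow> b' j \<le> K" "\<And>j. j < r \<Longrightarrow> \<bar>v j\<bar> \<le> (1/2) ^ b' j"
      "(\<Sum>j<r. (1/4 :: real) ^ b' j) \<le> 5"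
      using v by (rule dyadic_rounding) (rule that)
    \<comment> \<open>The form is linear in each vector, so enlarging a coordinate to a power of 2
      with the sign of its coefficient cannot decrease it. This is done for \<open>z\<close> first,
      then for \<open>v\<close> with \<open>z'\<close> fixed; hence dyadic vectors suffice and no
      rounding error arises.\<close>
    have round: "x * y \<le> dyadic (Some (c, 0 \<le> y)) * y" if "\<bar>x\<bar> \<le> (1/2) ^ c" for x y and c :: nat
    proof -
      have "x * y \<le> \<bar>x\<bar> * \<bar>y\<bar>" by (metis abs_ge_self abs_mult)
      also have "\<dots> \<le> (1/2) ^ c * \<bar>y\<bar>" using that by (rule mult_right_mono) simp
      finally show ?thesis by (simp add: dyadic_def abs_if split: if_splits)
    qed
    define g where "g u = (\<Sum>i\<in>J. Y i v * X \<omega> (u, i))" for u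
    define z' where "z' u = dyadic (Some (b u, 0 \<le> g u))" for u
    define h where "h j = (\<Sum>u<k. \<Sum>i\<in>J. z' u * (sqrt (\<tau> i) * e i j) * X \<omega> (u, i))" for j
    define v' where "v' j = dyadic (Some (b' j, 0 \<le> h j))" for j
    have lin: "(\<Sum>u<k. \<Sum>i\<in>J. z' u * Y i x * X \<omega> (u, i)) = (\<Sum>j<r. x j * h j)" for x
    proof -
      have "(\<Sum>j<r. x j * h j) = (\<Sum>j<r. \<Sum>u<k. \<Sum>i\<in>J. z' u * (sqrt (\<tau> i) * (e i j * x j)) * X \<omega> (u, i))"
        unfolding h_def sum_distrib_left by (intro sum.cong refl) (simp add: mult_ac)
      also have "\<dots> = (\<Sum>u<k. \<Sum>j<r. \<Sum>i\<in>J. z' u * (sqrt (\<tau> i) * (e i j * x j)) * X \<omega> (u, i))"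
        by (rule sum.swap)
      also have "\<dots> = (\<Sum>u<k. \<Sum>i\<in>J. \<Sum>j<r. z' u * (sqrt (\<tau> i) * (e i j * x j)) * X \<omega> (u, i))"
        by (intro sum.cong refl sum.swap)
      also have "\<dots> = (\<Sum>u<k. \<Sum>i\<in>J. z' u * Y i x * X \<omega> (u, i))"
        unfolding Y_def ip_def sum_distrib_left sum_distrib_right by simp
      finally show ?thesis ..
    qed
    have "(\<Sum>u<k. \<Sum>i\<in>J. z u * Y i v * X \<omega> (u, i)) = (\<Sum>u<k. z u * g u)"
      by (simp add: g_def sum_distrib_left mult.assoc)
    also have "\<dots> \<le> (\<Sum>u<k. z' u * g u)"
      unfolding z'_def using b(2) by (intro sum_mono round) auto
    also have "\<dots> = (\<Sum>u<k. \<Sum>i\<in>J. z' u * Y i v * X \<omega> (u, i))"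
      by (simp add: g_def sum_distrib_left mult.assoc)
    also have "\<dots> = (\<Sum>j<r. v j * h j)" by (rule lin)
    also have "\<dots> \<le> (\<Sum>j<r. v' j * h j)"
      unfolding v'_def using b'(2) by (intro sum_mono round) auto
    also have "\<dots> = (\<Sum>u<k. \<Sum>i\<in>J. z' u * Y i v' * X \<omega> (u, i))" by (rule lin[symmetric])
    also have "\<dots> \<le> (2590 + 18 * \<beta> + 60 * (\<beta> + 2)) * sqrt D"
    proof (rule coded_bound[OF \<beta> _ XH col[OF \<omega>'(1)] row[OF \<omega>'(2)] _ rem[OF \<omega>'(3)] b(1,3) b'(1,3) z'_def v'_def])
      show "0 \<le> \<beta> + 2" using \<beta> by simp
    next
      fix l c N
      assume l: "l \<le> K" and rest: "c \<in> PiE {..<k} (\<lambda>_. codes l)" "N \<in> nets l"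
       "(\<Sum>u<k. (dyadic (c u))\<^sup>2) \<le> 5" "ip r (partial l N) (partial l N) \<le> 20"
       "ip r (layer l N) (layer l N) \<le> 20"
      show "(\<Sum>p\<in>{..<k} \<times> {..<n}. trunc (cutoff l) (coef l c N p) * X \<omega> p)
       \<le> ((\<Sum>u<k. code_cost K (c u)) + net_cost l N + real k * (6 * (1/16) ^ (K - l)) + ?S)
            * (4 * sqrt D * (1/4) ^ l / (1 + real (K - l)))
          + 100 * sqrt D * ((1 + real (K - l)) * exp ((1 + real (K - l)) / 2) * (1/4) ^ (K - l))"
        by (rule lev[OF l \<omega>'(4)[OF l], unfolded good_def, rule_format, OF rest])
    qed
    also have "\<dots> = (2710 + 78 * \<beta>) * sqrt D" by (simp add: algebra_simps)
    finally show "(\<Sum>u<k. \<Sum>i\<in>J. z u * Y i v * X \<omega> (u, i)) \<le> (2710 + 78 * \<beta>) * sqrt D" .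
  qed
qed

end

section \<open>The three sparsity patterns\<close>

text \<open>Both exponential moments have this shape: given the pattern, a centered entry
  contributes at most \<open>1 + \<eta> * (exp |a| - 1 - |a|)\<close>, and
  \<open>exp (a * \<eta>) = 1 + \<eta> * (exp a - 1)\<close>. For independent indicators the bound
  is \<open>1 + x \<le> exp x\<close>.\<close>

definition pattern_dominated :: "nat \<Rightarrow> nat \<Rightarrow> real \<Rightarrow> (nat \<times> nat \<Rightarrow> bool) pmf \<Rightarrow> bool" where
  "pattern_dominated k n q P \<longleftrightarrow> (\<forall>f. (\<forall>e. 0 \<le> f e) \<longrightarrow>
     (\<integral>\<^sup>+\<eta>. (\<Prod>e\<in>{..<k} \<times> {..<n}. ennreal (1 + of_bool (\<eta> e) * f e)) \<partial>measure_pmf P)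
       \<le> ennreal (exp (q * (\<Sum>e\<in>{..<k} \<times> {..<n}. f e))))"

lemma prod_ennreal_exp: "finite A \<Longrightarrow> (\<Prod>x\<in>A. ennreal (exp (g x))) = ennreal (exp (\<Sum>x\<in>A. g x))"
  by (simp add: prod_ennreal exp_sum)

lemma prod_ennreal_mono:
  "(\<And>x. x \<in> A \<Longrightarrow> f x \<le> g x) \<Longrightarrow> (\<Prod>x\<in>A. f x) \<le> (\<Prod>x\<in>A. g x :: ennreal)"
  by (induction A rule: infinite_finite_induct) (auto intro: mult_mono)

lemma iid_pattern_dominated:
  assumes p: "0 \<le> p" "p \<le> 1"
  shows "pattern_dominated k n p (iid_pattern k n p)"
  unfolding pattern_dominated_def
proof (intro allI impI)
  fix f :: "nat \<times> nat \<Rightarrow> real" assume f: "\<forall>e. 0 \<le> f e"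
  let ?I = "{..<k} \<times> {..<n}"
  have "(\<integral>\<^sup>+\<eta>. (\<Prod>e\<in>?I. ennreal (1 + of_bool (\<eta> e) * f e)) \<partial>measure_pmf (iid_pattern k n p))
     = (\<Prod>e\<in>?I. \<integral>\<^sup>+b. ennreal (1 + of_bool b * f e) \<partial>measure_pmf (bernoulli_pmf p))"
    unfolding iid_pattern_def by (rule nn_integral_prod_Pi_pmf) simp
  also have "\<dots> \<le> (\<Prod>e\<in>?I. ennreal (exp (p * f e)))"
  proof (rule prod_ennreal_mono)
    fix e
    have fe: "0 \<le> f e" using f by blast
    have "(\<integral>\<^sup>+b. ennreal (1 + of_bool b * f e) \<partial>measure_pmf (bernoulli_pmf p))
        = ennreal (1 + f e) * ennreal p + ennreal (1 - p)"
      using p f by simp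
    also have "ennreal (1 + f e) * ennreal p = ennreal ((1 + f e) * p)"
      using p fe by (intro ennreal_mult[symmetric]) auto
    also have "\<dots> + ennreal (1 - p) = ennreal ((1 + f e) * p + (1 - p))"
      using p fe by (intro ennreal_plus[symmetric]) auto
    also have "(1 + f e) * p + (1 - p) = 1 + p * f e" by (simp add: algebra_simps)
    also have "\<dots> \<le> ennreal (exp (p * f e))"
      by (intro ennreal_leI exp_ge_add_one_self)
    finally show "(\<integral>\<^sup>+b. ennreal (1 + of_bool b * f e) \<partial>measure_pmf (bernoulli_pmf p)) \<le> ennreal (exp (p * f e))" .
  qed
  also have "\<dots> = ennreal (exp (p * (\<Sum>e\<in>?I. f e)))"
    by (simp add: prod_ennreal_exp sum_distrib_left)
  finally show "(\<integral>\<^sup>+\<eta>. (\<Prod>e\<in>?I. ennreal (1 + of_bool (\<eta> e) * f e)) \<partial>measure_pmf (iid_pattern k n p))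
     \<le> ennreal (exp (p * (\<Sum>e\<in>?I. f e)))" .
qed

text \<open>The ratio of the binomials is a product of factors \<open>(d - j) / (k - j)\<close>,
  each at most \<open>d / k\<close>. The induction peels off the first factor by absorption and
  compares \<open>d' / k'\<close> with \<open>d / k\<close>.\<close>

lemma choose_minus_le:
  assumes "a \<le> d" "d \<le> k"
  shows "real ((k - a) choose (d - a)) \<le> real (k choose d) * (real d / real k) ^ a"
  using assms
proof (induction a arbitrary: d k)
  case (Suc a)
  then obtain d' k' where d: "d = Suc d'" and k: "k = Suc k'" by (metis Suc_le_D le_trans)
  have le: "real d' / real k' \<le> real (Suc d') / real (Suc k')"
    using Suc.prems unfolding d k by (cases "k' = 0") (auto simp: field_simps)
  have "real ((k' - a) choose (d' - a)) \<le> real (k' choose d') * (real d' / real k') ^ a"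
    using Suc.prems by (intro Suc.IH) (auto simp: d k)
  also have "\<dots> \<le> real (k' choose d') * (real (Suc d') / real (Suc k')) ^ a"
    by (intro mult_left_mono power_mono le) auto
  also have "real (k' choose d') = real (Suc k' choose Suc d') * (real (Suc d') / real (Suc k'))"
  proof -
    have "real (Suc d') * real (Suc k' choose Suc d') = real (Suc k') * real (k' choose d')"
      unfolding of_nat_mult[symmetric] Suc_times_binomial ..
    then show ?thesis by (simp add: field_simps del: binomial_Suc_Suc)
  qed
  finally show ?case unfolding d k by (simp only: diff_Suc_Suc power_Suc mult.assoc)
qed simp

lemma card_supersets:
  assumes "finite B" "A \<subseteq> B" "card A \<le> d"
  shows "card {T. T \<subseteq> B \<and> card T = d \<and> A \<subseteq> T} = (card B - card A) choose (d - card A)"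
proof -
  have finA: "finite A" using assms finite_subset by blast
  have "{T. T \<subseteq> B \<and> card T = d \<and> A \<subseteq> T} = (\<lambda>T. T \<union> A) ` {T. T \<subseteq> B - A \<and> card T = d - card A}"
  proof (intro equalityI subsetI)
    fix T assume T: "T \<in> {T. T \<subseteq> B \<and> card T = d \<and> A \<subseteq> T}"
    then have "card (T - A) = d - card A" using finA by (simp add: card_Diff_subset)
    with T show "T \<in> (\<lambda>T. T \<union> A) ` {T. T \<subseteq> B - A \<and> card T = d - card A}"
      by (intro image_eqI[of _ _ "T - A"]) auto
  next
    fix T assume "T \<in> (\<lambda>T. T \<union> A) ` {T. T \<subseteq> B - A \<and> card T = d - card A}"
    then obtain S where S: "T = S \<union> A" "S \<subseteq> B - A" "card S = d - card A" by auto
    then have "finite S" using assms(1) finite_subset by blast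
    then have "card T = card S + card A" unfolding S(1) using S(2) finA by (intro card_Un_disjoint) auto
    with S assms show "T \<in> {T. T \<subseteq> B \<and> card T = d \<and> A \<subseteq> T}" by auto
  qed
  moreover have "inj_on (\<lambda>T. T \<union> A) {T. T \<subseteq> B - A \<and> card T = d - card A}"
    by (rule inj_onI) blast
  ultimately have "card {T. T \<subseteq> B \<and> card T = d \<and> A \<subseteq> T} = card {T. T \<subseteq> B - A \<and> card T = d - card A}"
    by (simp add: card_image)
  also have "\<dots> = card (B - A) choose (d - card A)" using assms by (intro n_subsets) simp
  finally show ?thesis using assms finA by (simp add: card_Diff_subset)
qed

lemma prod_one_plus_eq:
  fixes f :: "'b \<Rightarrow> real"
  assumes "finite T"
  shows "(\<Prod>u\<in>T. 1 + f u) = (\<Sum>A\<in>Pow T. \<Prod>u\<in>A. f u)"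
  using prod_add[OF assms, of f "\<lambda>_. 1"] by (simp add: add.commute)

text \<open>Expand the product over the subsets \<open>A\<close> of \<open>T\<close>: a uniformly random \<open>T\<close> contains a fixed \<open>A\<close> with
  probability at most \<open>d/k\<close> to the power \<open>card A\<close>, since sampling without replacement is negatively correlated.\<close>

lemma sum_subsets_prod_le:
  fixes f :: "nat \<Rightarrow> real"
  assumes d: "d \<le> k" and f: "\<And>u. 0 \<le> f u"
  shows "(\<Sum>T\<in>{T. T \<subseteq> {..<k} \<and> card T = d}. \<Prod>u\<in>T. 1 + f u)
      \<le> real (k choose d) * exp (real d / real k * (\<Sum>u<k. f u))"
proof -
  let ?S = "{T. T \<subseteq> {..<k} \<and> card T = d}"
  have finS: "finite ?S" by (rule finite_subset[of _ "Pow {..<k}"]) auto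
  have "(\<Sum>T\<in>?S. \<Prod>u\<in>T. 1 + f u) = (\<Sum>T\<in>?S. \<Sum>A\<in>Pow {..<k}. if A \<subseteq> T then \<Prod>u\<in>A. f u else 0)"
  proof (rule sum.cong[OF refl])
    fix T assume T: "T \<in> ?S"
    then have "finite T" using finite_subset by auto
    then have "(\<Prod>u\<in>T. 1 + f u) = (\<Sum>A\<in>Pow T. \<Prod>u\<in>A. f u)" by (rule prod_one_plus_eq)
    also have "\<dots> = (\<Sum>A\<in>Pow {..<k}. if A \<subseteq> T then \<Prod>u\<in>A. f u else 0)"
      using T by (intro sum.mono_neutral_cong_left) auto
    finally show "(\<Prod>u\<in>T. 1 + f u) = (\<Sum>A\<in>Pow {..<k}. if A \<subseteq> T then \<Prod>u\<in>A. f u else 0)" .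
  qed
  also have "\<dots> = (\<Sum>A\<in>Pow {..<k}. \<Sum>T\<in>?S. if A \<subseteq> T then \<Prod>u\<in>A. f u else 0)" by (rule sum.swap)
  also have "\<dots> \<le> (\<Sum>A\<in>Pow {..<k}. real (k choose d) * (\<Prod>u\<in>A. real d / real k * f u))"
  proof (rule sum_mono)
    fix A assume A: "A \<in> Pow {..<k}"
    then have finA: "finite A" using finite_subset by auto
    have nonneg: "0 \<le> (\<Prod>u\<in>A. f u)" using f by (intro prod_nonneg) auto
    have "(\<Sum>T\<in>?S. if A \<subseteq> T then \<Prod>u\<in>A. f u else 0) = (\<Sum>T\<in>{T. T \<subseteq> {..<k} \<and> card T = d \<and> A \<subseteq> T}. \<Prod>u\<in>A. f u)"
      using finS by (intro sum.mono_neutral_cong_right) auto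
    also have "\<dots> = real (card {T. T \<subseteq> {..<k} \<and> card T = d \<and> A \<subseteq> T}) * (\<Prod>u\<in>A. f u)" by simp
    also have "\<dots> \<le> (real (k choose d) * (real d / real k) ^ card A) * (\<Prod>u\<in>A. f u)"
    proof (rule mult_right_mono[OF _ nonneg])
      show "real (card {T. T \<subseteq> {..<k} \<and> card T = d \<and> A \<subseteq> T}) \<le> real (k choose d) * (real d / real k) ^ card A"
      proof (cases "card A \<le> d")
        case True
        have "card {T. T \<subseteq> {..<k} \<and> card T = d \<and> A \<subseteq> T} = (k - card A) choose (d - card A)"
          using card_supersets[of "{..<k}" A d] A True by simp
        then show ?thesis using choose_minus_le[OF True d] by simp
      next
        case False
        have "{T. T \<subseteq> {..<k} \<and> card T = d \<and> A \<subseteq> T} = {}"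
        proof (rule equals0I)
          fix T assume "T \<in> {T. T \<subseteq> {..<k} \<and> card T = d \<and> A \<subseteq> T}"
          then have "finite T" "A \<subseteq> T" "card T = d" using finite_subset by auto
          with False card_mono show False by metis
        qed
        then have "card {T. T \<subseteq> {..<k} \<and> card T = d \<and> A \<subseteq> T} = 0" by (simp only: card.empty)
        then show ?thesis by (simp only: of_nat_0) simp
      qed
    qed
    also have "\<dots> = real (k choose d) * (\<Prod>u\<in>A. real d / real k * f u)"
      unfolding prod.distrib by (simp only: prod_constant mult.assoc)
    finally show "(\<Sum>T\<in>?S. if A \<subseteq> T then \<Prod>u\<in>A. f u else 0) \<le> real (k choose d) * (\<Prod>u\<in>A. real d / real k * f u)" .
  qed
  also have "\<dots> = real (k choose d) * (\<Prod>u<k. 1 + real d / real k * f u)"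
    by (simp add: sum_distrib_left[symmetric] prod_one_plus_eq)
  also have "\<dots> \<le> real (k choose d) * (\<Prod>u<k. exp (real d / real k * f u))"
    using f by (intro mult_left_mono prod_mono conjI exp_ge_add_one_self add_nonneg_nonneg mult_nonneg_nonneg) auto
  also have "\<dots> = real (k choose d) * exp (real d / real k * (\<Sum>u<k. f u))"
    by (simp add: exp_sum sum_distrib_left)
  finally show ?thesis .
qed

lemma fixed_degree_pattern_dominated:
  assumes d: "d \<le> k"
  shows "pattern_dominated k n (real d / real k) (fixed_degree_pattern k n d)"
  unfolding pattern_dominated_def
proof (intro allI impI)
  fix f :: "nat \<times> nat \<Rightarrow> real" assume f: "\<forall>e. 0 \<le> f e"
  let ?I = "{..<k} \<times> {..<n}" and ?S = "{T. T \<subseteq> {..<k} \<and> card T = d}" and ?q = "real d / real k"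
  let ?h = "\<lambda>i T. \<Prod>u<k. ennreal (1 + of_bool (u \<in> T) * f (u, i))"
  have finS: "finite ?S" by (rule finite_subset[of _ "Pow {..<k}"]) auto
  have cardS: "card ?S = k choose d" using n_subsets[of "{..<k}" d] by simp
  have pos: "0 < k choose d" using d by simp
  then have neS: "?S \<noteq> {}" using cardS by (metis card.empty less_irrefl)
  have "(\<integral>\<^sup>+\<eta>. (\<Prod>e\<in>?I. ennreal (1 + of_bool (\<eta> e) * f e)) \<partial>measure_pmf (fixed_degree_pattern k n d))
      = (\<integral>\<^sup>+S. (\<Prod>i<n. ?h i (S i)) \<partial>measure_pmf (Pi_pmf {..<n} {} (\<lambda>_. pmf_of_set ?S)))"
  proof -
    have "(\<Prod>e\<in>?I. ennreal (1 + of_bool ((\<lambda>(u, i). u \<in> S i) e) * f e)) = (\<Prod>i<n. ?h i (S i))" for S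
    proof -
      have "(\<Prod>e\<in>?I. ennreal (1 + of_bool ((\<lambda>(u, i). u \<in> S i) e) * f e))
          = (\<Prod>u<k. \<Prod>i<n. ennreal (1 + of_bool (u \<in> S i) * f (u, i)))"
        unfolding prod.cartesian_product by (intro prod.cong) auto
      also have "\<dots> = (\<Prod>i<n. ?h i (S i))" by (rule prod.swap)
      finally show ?thesis .
    qed
    then show ?thesis unfolding fixed_degree_pattern_def nn_integral_map_pmf by presburger
  qed
  also have "\<dots> = (\<Prod>i<n. \<integral>\<^sup>+T. ?h i T \<partial>measure_pmf (pmf_of_set ?S))"
    by (rule nn_integral_prod_Pi_pmf) simp
  also have "\<dots> \<le> (\<Prod>i<n. ennreal (exp (?q * (\<Sum>u<k. f (u, i)))))"
  proof (rule prod_ennreal_mono)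
    fix i
    have h: "?h i T = ennreal (\<Prod>u\<in>T. 1 + f (u, i))" if "T \<in> ?S" for T
    proof -
      have "?h i T = ennreal (\<Prod>u<k. 1 + of_bool (u \<in> T) * f (u, i))"
        using f by (intro prod_ennreal) auto
      also have "(\<Prod>u<k. 1 + of_bool (u \<in> T) * f (u, i)) = (\<Prod>u\<in>T. 1 + f (u, i))"
        using that by (intro prod.mono_neutral_cong_right) auto
      finally show ?thesis .
    qed
    have "(\<integral>\<^sup>+T. ?h i T \<partial>measure_pmf (pmf_of_set ?S)) = (\<Sum>T\<in>?S. ?h i T) / ennreal (real (card ?S))"
      using neS finS by (simp add: nn_integral_pmf_of_set ennreal_of_nat_eq_real_of_nat)
    also have "(\<Sum>T\<in>?S. ?h i T) = (\<Sum>T\<in>?S. ennreal (\<Prod>u\<in>T. 1 + f (u, i)))"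
      by (intro sum.cong refl h)
    also have "\<dots> = ennreal (\<Sum>T\<in>?S. \<Prod>u\<in>T. 1 + f (u, i))"
      using f by (intro sum_ennreal prod_nonneg) auto
    also have "\<dots> / ennreal (real (card ?S)) = ennreal ((\<Sum>T\<in>?S. \<Prod>u\<in>T. 1 + f (u, i)) / real (k choose d))"
      unfolding cardS using f pos by (intro divide_ennreal sum_nonneg prod_nonneg) auto
    also have "\<dots> \<le> ennreal (exp (?q * (\<Sum>u<k. f (u, i))))"
      using sum_subsets_prod_le[OF d, of "\<lambda>u. f (u, i)"] f pos
      by (intro ennreal_leI) (simp add: divide_le_eq mult.commute)
    finally show "(\<integral>\<^sup>+T. ?h i T \<partial>measure_pmf (pmf_of_set ?S)) \<le> ennreal (exp (?q * (\<Sum>u<k. f (u, i))))" .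
  qed
  also have "\<dots> = ennreal (exp (?q * (\<Sum>i<n. \<Sum>u<k. f (u, i))))"
    by (simp add: prod_ennreal_exp sum_distrib_left)
  also have "(\<Sum>i<n. \<Sum>u<k. f (u, i)) = (\<Sum>e\<in>?I. f e)"
    by (subst sum.swap) (simp add: sum.cartesian_product)
  finally show "(\<integral>\<^sup>+\<eta>. (\<Prod>e\<in>?I. ennreal (1 + of_bool (\<eta> e) * f e)) \<partial>measure_pmf (fixed_degree_pattern k n d))
     \<le> ennreal (exp (?q * (\<Sum>e\<in>?I. f e)))" .
qed

text \<open>The pairs of a block and a column are independent, and for one pair at most one factor
  of the product differs from 1. Averaging over the \<open>k/s\<close> positions gives 1 plus
  \<open>s/k\<close> times the sum of \<open>f\<close> over the block, and
  \<open>1 + x \<le> exp x\<close> concludes.\<close>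

lemma sparse_stack_pattern_dominated:
  assumes blk: "equal_blocks k s blk" and s: "s dvd k" "0 < k"
  shows "pattern_dominated k n (real s / real k) (sparse_stack_pattern k n s blk)"
  unfolding pattern_dominated_def
proof (intro allI impI)
  fix f :: "nat \<times> nat \<Rightarrow> real" assume f: "\<forall>e. 0 \<le> f e"
  let ?I = "{..<k} \<times> {..<n}" and ?q = "real s / real k"
  let ?h = "\<lambda>(l, i) p. \<Prod>u\<in>blk l. ennreal (1 + of_bool (u = p) * f (u, i))"
  have disj: "disjoint_family_on blk {..<s}" and un: "(\<Union>l<s. blk l) = {..<k}"
    and card: "\<And>l. l < s \<Longrightarrow> card (blk l) = k div s"
    using blk by (auto simp: equal_blocks_def)
  have s0: "0 < s" using s by (metis dvd_0_left_iff gr0I)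
  have b0: "0 < k div s" using s s0 by (auto simp: dvd_def)
  have fin: "finite (blk l)" if "l < s" for l
    using un that by (metis UN_upper finite_lessThan finite_subset lessThan_iff)
  have split: "(\<Prod>u<k. g u) = (\<Prod>l<s. \<Prod>u\<in>blk l. g u)" for g :: "nat \<Rightarrow> ennreal"
    unfolding un[symmetric] using fin disj
    by (intro prod.UNION_disjoint) (auto simp: disjoint_family_on_def)
  have splits: "(\<Sum>u<k. g u) = (\<Sum>l<s. \<Sum>u\<in>blk l. g u)" for g :: "nat \<Rightarrow> real"
    unfolding un[symmetric] using fin disj
    by (intro sum.UNION_disjoint) (auto simp: disjoint_family_on_def)
  have "(\<integral>\<^sup>+\<eta>. (\<Prod>e\<in>?I. ennreal (1 + of_bool (\<eta> e) * f e)) \<partial>measure_pmf (sparse_stack_pattern k n s blk))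
      = (\<integral>\<^sup>+pos. (\<Prod>e\<in>{..<s} \<times> {..<n}. ?h e (pos e))
          \<partial>measure_pmf (Pi_pmf ({..<s} \<times> {..<n}) 0 (\<lambda>(l, i). pmf_of_set (blk l))))"
  proof -
    have "(\<Prod>e\<in>?I. ennreal (1 + of_bool ((\<lambda>(u, i). \<exists>l<s. u \<in> blk l \<and> u = pos (l, i)) e) * f e))
       = (\<Prod>e\<in>{..<s} \<times> {..<n}. ?h e (pos e))" for pos :: "nat \<times> nat \<Rightarrow> nat"
    proof -
      have "(\<Prod>e\<in>?I. ennreal (1 + of_bool ((\<lambda>(u, i). \<exists>l<s. u \<in> blk l \<and> u = pos (l, i)) e) * f e))
          = (\<Prod>u<k. \<Prod>i<n. ennreal (1 + of_bool (\<exists>l<s. u \<in> blk l \<and> u = pos (l, i)) * f (u, i)))"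
        unfolding prod.cartesian_product by (intro prod.cong) auto
      also have "\<dots> = (\<Prod>l<s. \<Prod>u\<in>blk l. \<Prod>i<n. ennreal (1 + of_bool (\<exists>l<s. u \<in> blk l \<and> u = pos (l, i)) * f (u, i)))"
        by (rule split)
      also have "\<dots> = (\<Prod>l<s. \<Prod>u\<in>blk l. \<Prod>i<n. ennreal (1 + of_bool (u = pos (l, i)) * f (u, i)))"
      proof (intro prod.cong refl)
        fix l u i assume l: "l \<in> {..<s}" and u: "u \<in> blk l"
        have "(\<exists>l'<s. u \<in> blk l' \<and> u = pos (l', i)) \<longleftrightarrow> u = pos (l, i)"
        proof
          assume "\<exists>l'<s. u \<in> blk l' \<and> u = pos (l', i)"
          then obtain l' where l': "l' < s" "u \<in> blk l'" "u = pos (l', i)" by blast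
          then have "l' = l" using disj l u by (auto simp: disjoint_family_on_def)
          with l' show "u = pos (l, i)" by simp
        qed (use l u in blast)
        then show "ennreal (1 + of_bool (\<exists>l<s. u \<in> blk l \<and> u = pos (l, i)) * f (u, i))
          = ennreal (1 + of_bool (u = pos (l, i)) * f (u, i))" by simp
      qed
      also have "\<dots> = (\<Prod>l<s. \<Prod>i<n. \<Prod>u\<in>blk l. ennreal (1 + of_bool (u = pos (l, i)) * f (u, i)))"
        by (intro prod.cong refl prod.swap)
      also have "\<dots> = (\<Prod>(l, i)\<in>{..<s} \<times> {..<n}. \<Prod>u\<in>blk l. ennreal (1 + of_bool (u = pos (l, i)) * f (u, i)))"
        by (rule prod.cartesian_product)
      also have "\<dots> = (\<Prod>e\<in>{..<s} \<times> {..<n}. ?h e (pos e))"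
        by (intro prod.cong) auto
      finally show ?thesis .
    qed
    then show ?thesis unfolding sparse_stack_pattern_def nn_integral_map_pmf by presburger
  qed
  also have "\<dots> = (\<Prod>e\<in>{..<s} \<times> {..<n}. \<integral>\<^sup>+p. ?h e p \<partial>measure_pmf ((\<lambda>(l, i). pmf_of_set (blk l)) e))"
    by (rule nn_integral_prod_Pi_pmf) simp
  also have "\<dots> \<le> (\<Prod>e\<in>{..<s} \<times> {..<n}. ennreal (exp (?q * (\<Sum>u\<in>blk (fst e). f (u, snd e)))))"
  proof (rule prod_ennreal_mono)
    fix e assume "e \<in> {..<s} \<times> {..<n}"
    then obtain l i where e: "e = (l, i)" and l: "l < s" by auto
    have ne: "blk l \<noteq> {}" using card[OF l] b0 by auto
    have h: "?h e p = ennreal (1 + f (p, i))" if p: "p \<in> blk l" for p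
    proof -
      have "?h e p = (\<Prod>u\<in>blk l. if u = p then ennreal (1 + f (p, i)) else 1)"
        unfolding e by (auto intro!: prod.cong)
      then show ?thesis using p fin[OF l] by simp
    qed
    have "(\<integral>\<^sup>+p. ?h e p \<partial>measure_pmf (pmf_of_set (blk l))) = (\<Sum>p\<in>blk l. ?h e p) / ennreal (real (k div s))"
      using nn_integral_pmf_of_set[OF ne fin[OF l], of "?h e"]
      by (simp only: card[OF l] ennreal_of_nat_eq_real_of_nat)
    also have "(\<Sum>p\<in>blk l. ?h e p) = (\<Sum>p\<in>blk l. ennreal (1 + f (p, i)))"
      by (intro sum.cong refl h)
    also have "\<dots> = ennreal (\<Sum>p\<in>blk l. 1 + f (p, i))"
      using f by (intro sum_ennreal) auto
    also have "\<dots> / ennreal (real (k div s)) = ennreal ((\<Sum>p\<in>blk l. 1 + f (p, i)) / real (k div s))"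
      using f b0 by (intro divide_ennreal sum_nonneg) auto
    also have "(\<Sum>p\<in>blk l. 1 + f (p, i)) / real (k div s) = 1 + ?q * (\<Sum>u\<in>blk l. f (u, i))"
      using b0 s s0 by (simp add: sum.distrib card[OF l] real_of_nat_div field_simps)
    also have "ennreal \<dots> \<le> ennreal (exp (?q * (\<Sum>u\<in>blk l. f (u, i))))"
      by (intro ennreal_leI exp_ge_add_one_self)
    finally show "(\<integral>\<^sup>+p. ?h e p \<partial>measure_pmf ((\<lambda>(l, i). pmf_of_set (blk l)) e))
        \<le> ennreal (exp (?q * (\<Sum>u\<in>blk (fst e). f (u, snd e))))"
      by (simp add: e)
  qed
  also have "\<dots> = ennreal (exp (?q * (\<Sum>e\<in>{..<s} \<times> {..<n}. \<Sum>u\<in>blk (fst e). f (u, snd e))))"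
    by (simp add: prod_ennreal_exp sum_distrib_left)
  also have "(\<Sum>e\<in>{..<s} \<times> {..<n}. \<Sum>u\<in>blk (fst e). f (u, snd e)) = (\<Sum>e\<in>?I. f e)"
  proof -
    have "(\<Sum>e\<in>{..<s} \<times> {..<n}. \<Sum>u\<in>blk (fst e). f (u, snd e)) = (\<Sum>(l, i)\<in>{..<s} \<times> {..<n}. \<Sum>u\<in>blk l. f (u, i))"
      by (intro sum.cong) auto
    also have "\<dots> = (\<Sum>l<s. \<Sum>i<n. \<Sum>u\<in>blk l. f (u, i))"
      by (rule sum.cartesian_product[symmetric])
    also have "\<dots> = (\<Sum>l<s. \<Sum>u\<in>blk l. \<Sum>i<n. f (u, i))" by (intro sum.cong refl sum.swap)
    also have "\<dots> = (\<Sum>u<k. \<Sum>i<n. f (u, i))" by (rule splits[symmetric])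
    also have "\<dots> = (\<Sum>e\<in>?I. f e)" by (simp add: sum.cartesian_product)
    finally show ?thesis .
  qed
  finally show "(\<integral>\<^sup>+\<eta>. (\<Prod>e\<in>?I. ennreal (1 + of_bool (\<eta> e) * f e)) \<partial>measure_pmf (sparse_stack_pattern k n s blk))
     \<le> ennreal (exp (?q * (\<Sum>e\<in>?I. f e)))" .
qed

section \<open>Exponential moments of the entries\<close>

abbreviation entry_space :: "nat \<Rightarrow> nat \<Rightarrow> (nat \<times> nat \<Rightarrow> bool) pmf \<Rightarrow> real measure
    \<Rightarrow> ((nat \<times> nat \<Rightarrow> bool) \<times> (nat \<times> nat \<Rightarrow> real)) measure" where
  "entry_space k n P \<mu> \<equiv> measure_pmf P \<Otimes>\<^sub>M PiM ({..<k} \<times> {..<n}) (\<lambda>_. \<mu>)"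

text \<open>For negative \<open>x\<close> the claim \<open>exp (- t) + t \<le> exp t - t\<close> is
  \<open>t \<le> sinh t\<close>, proved by differentiation; on nonnegative arguments
  \<open>exp x - x\<close> is increasing.\<close>

lemma exp_minus_id_le: "\<bar>x\<bar> \<le> y \<Longrightarrow> exp x - x \<le> exp y - (y :: real)"
proof -
  assume xy: "\<bar>x\<bar> \<le> y"
  have 1: "exp x - x \<le> exp \<bar>x\<bar> - \<bar>x\<bar>"
  proof (cases "0 \<le> x")
    case False
    define t where "t = - x"
    have t: "0 \<le> t" using False by (simp add: t_def)
    have "exp (- t) + t \<le> exp t - t"
    proof -
      have "\<exists>D. ((\<lambda>t. exp t - t - (exp (- t) + t)) has_real_derivative D) (at s) \<and> 0 \<le> D" if "0 \<le> s" "s \<le> t" for s :: real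
      proof (intro exI conjI)
        show "((\<lambda>t. exp t - t - (exp (- t) + t)) has_real_derivative (exp s - 1 - (- exp (- s) + 1))) (at s)"
          by (auto intro!: derivative_eq_intros)
        show "0 \<le> exp s - 1 - (- exp (- s) + 1)"
          using exp_ge_add_one_self[of s] exp_ge_add_one_self[of "- s"] by linarith
      qed
      from DERIV_nonneg_imp_nondecreasing[OF t, of "\<lambda>t. exp t - t - (exp (- t) + t)"] this
      show ?thesis by auto
    qed
    with False show ?thesis by (simp add: t_def)
  qed simp
  have "1 \<le> exp \<bar>x\<bar>" by simp
  have "y - \<bar>x\<bar> \<le> exp (y - \<bar>x\<bar>) - 1" using exp_ge_add_one_self[of "y - \<bar>x\<bar>"] by linarith
  also have "\<dots> \<le> exp \<bar>x\<bar> * (exp (y - \<bar>x\<bar>) - 1)"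
    using mult_right_mono[OF \<open>1 \<le> exp \<bar>x\<bar>\<close>, of "exp (y - \<bar>x\<bar>) - 1"] xy by simp
  also have "\<dots> = exp y - exp \<bar>x\<bar>" by (simp add: right_diff_distrib flip: exp_add)
  finally show ?thesis using 1 by linarith
qed

text \<open>Mean zero allows \<open>c * x\<close> to be subtracted under the integral. The integrand
  \<open>exp (c * x) - c * x\<close> is then bounded pointwise, with the extreme value at
  \<open>|c|\<close>.\<close>

lemma centered_mgf_le:
  assumes "centered_bounded_law \<mu>"
  shows "(\<integral>\<^sup>+x. ennreal (exp (c * x)) \<partial>\<mu>) \<le> ennreal (exp \<bar>c\<bar> - \<bar>c\<bar>)"
proof -
  interpret prob_space \<mu> using assms by (simp add: centered_bounded_law_def)
  have sets[measurable_cong]: "sets \<mu> = sets borel" and bd: "AE x in \<mu>. \<bar>x\<bar> \<le> 1" and mean: "(\<integral>x. x \<partial>\<mu>) = 0"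
    using assms by (simp_all add: centered_bounded_law_def)
  have id: "integrable \<mu> (\<lambda>x. x)"
    by (rule integrable_const_bound[where B = 1]) (use bd in auto)
  have bd': "AE x in \<mu>. exp (c * x) - c * x \<le> exp \<bar>c\<bar> - \<bar>c\<bar>"
    using bd
  proof eventually_elim
    case (elim x)
    then have "\<bar>c * x\<bar> \<le> \<bar>c\<bar>" by (simp add: abs_mult mult_left_le)
    then show ?case by (rule exp_minus_id_le)
  qed
  have int: "integrable \<mu> (\<lambda>x. exp (c * x))"
  proof (rule integrable_const_bound[where B = "exp \<bar>c\<bar>"])
    show "AE x in \<mu>. norm (exp (c * x)) \<le> exp \<bar>c\<bar>"
      using bd
    proof eventually_elim
      case (elim x)
      then have "\<bar>c * x\<bar> \<le> \<bar>c\<bar>" by (simp add: abs_mult mult_left_le)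
      then show ?case by simp
    qed
  qed measurable
  have "(\<integral>x. exp (c * x) \<partial>\<mu>) = (\<integral>x. exp (c * x) - c * x \<partial>\<mu>)"
    using int id mean by simp
  also have "\<dots> \<le> (\<integral>x. exp \<bar>c\<bar> - \<bar>c\<bar> \<partial>\<mu>)"
    using bd' int id by (intro integral_mono_AE) auto
  also have "\<dots> = exp \<bar>c\<bar> - \<bar>c\<bar>" by (simp add: prob_space)
  finally have "(\<integral>x. exp (c * x) \<partial>\<mu>) \<le> exp \<bar>c\<bar> - \<bar>c\<bar>" .
  then show ?thesis using int by (subst nn_integral_eq_integral) (auto intro: ennreal_leI)
qed

lemma sparse_entries_entry_space:
  assumes \<mu>: "centered_bounded_law \<mu>" and q: "0 \<le> q" and P: "pattern_dominated k n q P"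
  shows "sparse_entries (entry_space k n P \<mu>) k n q
    (\<lambda>\<omega> e. of_bool (fst \<omega> e) * snd \<omega> e) (\<lambda>\<omega> e. of_bool (fst \<omega> e))"
proof -
  let ?I = "{..<k} \<times> {..<n}"
  have p\<mu>: "prob_space \<mu>" and sets: "sets \<mu> = sets borel"
    using \<mu> by (simp_all add: centered_bounded_law_def)
  interpret L: prob_space \<mu> by (rule p\<mu>)
  interpret prod: product_sigma_finite "\<lambda>_. \<mu>" by unfold_locales
  interpret PI: prob_space "PiM ?I (\<lambda>_. \<mu>)" using p\<mu> by (intro prob_space_PiM) auto
  interpret PP: pair_prob_space "measure_pmf P" "PiM ?I (\<lambda>_. \<mu>)" ..
  interpret prob_space "entry_space k n P \<mu>" by (rule PP.prob_space_axioms)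
  have fst_m: "(\<lambda>\<omega>. of_bool (fst \<omega> e) :: real) \<in> borel_measurable (entry_space k n P \<mu>)" for e
    by (intro measurable_compose[OF measurable_fst]) auto
  have snd_m: "(\<lambda>\<omega>. snd \<omega> e) \<in> borel_measurable (entry_space k n P \<mu>)" if "e \<in> ?I" for e
    using measurable_compose[OF measurable_snd measurable_component_singleton[OF that]]
      measurable_cong_sets[OF refl sets] by blast
  have X_m: "(\<lambda>\<omega>. of_bool (fst \<omega> e) * snd \<omega> e) \<in> borel_measurable (entry_space k n P \<mu>)" if "e \<in> ?I" for e
    using that by (intro borel_measurable_times fst_m snd_m)
  have P': "(\<integral>\<^sup>+\<eta>. (\<Prod>e\<in>?I. ennreal (1 + of_bool (\<eta> e) * f e)) \<partial>measure_pmf P)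
       \<le> ennreal (exp (q * (\<Sum>e\<in>?I. f e)))" if "\<And>e. 0 \<le> f e" for f
    using P[unfolded pattern_dominated_def] that by blast
  show ?thesis
  proof
    fix a :: "nat \<times> nat \<Rightarrow> real"
    let ?f = "\<lambda>e. exp \<bar>a e\<bar> - 1 - \<bar>a e\<bar>"
    have f: "0 \<le> ?f e" for e using exp_ge_add_one_self[of "\<bar>a e\<bar>"] by linarith
    have m: "(\<lambda>\<omega>. ennreal (exp (\<Sum>e\<in>?I. a e * (of_bool (fst \<omega> e) * snd \<omega> e)))) \<in> borel_measurable (entry_space k n P \<mu>)"
      by (intro measurable_compose[OF _ measurable_ennreal] borel_measurable_exp borel_measurable_sum
          borel_measurable_times borel_measurable_const fst_m snd_m)
        (auto intro!: measurable_compose[OF _ borel_measurable_exp] borel_measurable_sum borel_measurable_times fst_m snd_m)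
    have "(\<integral>\<^sup>+\<omega>. ennreal (exp (\<Sum>e\<in>?I. a e * (of_bool (fst \<omega> e) * snd \<omega> e))) \<partial>entry_space k n P \<mu>)
        = (\<integral>\<^sup>+\<eta>. \<integral>\<^sup>+\<xi>. ennreal (exp (\<Sum>e\<in>?I. a e * (of_bool (\<eta> e) * \<xi> e))) \<partial>PiM ?I (\<lambda>_. \<mu>) \<partial>measure_pmf P)"
      using PI.nn_integral_fst[OF m] by simp
    \<comment> \<open>Given the pattern the values are independent, so the inner integral is a
      product; entries outside the support give the factor 1.\<close>
    also have "\<dots> \<le> (\<integral>\<^sup>+\<eta>. (\<Prod>e\<in>?I. ennreal (1 + of_bool (\<eta> e) * ?f e)) \<partial>measure_pmf P)"
    proof (rule nn_integral_mono)
      fix \<eta>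
      have "(\<integral>\<^sup>+\<xi>. ennreal (exp (\<Sum>e\<in>?I. a e * (of_bool (\<eta> e) * \<xi> e))) \<partial>PiM ?I (\<lambda>_. \<mu>))
          = (\<integral>\<^sup>+\<xi>. (\<Prod>e\<in>?I. ennreal (exp ((a e * of_bool (\<eta> e)) * \<xi> e))) \<partial>PiM ?I (\<lambda>_. \<mu>))"
        by (simp add: prod_ennreal_exp mult.assoc)
      also have "\<dots> = (\<Prod>e\<in>?I. \<integral>\<^sup>+x. ennreal (exp ((a e * of_bool (\<eta> e)) * x)) \<partial>\<mu>)"
      proof (rule prod.product_nn_integral_prod)
        show "(\<lambda>x. ennreal (exp ((a e * of_bool (\<eta> e)) * x))) \<in> borel_measurable \<mu>" for e
          unfolding measurable_cong_sets[OF sets refl] by measurable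
      qed simp
      also have "\<dots> \<le> (\<Prod>e\<in>?I. ennreal (1 + of_bool (\<eta> e) * ?f e))"
      proof (rule prod_ennreal_mono)
        fix e
        have "(\<integral>\<^sup>+x. ennreal (exp ((a e * of_bool (\<eta> e)) * x)) \<partial>\<mu>)
            \<le> ennreal (exp \<bar>a e * of_bool (\<eta> e)\<bar> - \<bar>a e * of_bool (\<eta> e)\<bar>)"
          by (rule centered_mgf_le[OF \<mu>])
        also have "\<dots> = ennreal (1 + of_bool (\<eta> e) * ?f e)" by (cases "\<eta> e") simp_all
        finally show "(\<integral>\<^sup>+x. ennreal (exp ((a e * of_bool (\<eta> e)) * x)) \<partial>\<mu>) \<le> ennreal (1 + of_bool (\<eta> e) * ?f e)" .
      qed
      finally show "(\<integral>\<^sup>+\<xi>. ennreal (exp (\<Sum>e\<in>?I. a e * (of_bool (\<eta> e) * \<xi> e))) \<partial>PiM ?I (\<lambda>_. \<mu>))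
          \<le> (\<Prod>e\<in>?I. ennreal (1 + of_bool (\<eta> e) * ?f e))" .
    qed
    also have "\<dots> \<le> ennreal (exp (q * (\<Sum>e\<in>?I. ?f e)))" by (rule P'[OF f])
    finally show "(\<integral>\<^sup>+\<omega>. ennreal (exp (\<Sum>e\<in>?I. a e * (of_bool (fst \<omega> e) * snd \<omega> e))) \<partial>entry_space k n P \<mu>)
        \<le> ennreal (exp (q * (\<Sum>e\<in>?I. ?f e)))" .
  next
    fix a :: "nat \<times> nat \<Rightarrow> real" assume a: "\<And>e. 0 \<le> a e"
    have m: "(\<lambda>\<omega>. ennreal (exp (\<Sum>e\<in>?I. a e * of_bool (fst \<omega> e)))) \<in> borel_measurable (entry_space k n P \<mu>)"
      by (intro measurable_compose[OF measurable_fst]) auto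
    have "(\<integral>\<^sup>+\<omega>. ennreal (exp (\<Sum>e\<in>?I. a e * of_bool (fst \<omega> e))) \<partial>entry_space k n P \<mu>)
        = (\<integral>\<^sup>+\<eta>. \<integral>\<^sup>+\<xi>. ennreal (exp (\<Sum>e\<in>?I. a e * of_bool (\<eta> e))) \<partial>PiM ?I (\<lambda>_. \<mu>) \<partial>measure_pmf P)"
      using PI.nn_integral_fst[OF m] by simp
    also have "\<dots> = (\<integral>\<^sup>+\<eta>. ennreal (exp (\<Sum>e\<in>?I. a e * of_bool (\<eta> e))) \<partial>measure_pmf P)"
      by (simp add: PI.emeasure_space_1)
    also have "\<dots> = (\<integral>\<^sup>+\<eta>. (\<Prod>e\<in>?I. ennreal (1 + of_bool (\<eta> e) * (exp (a e) - 1))) \<partial>measure_pmf P)"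
    proof (rule nn_integral_cong)
      fix \<eta>
      have "(\<Prod>e\<in>?I. ennreal (1 + of_bool (\<eta> e) * (exp (a e) - 1))) = (\<Prod>e\<in>?I. ennreal (exp (a e * of_bool (\<eta> e))))"
        by (intro prod.cong refl arg_cong[where f = ennreal]) (simp add: of_bool_def)
      then show "ennreal (exp (\<Sum>e\<in>?I. a e * of_bool (\<eta> e))) = (\<Prod>e\<in>?I. ennreal (1 + of_bool (\<eta> e) * (exp (a e) - 1)))"
        by (simp add: prod_ennreal_exp)
    qed
    also have "\<dots> \<le> ennreal (exp (q * (\<Sum>e\<in>?I. exp (a e) - 1)))"
      using a by (intro P') simp
    finally show "(\<integral>\<^sup>+\<omega>. ennreal (exp (\<Sum>e\<in>?I. a e * of_bool (fst \<omega> e))) \<partial>entry_space k n P \<mu>)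
        \<le> ennreal (exp (q * (\<Sum>e\<in>?I. exp (a e) - 1)))" .
  qed (use q fst_m X_m in auto)
qed

section \<open>Leverage scores and the spectral norm\<close>

lemma euclidean_norm_eq: "euclidean_norm v = sqrt (\<Sum>i<dim_vec v. (v $ i)\<^sup>2)"
  by (simp add: euclidean_norm_def scalar_prod_def power2_eq_square atLeast0LessThan)

lemma spectral_norm_le:
  assumes "\<And>x. x \<in> carrier_vec (dim_col A) \<Longrightarrow> euclidean_norm x \<le> 1 \<Longrightarrow> euclidean_norm (A *\<^sub>v x) \<le> c"
  shows "spectral_norm A \<le> c"
  unfolding spectral_norm_def
proof (rule cSUP_least)
  have "0\<^sub>v (dim_col A) \<in> {x \<in> carrier_vec (dim_col A). euclidean_norm x \<le> 1}"
    by (simp add: euclidean_norm_eq)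
  then show "{x \<in> carrier_vec (dim_col A). euclidean_norm x \<le> 1} \<noteq> {}" by blast
qed (use assms in auto)

definition leverage :: "nat \<Rightarrow> real Matrix.mat \<Rightarrow> nat \<Rightarrow> real" where
  "leverage r U i = (\<Sum>j<r. (U $$ (i, j))\<^sup>2)"

text \<open>Division by 0 sends a vanishing row to the zero vector, so the norm is 0 or 1 and
  scaling by \<open>sqrt (leverage r U i)\<close> recovers the row in every case.\<close>

definition unit_row :: "nat \<Rightarrow> real Matrix.mat \<Rightarrow> nat \<Rightarrow> nat \<Rightarrow> real" where
  "unit_row r U i j = U $$ (i, j) / sqrt (leverage r U i)"

lemma leverage_nonneg: "0 \<le> leverage r U i"
  by (simp add: leverage_def sum_nonneg)

lemma sqrt_leverage_unit_row: "sqrt (leverage r U i) * ip r (unit_row r U i) v = (\<Sum>j<r. U $$ (i, j) * v j)"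
proof (cases "leverage r U i = 0")
  case True
  then have "U $$ (i, j) = 0" if "j < r" for j
    using that by (simp add: leverage_def sum_nonneg_eq_0_iff)
  then show ?thesis using True by simp
next
  case False
  then show ?thesis by (simp add: ip_def unit_row_def sum_distrib_left)
qed

lemma unit_row_norm: "ip r (unit_row r U i) (unit_row r U i) \<le> 1"
proof (cases "leverage r U i = 0")
  case True
  then show ?thesis by (simp add: ip_def unit_row_def)
next
  case False
  have "ip r (unit_row r U i) (unit_row r U i) = (\<Sum>j<r. (U $$ (i, j))\<^sup>2 / leverage r U i)"
    unfolding ip_def using leverage_nonneg[of r U i]
    by (intro sum.cong) (auto simp: unit_row_def power2_eq_square)
  also have "\<dots> = 1" using False by (simp add: sum_divide_distrib[symmetric] leverage_def[symmetric])
  finally show ?thesis by simp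
qed

context
  fixes n r :: nat and V U
  assumes iso: "isometry_with_range n r V U"
begin

lemma isometry_sum: "(\<Sum>i<n. (\<Sum>j<r. U $$ (i, j) * x j)\<^sup>2) = (\<Sum>j<r. (x j)\<^sup>2)"
proof -
  have U: "U \<in> carrier_mat n r" using iso by (simp add: isometry_with_range_def)
  let ?x = "Matrix.vec r x"
  have "(U *\<^sub>v ?x) $ i = (\<Sum>j<r. U $$ (i, j) * x j)" if "i < n" for i
    using U that by (simp add: scalar_prod_def atLeast0LessThan)
  moreover have "euclidean_norm (U *\<^sub>v ?x) = euclidean_norm ?x"
    using iso by (simp add: isometry_with_range_def)
  ultimately show ?thesis using U by (simp add: euclidean_norm_eq)
qed

text \<open>The isometry maps basis vectors to unit vectors, so each column of \<open>U\<close> has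
  squared norm 1.\<close>

lemma leverage_sum: "(\<Sum>i<n. leverage r U i) = real r"
proof -
  have "(\<Sum>i<n. (U $$ (i, j))\<^sup>2) = 1" if j: "j < r" for j
  proof -
    have "(\<Sum>j'<r. U $$ (i, j') * (if j' = j then 1 else 0)) = U $$ (i, j)" for i
      using j by (simp add: if_distrib cong: if_cong)
    moreover have "(\<Sum>j'<r. (if j' = j then 1 else 0 :: real)\<^sup>2) = 1"
      using j by (simp add: if_distrib[of "\<lambda>x. x\<^sup>2"] cong: if_cong)
    ultimately show ?thesis using isometry_sum[of "\<lambda>j'. if j' = j then 1 else 0"] by simp
  qed
  then show ?thesis unfolding leverage_def by (subst sum.swap) simp
qed

text \<open>Apply the isometry to row \<open>i\<close> of \<open>U\<close>: coordinate
  \<open>i\<close> of the image is the leverage itself, and its square is at most the squared norm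
  of the image, which is again the leverage.\<close>

lemma leverage_le_1: "i < n \<Longrightarrow> leverage r U i \<le> 1"
proof -
  assume i: "i < n"
  have "(leverage r U i)\<^sup>2 = (\<Sum>j<r. U $$ (i, j) * U $$ (i, j))\<^sup>2"
    by (simp add: leverage_def power2_eq_square)
  also have "\<dots> \<le> (\<Sum>i'<n. (\<Sum>j<r. U $$ (i', j) * U $$ (i, j))\<^sup>2)"
    using i by (intro member_le_sum[where f = "\<lambda>i'. (\<Sum>j<r. U $$ (i', j) * U $$ (i, j))\<^sup>2"]) auto
  also have "\<dots> = leverage r U i" unfolding isometry_sum leverage_def ..
  finally have "leverage r U i * leverage r U i \<le> 1 * leverage r U i" by (simp add: power2_eq_square)
  moreover have "1 * leverage r U i < leverage r U i * leverage r U i" if "1 < leverage r U i"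
    using that by (intro mult_strict_right_mono) auto
  ultimately show ?thesis by linarith
qed

lemma sparse_frame_columns:
  assumes S: "sparse_entries M k n q X H" and k: "3 \<le> k" "r \<le> k" and K: "k \<le> 4 ^ K" "4 ^ K < 4 * k"
    and J: "J \<subseteq> {..<n}" "real (card J) \<le> nn" "real k \<le> nn"
    and \<rho>: "0 < \<rho>" "\<rho> \<le> 1" "\<rho> * ln (nn / real k) \<le> 1" "real r \<le> real k * \<rho>"
    and le: "\<And>i. i \<in> J \<Longrightarrow> leverage r U i \<le> \<rho>" and D: "ln (real k) \<le> real k * q"
  shows "sparse_frame M k n q X H r K J \<rho> nn (unit_row r U) (leverage r U)"
proof (rule sparse_frame.intro[OF S], unfold_locales)
  have sub: "(\<Sum>i\<in>J. f i) \<le> (\<Sum>i<n. f i)" if "\<And>i. 0 \<le> f i" for f :: "nat \<Rightarrow> real"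
    using J(1) that by (intro sum_mono2) auto
  show "(\<Sum>i\<in>J. leverage r U i) \<le> real k * \<rho>"
    using sub[of "leverage r U"] leverage_sum leverage_nonneg \<rho>(4) by fastforce
  fix v
  have "(\<Sum>i\<in>J. leverage r U i * (ip r (unit_row r U i) v)\<^sup>2) = (\<Sum>i\<in>J. (\<Sum>j<r. U $$ (i, j) * v j)\<^sup>2)"
    unfolding sqrt_leverage_unit_row[symmetric] using leverage_nonneg by (simp add: power_mult_distrib)
  also have "\<dots> \<le> (\<Sum>i<n. (\<Sum>j<r. U $$ (i, j) * v j)\<^sup>2)" by (rule sub) simp
  also have "\<dots> = ip r v v" unfolding isometry_sum by (simp add: ip_def power2_eq_square)
  finally show "(\<Sum>i\<in>J. leverage r U i * (ip r (unit_row r U i) v)\<^sup>2) \<le> ip r v v" .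
qed (use assms unit_row_norm leverage_nonneg in auto)

end

lemma power_four_between:
  assumes "0 < k"
  obtains K where "k \<le> 4 ^ K" "4 ^ K < 4 * (k :: nat)"
proof -
  define K where "K = (LEAST K. k \<le> 4 ^ K)"
  have "Suc m \<le> 4 ^ m" for m :: nat by (induction m) auto
  then have "k \<le> 4 ^ k" by (rule Suc_leD)
  then have le: "k \<le> 4 ^ K" unfolding K_def by (rule LeastI)
  have "4 ^ K < 4 * k"
  proof (cases K)
    case 0
    then show ?thesis using assms by simp
  next
    case (Suc K')
    then have "\<not> k \<le> 4 ^ K'" using not_less_Least[of K' "\<lambda>K. k \<le> 4 ^ K"] by (simp add: K_def)
    then show ?thesis using Suc by simp
  qed
  with le show ?thesis by (rule that)
qed

text \<open>Source of the 12 in \<open>B + 12\<close>: each of the two column blocks costs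
  \<open>n + 2 * k + 2 \<le> 2 * k ^ 10\<close> units of failure probability, and
  \<open>4 * k ^ 10 \<le> k ^ 12\<close>.\<close>

lemma failure_probability_le:
  assumes k: "3 \<le> k" and n: "real n \<le> real k ^ 10"
  shows "2 * ((real n + 2 * real k + 2) * exp (- ((B + 12) * ln (real k)))) \<le> real k powr (- B)"
proof -
  have k3: "3 \<le> real k" using k by simp
  have sq: "real k ^ 2 \<le> real k ^ 10" using k3 by (intro power_increasing) auto
  have "3 * real k \<le> real k * real k" using k3 by (intro mult_right_mono) auto
  with sq k3 have "real n + 2 * real k + 2 \<le> 2 * real k ^ 10"
    using n unfolding power2_eq_square by linarith
  moreover have "2 * 2 \<le> real k ^ 2"
    using k3 power_mono[of 3 "real k" 2] by simp
  then have "real k ^ 10 * (2 * 2) \<le> real k ^ 10 * real k ^ 2" by (intro mult_left_mono) auto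
  ultimately have "2 * (real n + 2 * real k + 2) \<le> real k ^ 12" by (simp flip: power_add)
  then have "2 * (real n + 2 * real k + 2) * real k powr (- (B + 12))
      \<le> real k ^ 12 * real k powr (- (B + 12))" by (intro mult_right_mono) auto
  also have "real k ^ 12 = real k powr 12" using k3 by simp
  also have "real k powr 12 * real k powr (- (B + 12)) = real k powr (- B)"
    by (simp only: powr_add[symmetric]) simp
  finally have "2 * (real n + 2 * real k + 2) * real k powr (- (B + 12)) \<le> real k powr (- B)" .
  moreover have "exp (- ((B + 12) * ln (real k))) = real k powr (- (B + 12))"
    using k3 by (simp add: powr_def algebra_simps)
  ultimately show ?thesis by (simp only: mult.assoc)
qed

text \<open>The columns are split at leverage \<open>r/k\<close>: at most \<open>k\<close> columns lie above it, and below it the row weights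
  are small enough to pay for the \<open>ln (n/k)\<close> in the entropy of the greedy approximation.\<close>

lemma spectral_norm_tail:
  assumes B: "0 \<le> B" and n: "k \<le> n" "n \<le> r ^ 10" and r: "r \<le> k" "3 \<le> r"
    and kr: "real r * (ln (exp 1 * real n / real r))\<^sup>2 \<le> real k"
    and iso: "isometry_with_range n r V U" and \<mu>: "centered_bounded_law \<mu>"
    and q: "0 \<le> q" "ln (real k) \<le> real k * q" and P: "pattern_dominated k n q P"
  shows "\<P>(\<pi> in sparse_entry_law k n P \<mu>.
      spectral_norm (Matrix.mat k n \<pi> * U) > 2 * (2710 + 78 * (B + 12)) * sqrt (real k * q)) \<le> real k powr (- B)"
proof -
  let ?I = "{..<k} \<times> {..<n}" and ?M = "entry_space k n P \<mu>"
  let ?X = "\<lambda>\<omega> e. of_bool (fst \<omega> e) * snd \<omega> e :: real" and ?H = "\<lambda>\<omega> e. of_bool (fst \<omega> e) :: real"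
  define \<beta> where "\<beta> = B + 12"
  define c where "c = (2710 + 78 * \<beta>) * sqrt (real k * q)"
  have \<beta>: "0 \<le> \<beta>" using B by (simp add: \<beta>_def)
  have k3: "3 \<le> k" using r by simp
  have pos: "0 < real k" "0 < real r" "0 < real n" using r n by auto
  have S: "sparse_entries ?M k n q ?X ?H" by (rule sparse_entries_entry_space[OF \<mu> q(1) P])
  interpret S: sparse_entries ?M k n q ?X ?H by (rule S)
  obtain K where K: "k \<le> 4 ^ K" "4 ^ K < 4 * k" using k3 by (auto intro: power_four_between[of k])
  have U: "U \<in> carrier_mat n r" using iso by (simp add: isometry_with_range_def)
  define \<rho> where "\<rho> = real r / real k"
  have \<rho>: "0 < \<rho>" "\<rho> \<le> 1" "real r \<le> real k * \<rho>" using pos r by (simp_all add: \<rho>_def)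
  define J1 where "J1 = {i. i < n \<and> \<rho> \<le> leverage r U i}"
  define J2 where "J2 = {i. i < n \<and> \<not> \<rho> \<le> leverage r U i}"
  have J: "J1 \<subseteq> {..<n}" "J2 \<subseteq> {..<n}" "J1 \<inter> J2 = {}" "J1 \<union> J2 = {..<n}"
    by (auto simp: J1_def J2_def)
  have finJ: "finite J1" "finite J2" using J finite_subset by blast+
  have "real (card J1) * \<rho> \<le> (\<Sum>i\<in>J1. leverage r U i)"
    using sum_mono[of J1 "\<lambda>_. \<rho>" "leverage r U"] by (simp add: J1_def)
  also have "\<dots> \<le> (\<Sum>i<n. leverage r U i)" using J leverage_nonneg by (intro sum_mono2) auto
  also have "\<dots> = real k * \<rho>" using leverage_sum[OF iso] pos by (simp add: \<rho>_def)
  finally have card1: "real (card J1) \<le> real k" using \<rho>(1) by simp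
  have card2: "real (card J2) \<le> real n" using card_mono[OF _ J(2)] by simp
  \<comment> \<open>Here the lower bound on \<open>k\<close> enters: it says
    \<open>\<rho> * L\<^sup>2 \<le> 1\<close>, and \<open>L\<close> is at least 1 and at least
    \<open>ln (n/k)\<close>.\<close>
  have \<rho>_ln: "\<rho> * ln (real n / real k) \<le> 1"
  proof -
    define L where "L = ln (exp 1 * real n / real r)"
    have "L = 1 + ln (real n / real r)" using pos by (simp add: L_def ln_mult ln_div)
    moreover have "0 \<le> ln (real n / real r)" using n r pos by (intro ln_ge_zero) simp
    moreover have "ln (real n / real k) \<le> ln (real n / real r)"
      using pos r n by (intro ln_mono divide_left_mono) auto
    ultimately have L: "1 \<le> L" "ln (real n / real k) \<le> L" by auto
    have "\<rho> * L\<^sup>2 \<le> 1" using kr pos by (simp add: \<rho>_def L_def)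
    moreover have "L \<le> L\<^sup>2" using L by (simp add: power2_eq_square)
    then have "\<rho> * ln (real n / real k) \<le> \<rho> * L\<^sup>2" using L \<rho> by (intro mult_left_mono) auto
    ultimately show ?thesis by linarith
  qed
  \<comment> \<open>With \<open>\<rho> = 1\<close> and \<open>nn = k\<close> the logarithm
    \<open>ln (nn / k)\<close> vanishes, so large leverages do no harm in this block.\<close>
  interpret F1: sparse_frame ?M k n q ?X ?H r K J1 1 "real k" "unit_row r U" "leverage r U"
    by (rule sparse_frame_columns[OF iso S k3 r(1) K J(1) card1])
      (use pos r leverage_le_1[OF iso] q in \<open>auto simp: J1_def\<close>)
  interpret F2: sparse_frame ?M k n q ?X ?H r K J2 \<rho> "real n" "unit_row r U" "leverage r U"
    by (rule sparse_frame_columns[OF iso S k3 r(1) K J(2) card2])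
      (use n \<rho> \<rho>_ln q in \<open>auto simp: J2_def\<close>)
  obtain B1 where B1: "B1 \<in> sets ?M" "S.prob B1 \<le> (real n + 2 * real k + 2) * exp (- (\<beta> * ln (real k)))"
    and F1: "\<And>\<omega> z v. \<omega> \<in> space ?M - B1 \<Longrightarrow> \<forall>p\<in>?I. \<bar>?X \<omega> p\<bar> \<le> ?H \<omega> p \<Longrightarrow>
       (\<Sum>u<k. (z u)\<^sup>2) \<le> 1 \<Longrightarrow> (\<Sum>j<r. (v j)\<^sup>2) \<le> 1 \<Longrightarrow>
       (\<Sum>u<k. \<Sum>i\<in>J1. z u * F1.Y i v * ?X \<omega> (u, i)) \<le> (2710 + 78 * \<beta>) * sqrt F1.D"
    by (rule F1.bilinear_bound[OF \<beta>]) (rule that)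
  obtain B2 where B2: "B2 \<in> sets ?M" "S.prob B2 \<le> (real n + 2 * real k + 2) * exp (- (\<beta> * ln (real k)))"
    and F2: "\<And>\<omega> z v. \<omega> \<in> space ?M - B2 \<Longrightarrow> \<forall>p\<in>?I. \<bar>?X \<omega> p\<bar> \<le> ?H \<omega> p \<Longrightarrow>
       (\<Sum>u<k. (z u)\<^sup>2) \<le> 1 \<Longrightarrow> (\<Sum>j<r. (v j)\<^sup>2) \<le> 1 \<Longrightarrow>
       (\<Sum>u<k. \<Sum>i\<in>J2. z u * F2.Y i v * ?X \<omega> (u, i)) \<le> (2710 + 78 * \<beta>) * sqrt F2.D"
    by (rule F2.bilinear_bound[OF \<beta>]) (rule that)
  have Y: "F1.Y i v = (\<Sum>j<r. U $$ (i, j) * v j)" "F2.Y i v = (\<Sum>j<r. U $$ (i, j) * v j)" for i v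
    unfolding F1.Y_def F2.Y_def by (rule sqrt_leverage_unit_row)+
  \<comment> \<open>The law bounds the values by 1 only almost surely; outside this null set the
    support indicators dominate the entries.\<close>
  define N where "N = {\<omega> \<in> space ?M. \<exists>e\<in>?I. 1 < \<bar>snd \<omega> e\<bar>}"
  have N: "N \<in> sets ?M" "S.prob N = 0"
  proof -
    have p\<mu>: "prob_space \<mu>" and sets: "sets \<mu> = sets borel" and bd: "AE x in \<mu>. \<bar>x\<bar> \<le> 1"
      using \<mu> by (simp_all add: centered_bounded_law_def)
    interpret L: prob_space \<mu> by (rule p\<mu>)
    interpret PI: prob_space "PiM ?I (\<lambda>_. \<mu>)" using p\<mu> by (intro prob_space_PiM) auto
    interpret PP: pair_prob_space "measure_pmf P" "PiM ?I (\<lambda>_. \<mu>)" ..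
    have m: "(\<lambda>\<omega>. snd \<omega> e) \<in> measurable ?M \<mu>" if "e \<in> ?I" for e
      using that by (intro measurable_compose[OF measurable_snd] measurable_component_singleton)
    have m': "{\<omega> \<in> space ?M. 1 < \<bar>snd \<omega> e\<bar>} \<in> sets ?M" if "e \<in> ?I" for e
    proof -
      have "(\<lambda>\<omega>. snd \<omega> e) \<in> borel_measurable ?M" using m[OF that] measurable_cong_sets[OF refl sets] by blast
      then show ?thesis by measurable
    qed
    have Neq: "N = (\<Union>e\<in>?I. {\<omega> \<in> space ?M. 1 < \<bar>snd \<omega> e\<bar>})" by (auto simp: N_def)
    then show "N \<in> sets ?M" using m' by auto
    have "AE \<omega> in ?M. \<bar>snd \<omega> e\<bar> \<le> 1" if e: "e \<in> ?I" for e
    proof -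
      have "AE \<xi> in PiM ?I (\<lambda>_. \<mu>). \<bar>\<xi> e\<bar> \<le> 1"
        by (rule AE_PiM_component) (use p\<mu> e bd in auto)
      moreover have "{\<xi> \<in> space (PiM ?I (\<lambda>_. \<mu>)). \<bar>\<xi> e\<bar> \<le> 1} \<in> sets (PiM ?I (\<lambda>_. \<mu>))"
      proof -
        have "(\<lambda>\<xi>. \<xi> e) \<in> borel_measurable (PiM ?I (\<lambda>_. \<mu>))"
          using measurable_component_singleton[OF e] measurable_cong_sets[OF refl sets] by blast
        then show ?thesis by measurable
      qed
      moreover have "{\<omega> \<in> space ?M. \<bar>snd \<omega> e\<bar> \<le> 1} \<in> sets ?M"
      proof -
        have "(\<lambda>\<omega>. snd \<omega> e) \<in> borel_measurable ?M" using m[OF e] measurable_cong_sets[OF refl sets] by blast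
        then show ?thesis by measurable
      qed
      ultimately show ?thesis
        by (intro PP.AE_pair_measure) (auto simp: case_prod_beta)
    qed
    then have "AE \<omega> in ?M. \<forall>e\<in>?I. \<bar>snd \<omega> e\<bar> \<le> 1" by (intro AE_finite_allI) auto
    then have "AE \<omega> in ?M. \<omega> \<notin> N"
    proof eventually_elim
      case (elim \<omega>)
      then show ?case unfolding N_def using leD by blast
    qed
    with \<open>N \<in> sets ?M\<close> show "S.prob N = 0" by (simp add: S.prob_eq_0)
  qed
  define f where "f = (\<lambda>(\<eta>, \<xi>). \<lambda>ui\<in>?I. of_bool (\<eta> ui) * \<xi> ui :: real)"
  have f: "f \<in> measurable ?M (PiM ?I (\<lambda>_. borel))"
    unfolding f_def case_prod_beta by (intro measurable_restrict S.X_measurable)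
  have law: "sparse_entry_law k n P \<mu> = distr ?M (PiM ?I (\<lambda>_. borel)) f"
    by (simp add: sparse_entry_law_def f_def)
  have good: "spectral_norm (Matrix.mat k n (f \<omega>) * U) \<le> 2 * c" if \<omega>: "\<omega> \<in> space ?M - (B1 \<union> (B2 \<union> N))" for \<omega>
  proof (rule spectral_norm_le)
    let ?A = "Matrix.mat k n (f \<omega>)"
    fix x assume x: "x \<in> carrier_vec (dim_col (?A * U))" and x1: "euclidean_norm x \<le> 1"
    have xr: "dim_vec x = r" using x U by simp
    define y where "y i = (\<Sum>j<r. U $$ (i, j) * x $ j)" for i
    define g where "g u = (\<Sum>i<n. y i * ?X \<omega> (u, i))" for u
    have fX: "f \<omega> e = ?X \<omega> e" if "e \<in> ?I" for e using that by (simp add: f_def case_prod_beta)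
    have "(?A * U) *\<^sub>v x = ?A *\<^sub>v (U *\<^sub>v x)"
      using U xr by (intro assoc_mult_mat_vec) auto
    moreover have "(?A *\<^sub>v (U *\<^sub>v x)) $ u = g u" if "u < k" for u
    proof -
      have "(?A *\<^sub>v (U *\<^sub>v x)) $ u = (\<Sum>i<n. f \<omega> (u, i) * (\<Sum>j<r. U $$ (i, j) * x $ j))"
        using that U xr by (simp add: scalar_prod_def atLeast0LessThan)
      also have "\<dots> = g u" unfolding g_def y_def using that fX by (intro sum.cong) auto
      finally show ?thesis .
    qed
    ultimately have norm: "euclidean_norm ((?A * U) *\<^sub>v x) = sqrt (\<Sum>u<k. (g u)\<^sup>2)"
      by (simp add: euclidean_norm_eq)
    define s where "s = sqrt (\<Sum>u<k. (g u)\<^sup>2)"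
    have s2: "s\<^sup>2 = (\<Sum>u<k. (g u)\<^sup>2)" by (simp add: s_def sum_nonneg)
    have "s \<le> 2 * c"
    proof (cases "s = 0")
      case True
      then show ?thesis using \<beta> q by (simp add: c_def)
    next
      case False
      have s0: "0 < s" using False by (simp add: s_def sum_nonneg order_less_le)
      \<comment> \<open>The normalised image is the dual vector that turns its norm into the
        bilinear form.\<close>
      define z where "z u = g u / s" for u
      have z: "(\<Sum>u<k. (z u)\<^sup>2) \<le> 1"
        using s0 by (simp add: z_def power_divide sum_divide_distrib[symmetric] s2[symmetric])
      have xsq: "(\<Sum>j<r. (x $ j)\<^sup>2) \<le> 1" using x1 xr by (simp add: euclidean_norm_eq)
      have XH: "\<forall>p\<in>?I. \<bar>?X \<omega> p\<bar> \<le> ?H \<omega> p"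
      proof
        fix p assume "p \<in> ?I"
        moreover have "\<omega> \<in> space ?M" "\<omega> \<notin> N" using \<omega> by auto
        ultimately have "\<bar>snd \<omega> p\<bar> \<le> 1" unfolding N_def using not_less by blast
        then show "\<bar>?X \<omega> p\<bar> \<le> ?H \<omega> p" by (simp add: abs_mult)
      qed
      have \<omega>12: "\<omega> \<in> space ?M - B1" "\<omega> \<in> space ?M - B2" using \<omega> by auto
      have "s = s\<^sup>2 / s" using s0 by (simp add: power2_eq_square)
      also have "\<dots> = (\<Sum>u<k. z u * g u)"
        unfolding s2 by (simp add: z_def sum_divide_distrib power2_eq_square)
      also have "\<dots> = (\<Sum>u<k. \<Sum>i<n. z u * y i * ?X \<omega> (u, i))"
        by (simp add: g_def sum_distrib_left mult.assoc)
      also have "\<dots> = (\<Sum>u<k. (\<Sum>i\<in>J1. z u * y i * ?X \<omega> (u, i)) + (\<Sum>i\<in>J2. z u * y i * ?X \<omega> (u, i)))"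
        unfolding J(4)[symmetric] using J(3) finJ by (intro sum.cong refl sum.union_disjoint)
      also have "\<dots> = (\<Sum>u<k. \<Sum>i\<in>J1. z u * y i * ?X \<omega> (u, i)) + (\<Sum>u<k. \<Sum>i\<in>J2. z u * y i * ?X \<omega> (u, i))"
        by (rule sum.distrib)
      also have "\<dots> \<le> c + c"
        using F1[OF \<omega>12(1) XH z xsq] F2[OF \<omega>12(2) XH z xsq]
        unfolding Y F1.D_def F2.D_def y_def[symmetric] c_def by (rule add_mono)
      finally show ?thesis by simp
    qed
    then show "euclidean_norm ((?A * U) *\<^sub>v x) \<le> 2 * c" unfolding norm s_def .
  qed
  let ?E = "{\<pi> \<in> space (sparse_entry_law k n P \<mu>). spectral_norm (Matrix.mat k n \<pi> * U) > 2 * c}"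
  have "measure (sparse_entry_law k n P \<mu>) ?E \<le> real k powr (- B)"
  proof (cases "?E \<in> sets (sparse_entry_law k n P \<mu>)")
    case False
    then show ?thesis by (simp add: measure_notin_sets) \<comment> \<open>non-measurable sets have measure 0\<close>
  next
    case True
    then have E: "?E \<in> sets (PiM ?I (\<lambda>_. borel))" by (simp add: law)
    have "measure (sparse_entry_law k n P \<mu>) ?E = S.prob (f -` ?E \<inter> space ?M)"
      unfolding law by (rule measure_distr[OF f E[unfolded law]])
    also have "\<dots> \<le> S.prob (B1 \<union> (B2 \<union> N))"
    proof (rule S.finite_measure_mono)
      show "f -` ?E \<inter> space ?M \<subseteq> B1 \<union> (B2 \<union> N)"
      proof
        fix \<omega> assume "\<omega> \<in> f -` ?E \<inter> space ?M"
        then show "\<omega> \<in> B1 \<union> (B2 \<union> N)" using good[of \<omega>] by auto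
      qed
      show "B1 \<union> (B2 \<union> N) \<in> sets ?M" using B1(1) B2(1) N(1) by auto
    qed
    also have "\<dots> \<le> S.prob B1 + (S.prob B2 + S.prob N)"
      using B1(1) B2(1) N(1) by (intro order_trans[OF measure_Un_le] add_left_mono measure_Un_le) auto
    also have "\<dots> \<le> 2 * ((real n + 2 * real k + 2) * exp (- (\<beta> * ln (real k))))"
      using B1(2) B2(2) N(2) by linarith
    also have "\<dots> \<le> real k powr (- B)"
      unfolding \<beta>_def
    proof (rule failure_probability_le[OF k3])
      have "n \<le> k ^ 10" using n(2) power_mono[OF r(1), of 10] by linarith
      then have "real n \<le> real (k ^ 10)" by (rule of_nat_mono)
      then show "real n \<le> real k ^ 10" by simp
    qed
    finally show ?thesis .
  qed
  then show ?thesis unfolding c_def \<beta>_def mult.assoc .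
qed

theorem corollary7p6:
  fixes B :: real
  assumes "B \<ge> 1"
  shows "\<exists>C :: real. \<forall>(n :: nat) (k :: nat) (r :: nat) (V :: real Matrix.vec set)
           (U :: real Matrix.mat) (\<mu> :: real measure).
    n \<ge> k \<longrightarrow> k \<ge> r \<longrightarrow> r \<ge> 3 \<longrightarrow> n \<le> r ^ 10 \<longrightarrow>
    real k \<ge> real r * (ln (exp 1 * real n / real r))\<^sup>2 \<longrightarrow>
    subspace_of_dim n r V \<longrightarrow> isometry_with_range n r V U \<longrightarrow> centered_bounded_law \<mu> \<longrightarrow>
      (\<forall>p :: real. ln (real k) / real k \<le> p \<longrightarrow> p \<le> 1 \<longrightarrow>
         \<P>(\<pi> in sparse_entry_law k n (iid_pattern k n p) \<mu>.
            spectral_norm (Matrix.mat k n \<pi> * U) > C * sqrt (real k * p)) \<le> real k powr (- B)) \<and>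
      (\<forall>d :: nat. \<lceil>ln (real k)\<rceil> \<le> int d \<longrightarrow> d \<le> k \<longrightarrow>
         \<P>(\<pi> in sparse_entry_law k n (fixed_degree_pattern k n d) \<mu>.
            spectral_norm (Matrix.mat k n \<pi> * U) > C * sqrt (real d)) \<le> real k powr (- B)) \<and>
      (\<forall>(s :: nat) blk. s dvd k \<longrightarrow> \<lceil>ln (real k)\<rceil> \<le> int s \<longrightarrow> s \<le> k \<longrightarrow> equal_blocks k s blk \<longrightarrow>
         \<P>(\<pi> in sparse_entry_law k n (sparse_stack_pattern k n s blk) \<mu>.
            spectral_norm (Matrix.mat k n \<pi> * U) > C * sqrt (real s)) \<le> real k powr (- B))"
\<comment> \<open>The factor 2 counts the two column blocks, and \<open>B + 12\<close> is the
  confidence exponent that leaves \<open>k powr (- B)\<close> after the union bounds.\<close>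
proof (rule exI[of _ "2 * (2710 + 78 * (B + 12))"], intro allI impI conjI)
  fix n k r :: nat and V :: "real Matrix.vec set" and U :: "real Matrix.mat" and \<mu> :: "real measure"
  assume n: "k \<le> n" and r: "r \<le> k" "3 \<le> r" and nr: "n \<le> r ^ 10"
    and kr: "real r * (ln (exp 1 * real n / real r))\<^sup>2 \<le> real k"
    and iso: "isometry_with_range n r V U" and \<mu>: "centered_bounded_law \<mu>"
  have B: "0 \<le> B" using assms by simp
  have k: "0 < real k" using r by simp
  note tail = spectral_norm_tail[OF B n nr r kr iso \<mu>]
  have ln_k: "0 \<le> ln (real k)" using r by simp
  {
    fix p :: real assume p: "ln (real k) / real k \<le> p" "p \<le> 1"
    have "0 \<le> ln (real k) / real k" using ln_k k by simp
    with p have p0: "0 \<le> p" by linarith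
    have "ln (real k) \<le> real k * p" using p k by (simp add: field_simps)
    from tail[OF p0 this iid_pattern_dominated[OF p0 p(2)]]
    show "\<P>(\<pi> in sparse_entry_law k n (iid_pattern k n p) \<mu>.
            spectral_norm (Matrix.mat k n \<pi> * U) > 2 * (2710 + 78 * (B + 12)) * sqrt (real k * p)) \<le> real k powr (- B)" .
  }
  {
    fix d :: nat assume d: "\<lceil>ln (real k)\<rceil> \<le> int d" "d \<le> k"
    have kd: "real k * (real d / real k) = real d" using k by simp
    have "ln (real k) \<le> real k * (real d / real k)" unfolding kd using d(1) by (simp add: ceiling_le_iff)
    from tail[OF _ this fixed_degree_pattern_dominated[OF d(2)], unfolded kd]
    show "\<P>(\<pi> in sparse_entry_law k n (fixed_degree_pattern k n d) \<mu>.
            spectral_norm (Matrix.mat k n \<pi> * U) > 2 * (2710 + 78 * (B + 12)) * sqrt (real d)) \<le> real k powr (- B)" by simp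
  }
  {
    fix s :: nat and blk assume s: "s dvd k" "\<lceil>ln (real k)\<rceil> \<le> int s" "s \<le> k" and blk: "equal_blocks k s blk"
    have ks: "real k * (real s / real k) = real s" using k by simp
    have "ln (real k) \<le> real k * (real s / real k)" unfolding ks using s(2) by (simp add: ceiling_le_iff)
    from tail[OF _ this sparse_stack_pattern_dominated[OF blk s(1)], unfolded ks] k
    show "\<P>(\<pi> in sparse_entry_law k n (sparse_stack_pattern k n s blk) \<mu>.
            spectral_norm (Matrix.mat k n \<pi> * U) > 2 * (2710 + 78 * (B + 12)) * sqrt (real s)) \<le> real k powr (- B)" by simp
  }
qed

end
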